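(* Let $\Phi_a=\{g_{0,+}\}$, $\Phi_b=\{g_{0,-}\}$, $\Phi_c=\{\bar{w}_{3,[\frac14,\frac12]}\}$, $\Phi_d=\{w_{2,[\frac34,1]}\}$ and $\Phi_e=\{w_{2,[0,1]}\}$. For $\Phi\subset\mathbb{G}$ write $E(\Phi)=\{[g]: g\in\Phi\}$. Consider the collection $\mathcal{M}$ of all sets of equivalence classes of the form $E(\Phi_1)\odot E(\Phi_2)\odot\cdots\odot E(\Phi_n)$, where $n\ge1$ and each $\Phi_i$ is one of $\Phi_a,\Phi_b,\Phi_c,\Phi_d,\Phi_e$. Then $\mathcal{M}$ with the operation $\odot$ is a monoid and is finitely generated. Moreover, the union of all the elements of $\mathcal{M}$ is a set of equivalence classes, and the union of these equivalence classes is $\mathbb{G}$.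
   Context: $\lambda$ is Lebesgue measure on $[0,1]$. A continuous map $h:[0,1]\to[0,1]$ is $\lambda$-preserving if $\lambda(A)=\lambda(h^{-1}(A))$ for every Borel set $A\subseteq[0,1]$. A dyadic number is a rational number whose denominator is an integer power of $2$. $\mathbb{G}$ ($\lambda$-preserving Thompson's monoid) is the set of continuous maps $g$ from $[0,1]$ onto $[0,1]$ such that: $g$ is $\lambda$-preserving; $g$ is piecewise affine; $g$ is differentiable except at finitely many points; the $x$-coordinate of each point of non-differentiability is dyadic; and on every interval where $g$ is differentiable, the derivative is of the form $\pm 2^k$ with $k\in\mathbb{Z}$. Thompson's group $\mathbb{F}$ is the group of piecewise affine homeomorphisms $f$ from $[0,1]$ onto $[0,1]$ that are differentiable except at finitely many points, all with dyadic $x$-coordinate, and whose derivatives where they exist are integer powers of $2$ (so $f$ is increasing). Equivalence relation on $\mathbb{G}$: $g_1\sim g_2$ iff there exist $f_1,f_2\in\mathbb{F}$ with $g_2=f_1\circ g_1\circ f_2$. The class of $g$ is $[g]=\{\hat g\in\mathbb{G}:\hat g\sim g\}$. Operation: for $\Phi_1,\Phi_2\subset\mathbb{G}$, $E(\Phi_1)\odot E(\Phi_2)$ is the set of all equivalence classes $[\hat g_1\circ\hat g_2]$ such that there are $g_1\in\Phi_1$, $g_2\in\Phi_2$ with $\hat g_1\in[g_1]$ and $\hat g_2\in[g_2]$. (The result is again a set of equivalence classes, so $\odot$ can be iterated.) Maps: $g_{0,+}(x)=x$, $g_{0,-}(x)=1-x$. $\bar{w}_{3,[\frac14,\frac12]}$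 equals $x$ outside $[\frac14,\frac12]$ and on $[\frac14,\frac12]$ is continuous piecewise affine with slopes $2,-4,4$ on $[\frac14,\frac38]$, $[\frac38,\frac7{16}]$, $[\frac7{16},\frac12]$ respectively. $w_{2,[\frac34,1]}$ equals $x$ on $[0,\frac34]$ and is continuous with slope $2$ on $[\frac34,\frac78]$ and slope $-2$ on $[\frac78,1]$. $w_{2,[0,1]}(x)=2x$ on $[0,\frac12]$ and $2-2x$ on $[\frac12,1]$. *)

theory Defs
  imports "HOL-Analysis.Analysis" "HOL-Algebra.Group"
begin

text \<open>
  A self-map of the unit interval is a function in \<^term>\<open>extensional {0..1}\<close>, so that
  equality of functions is equality of maps on \<open>[0,1]\<close>; composition is accordingly
  \<^term>\<open>compose {0..1}\<close>. Differentiability at the end points 0 and 1 is one-sided.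
\<close>

definition dyadic :: "real \<Rightarrow> bool" where
  "dyadic x \<longleftrightarrow> (\<exists>(m::int) (n::nat). x = of_int m / 2 ^ n)"

definition lambda_preserving :: "(real \<Rightarrow> real) \<Rightarrow> bool" where
  "lambda_preserving h \<longleftrightarrow>
     (\<forall>A\<in>sets borel. A \<subseteq> {0..1} \<longrightarrow> emeasure lborel A = emeasure lborel (h -` A \<inter> {0..1}))"

definition piecewise_affine :: "(real \<Rightarrow> real) \<Rightarrow> bool" where
  "piecewise_affine g \<longleftrightarrow>
     (\<exists>(n::nat) p. p 0 = 0 \<and> p n = 1 \<and>
        (\<forall>i<n. p i < p (Suc i) \<and> (\<exists>m c. \<forall>x\<in>{p i..p (Suc i)}. g x = m * x + c)))"

definition nondiff_points :: "(real \<Rightarrow> real) \<Rightarrow> real set" where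
  "nondiff_points g = {x \<in> {0..1}. \<not> g differentiable (at x within {0..1})}"

definition thompson_monoid :: "(real \<Rightarrow> real) set" where
  "thompson_monoid =
     {g \<in> extensional {0..1}.
        continuous_on {0..1} g \<and> g ` {0..1} = {0..1} \<and>
        lambda_preserving g \<and> piecewise_affine g \<and>
        finite (nondiff_points g) \<and> (\<forall>x\<in>nondiff_points g. dyadic x) \<and>
        (\<forall>x\<in>{0..1}. \<forall>D. (g has_real_derivative D) (at x within {0..1}) \<longrightarrow>
           (\<exists>k::int. D = 2 powi k \<or> D = - (2 powi k)))}"

definition thompson_group :: "(real \<Rightarrow> real) set" where
  "thompson_group =
     {f \<in> extensional {0..1}.
        (\<exists>f'. homeomorphism {0..1} {0..1} f f') \<and> piecewise_affine f \<and>
        finite (nondiff_points f) \<and> (\<forall>x\<in>nondiff_points f. dyadic x) \<and>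
        (\<forall>x\<in>{0..1}. \<forall>D. (f has_real_derivative D) (at x within {0..1}) \<longrightarrow>
           (\<exists>k::int. D = 2 powi k))}"

definition thompson_equiv :: "(real \<Rightarrow> real) \<Rightarrow> (real \<Rightarrow> real) \<Rightarrow> bool" where
  "thompson_equiv g1 g2 \<longleftrightarrow>
     g1 \<in> thompson_monoid \<and> g2 \<in> thompson_monoid \<and>
     (\<exists>f1\<in>thompson_group. \<exists>f2\<in>thompson_group.
        g2 = compose {0..1} f1 (compose {0..1} g1 f2))"

definition eclass :: "(real \<Rightarrow> real) \<Rightarrow> (real \<Rightarrow> real) set" where
  "eclass g = {h \<in> thompson_monoid. thompson_equiv h g}"

definition eclasses :: "(real \<Rightarrow> real) set \<Rightarrow> (real \<Rightarrow> real) set set" where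
  "eclasses \<Phi> = eclass ` \<Phi>"

text \<open>
  The operation is defined for arbitrary sets of equivalence classes, so that it can be iterated;
  \<open>eprod_eclasses\<close> gives its value on sets of the form \<^term>\<open>eclasses \<Phi>\<close>.
\<close>

definition eprod ::
    "(real \<Rightarrow> real) set set \<Rightarrow> (real \<Rightarrow> real) set set \<Rightarrow> (real \<Rightarrow> real) set set"
    (infixl "\<odot>" 70) where
  "A \<odot> B = {eclass (compose {0..1} h1 h2) |h1 h2. (\<exists>C\<in>A. h1 \<in> C) \<and> (\<exists>C\<in>B. h2 \<in> C)}"

lemma eprod_eclasses:
  "eclasses \<Phi>1 \<odot> eclasses \<Phi>2 =
     {eclass (compose {0..1} h1 h2) |h1 h2.
        \<exists>g1\<in>\<Phi>1. \<exists>g2\<in>\<Phi>2. h1 \<in> eclass g1 \<and> h2 \<in> eclass g2}"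
  unfolding eprod_def eclasses_def by blast

definition g0_plus :: "real \<Rightarrow> real" where
  "g0_plus = (\<lambda>x\<in>{0..1}. x)"

definition g0_minus :: "real \<Rightarrow> real" where
  "g0_minus = (\<lambda>x\<in>{0..1}. 1 - x)"

definition w3_bar :: "real \<Rightarrow> real" where
  "w3_bar = (\<lambda>x\<in>{0..1}.
     if x \<in> {1/4..3/8} then 1/4 + 2 * (x - 1/4)
     else if x \<in> {3/8..7/16} then 1/2 - 4 * (x - 3/8)
     else if x \<in> {7/16..1/2} then 1/4 + 4 * (x - 7/16)
     else x)"

definition w2_right :: "real \<Rightarrow> real" where
  "w2_right = (\<lambda>x\<in>{0..1}.
     if x \<in> {3/4..7/8} then 3/4 + 2 * (x - 3/4)
     else if x \<in> {7/8..1} then 1 - 2 * (x - 7/8)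
     else x)"

definition w2_full :: "real \<Rightarrow> real" where
  "w2_full = (\<lambda>x\<in>{0..1}. if x \<le> 1/2 then 2 * x else 2 - 2 * x)"

definition generating_sets :: "(real \<Rightarrow> real) set set" where
  "generating_sets = {{g0_plus}, {g0_minus}, {w3_bar}, {w2_right}, {w2_full}}"

text \<open>
  Products \<open>E(\<Phi>\<^sub>1) \<odot> \<dots> \<odot> E(\<Phi>\<^sub>n)\<close> with \<open>n \<ge> 1\<close>, bracketed to the left.
\<close>

definition eproducts :: "(real \<Rightarrow> real) set set set" where
  "eproducts =
     {foldl (\<odot>) (eclasses \<Phi>) (map eclasses \<Phi>s) |\<Phi> \<Phi>s.
        \<Phi> \<in> generating_sets \<and> set \<Phi>s \<subseteq> generating_sets}"

definition finitely_generated_monoid :: "('a, 'b) monoid_scheme \<Rightarrow> bool" where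
  "finitely_generated_monoid M \<longleftrightarrow>
     monoid M \<and>
     (\<exists>S. finite S \<and> S \<subseteq> carrier M \<and> (\<forall>H. submonoid H M \<and> S \<subseteq> H \<longrightarrow> H = carrier M))"

end

theory Submission
  imports Defs
begin

text \<open>
  A map in the monoid is \<open>\<lambda>\<close>-preserving, but a composite \<open>f \<circ> g\<close> with \<open>f\<close> in Thompson's group need not be.
  It becomes \<open>\<lambda>\<close>-preserving after composing on the right with the \<open>\<phi>\<close> for which \<open>\<phi>\<^sup>-\<^sup>1\<close> has density
  \<open>f' \<circ> g\<close>, and this density is again a dyadic step function with values powers of 2. Pushing such
  corrections to the right gives associativity of \<open>\<odot>\<close>, and it shows that a map of the monoid lies in
  the union of some product as soon as it is any composite of generators and elements of the group.

  Up to the group acting on the right, a dyadic piecewise linear map is determined by the list of its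
  values at turning points. Such a list is shortened until only \<open>[0, 1]\<close> or \<open>[1, 0]\<close> is left: if an
  end lap is not longer than its neighbour, it is folded away by a map with turning values
  \<open>[p, 0, 1]\<close>; otherwise some inner lap is contained in both of its neighbours, and it is unfolded
  by a map with turning values \<open>[0, q, p, 1]\<close>, \<open>0 < p < q < 1\<close>. Both folds are, up to the group, among
  the generators (or conjugates of them by \<open>x \<mapsto> 1 - x\<close>).
\<close>

section \<open>Dyadic piecewise linear maps\<close>

text \<open>Composition does not descend to classes: the class of
  \<open>h1 \<circ> f \<circ> h2\<close> varies with the group element \<open>f\<close> in the
  middle. This is why \<open>\<odot>\<close> yields sets of classes, and also why five generators
  suffice: a suitable \<open>f\<close> between two factors replaces the constants 3/4, 1/4, 1/2 by
  any others. Indeed the group carries every pair of dyadic points \<open>0 < p < q < 1\<close> to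
  every other such pair, so only the order pattern of the turning values of a fold matters.
  Coincidences with 0 and 1 are part of the pattern, since the group fixes both points. Hence the
  values \<open>[1, 0, 1]\<close> do not arise from a fold with \<open>p < 1\<close> and group
  elements alone; they come from \<open>w2_full\<close>. Orientation is reversed by
  \<open>g0_minus\<close>. A second obstacle is that the definition of the monoid makes only the
  abscissas of break points dyadic, whereas every splitting argument needs dyadic values as well.
  These are obtained from surjectivity: a point where the minimum 0 is attained has to be
  dyadic.\<close>

lemma dyadic_of_int [simp]: "dyadic (of_int m)"
  unfolding dyadic_def by (intro exI[of _ m] exI[of _ 0]) simp

lemma dyadic_0 [simp]: "dyadic 0" and dyadic_1 [simp]: "dyadic 1"
  using dyadic_of_int[of 0] dyadic_of_int[of 1] by simp_all

lemma dyadic_numeral [simp]: "dyadic (numeral n)"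
  using dyadic_of_int[of "numeral n"] by simp

lemma dyadic_add [simp]:
  assumes "dyadic x" "dyadic y" shows "dyadic (x + y)"
proof -
  obtain m n where x: "x = of_int m / 2 ^ n" using assms(1) unfolding dyadic_def by blast
  obtain k l where y: "y = of_int k / 2 ^ l" using assms(2) unfolding dyadic_def by blast
  have "x + y = of_int (m * 2 ^ l + k * 2 ^ n) / 2 ^ (n + l)"
    by (simp add: x y field_simps power_add)
  then show ?thesis unfolding dyadic_def by blast
qed

lemma dyadic_mult [simp]:
  assumes "dyadic x" "dyadic y" shows "dyadic (x * y)"
proof -
  obtain m n where x: "x = of_int m / 2 ^ n" using assms(1) unfolding dyadic_def by blast
  obtain k l where y: "y = of_int k / 2 ^ l" using assms(2) unfolding dyadic_def by blast
  have "x * y = of_int (m * k) / 2 ^ (n + l)"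
    by (simp add: x y power_add)
  then show ?thesis unfolding dyadic_def by blast
qed

lemma dyadic_uminus [simp]: "dyadic x \<Longrightarrow> dyadic (- x)"
  using dyadic_mult[OF dyadic_of_int[of "-1"], of x] by simp

lemma dyadic_diff [simp]: "dyadic x \<Longrightarrow> dyadic y \<Longrightarrow> dyadic (x - y)"
  using dyadic_add[of x "- y"] by simp

lemma dyadic_powi [simp]: "dyadic (2 powi k)"
proof (cases "k \<ge> 0")
  case True
  then have "(2::real) powi k = of_int (2 ^ nat k)" by (simp add: power_int_def)
  then show ?thesis by (metis dyadic_of_int)
next
  case False
  then have "(2::real) powi k = of_int 1 / 2 ^ nat (- k)"
    by (simp add: power_int_def field_simps)
  then show ?thesis unfolding dyadic_def by blast
qed

lemma dyadic_divide_powi [simp]: "dyadic x \<Longrightarrow> dyadic (x / 2 powi k)"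
  using dyadic_mult[OF _ dyadic_powi[of "- k"], of x]
  by (simp add: power_int_minus divide_inverse del: dyadic_powi)

lemma dyadic_divide_numeral_Bit0 [simp]: "dyadic (x / numeral n) \<Longrightarrow> dyadic (x / numeral (num.Bit0 n))"
  using dyadic_divide_powi[of "x / numeral n" 1]
  by (simp add: numeral_Bit0_eq_double[of n] mult.commute)

section \<open>Admissible slopes: powers of 2 and their negatives\<close>

definition Pos :: "real set" where "Pos = range (\<lambda>k::int. 2 powi k)"
definition Neg :: "real set" where "Neg = uminus ` Pos"
definition Sgn :: "real set" where "Sgn = Pos \<union> Neg"

lemma Pos_powi [simp]: "2 powi k \<in> Pos"
  unfolding Pos_def by blast

lemma Pos_pos: "s \<in> Pos \<Longrightarrow> s > 0"
  unfolding Pos_def by auto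

lemma Pos_Sgn: "Pos \<subseteq> Sgn" and Neg_Sgn: "Neg \<subseteq> Sgn"
  unfolding Sgn_def by auto

lemma Pos_mult: "s \<in> Pos \<Longrightarrow> t \<in> Pos \<Longrightarrow> s * t \<in> Pos"
  unfolding Pos_def by (auto simp: power_int_add[symmetric])

lemma Pos_inverse: "s \<in> Pos \<Longrightarrow> inverse s \<in> Pos"
  unfolding Pos_def by (auto simp: power_int_minus[symmetric])

lemma Pos_Neg_mult: "s \<in> Pos \<Longrightarrow> t \<in> Neg \<Longrightarrow> s * t \<in> Neg"
  and Neg_Pos_mult: "t \<in> Neg \<Longrightarrow> s \<in> Pos \<Longrightarrow> t * s \<in> Neg"
  unfolding Neg_def using Pos_mult by (auto simp: mult.commute)

lemma Neg_mult: "s \<in> Neg \<Longrightarrow> t \<in> Neg \<Longrightarrow> s * t \<in> Pos"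
  unfolding Neg_def using Pos_mult by auto

lemma Sgn_mult: "s \<in> Sgn \<Longrightarrow> t \<in> Sgn \<Longrightarrow> s * t \<in> Sgn"
  unfolding Sgn_def using Pos_mult Pos_Neg_mult Neg_Pos_mult Neg_mult by blast

lemma Sgn_iff: "s \<in> Sgn \<longleftrightarrow> (\<exists>k::int. s = 2 powi k \<or> s = - (2 powi k))"
  unfolding Sgn_def Neg_def Pos_def by auto

lemma Sgn_nonzero: "s \<in> Sgn \<Longrightarrow> s \<noteq> 0"
  unfolding Sgn_iff by auto

lemma Sgn_dyadic: "s \<in> Sgn \<Longrightarrow> dyadic s"
  unfolding Sgn_iff by auto

lemma dyadic_divide_Sgn: "dyadic x \<Longrightarrow> s \<in> Sgn \<Longrightarrow> dyadic (x / s)"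
  unfolding Sgn_iff by (auto simp: divide_minus_right simp del: minus_divide_left)

text \<open>Adjacent pieces share their end point, so such maps are continuous.\<close>

inductive dyadic_pl :: "real set \<Rightarrow> (real \<Rightarrow> real) \<Rightarrow> real \<Rightarrow> real \<Rightarrow> bool"
  for S :: "real set" and g :: "real \<Rightarrow> real" where
  affine: "\<lbrakk>dyadic a; dyadic b; a < b; s \<in> S; dyadic c; \<And>x. x \<in> {a..b} \<Longrightarrow> g x = s * x + c\<rbrakk>
    \<Longrightarrow> dyadic_pl S g a b"
| join: "\<lbrakk>dyadic_pl S g a b; dyadic_pl S g b c\<rbrakk> \<Longrightarrow> dyadic_pl S g a c"

lemma dyadic_pl_less: "dyadic_pl S g a b \<Longrightarrow> a < b"
  by (induction rule: dyadic_pl.induct) auto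

lemma dyadic_pl_dyadic: assumes "dyadic_pl S g a b" shows "dyadic a" "dyadic b"
  using assms by (induction rule: dyadic_pl.induct) auto

lemma dyadic_pl_cong:
  assumes "dyadic_pl S g a b" "\<And>x. x \<in> {a..b} \<Longrightarrow> h x = g x" shows "dyadic_pl S h a b"
  using assms
proof (induction rule: dyadic_pl.induct)
  case (affine a b s c)
  then show ?case by (intro dyadic_pl.affine[of a b s S c]) auto
next
  case (join a b c)
  then have "a < b" "b < c" by (auto dest: dyadic_pl_less)
  then show ?case using join by (intro dyadic_pl.join[of S h a b c]) auto
qed

lemma dyadic_pl_mono: "dyadic_pl S g a b \<Longrightarrow> S \<subseteq> T \<Longrightarrow> dyadic_pl T g a b"
  by (induction rule: dyadic_pl.induct) (blast intro: dyadic_pl.intros)+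

lemma dyadic_pl_uminus: "dyadic_pl S g a b \<Longrightarrow> dyadic_pl (uminus ` S) (\<lambda>x. - g x) a b"
proof (induction rule: dyadic_pl.induct)
  case (affine a b s c)
  then show ?case by (intro dyadic_pl.affine[of a b "- s" _ "- c"]) auto
next
  case (join a b c)
  then show ?case by (blast intro: dyadic_pl.join)
qed

lemma dyadic_pl_continuous: "dyadic_pl S g a b \<Longrightarrow> continuous_on {a..b} g"
proof (induction rule: dyadic_pl.induct)
  case (affine a b s c)
  then have "continuous_on {a..b} g \<longleftrightarrow> continuous_on {a..b} (\<lambda>x. s * x + c)"
    by (intro continuous_on_cong) auto
  then show ?case by (auto intro!: continuous_intros)
next
  case (join a b c)
  then have "{a..c} = {a..b} \<union> {b..c}" by (auto dest: dyadic_pl_less)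
  then show ?case using join by (auto intro!: continuous_on_closed_Un)
qed

lemma dyadic_pl_value:
  assumes "dyadic_pl S g a b" "S \<subseteq> Sgn" "x \<in> {a..b}" "dyadic x" shows "dyadic (g x)"
  using assms
proof (induction rule: dyadic_pl.induct)
  case (affine a b s c)
  then show ?case using Sgn_dyadic by auto
next
  case (join a b c)
  then show ?case by (cases "x \<le> b") auto
qed

section \<open>Monotonicity and images of increasing maps\<close>

lemma dyadic_pl_strict_mono:
  assumes "dyadic_pl Pos g a b" shows "strict_mono_on {a..b} g"
  using assms
proof (induction rule: dyadic_pl.induct)
  case (affine a b s c)
  then show ?case by (auto simp: strict_mono_on_def dest: Pos_pos)
next
  case (join a b c)
  have ab: "a < b" "b < c" using join by (auto dest: dyadic_pl_less)
  show ?case unfolding strict_mono_on_def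
  proof (intro allI impI, elim conjE)
    fix r s assume rs: "r \<in> {a..c}" "s \<in> {a..c}" "r < s"
    consider "s \<le> b" | "b \<le> r" | "r < b" "b < s" by linarith
    then show "g r < g s"
    proof cases
      case 3
      then have "g r < g b" "g b < g s"
        using join.IH rs ab unfolding strict_mono_on_def by auto
      then show ?thesis by simp
    qed (use join.IH rs ab in \<open>auto simp: strict_mono_on_def\<close>)
  qed
qed

lemma dyadic_pl_image:
  assumes "dyadic_pl Pos g a b" shows "g ` {a..b} = {g a..g b}"
proof
  have ab: "a < b" using assms by (rule dyadic_pl_less)
  have mono: "mono_on {a..b} g"
    using dyadic_pl_strict_mono[OF assms] by (rule strict_mono_on_imp_mono_on)
  show "g ` {a..b} \<subseteq> {g a..g b}"
    using mono ab by (auto simp: mono_on_def)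
  show "{g a..g b} \<subseteq> g ` {a..b}"
    using IVT'[of g a _ b] dyadic_pl_continuous[OF assms] ab by fastforce
qed

lemma dyadic_pl_image_le:
  assumes "dyadic_pl Pos g a b" "x \<in> {a..b}" shows "g x \<in> {g a..g b}"
  using dyadic_pl_image[OF assms(1)] assms(2) by blast

lemma dyadic_pl_value_less:
  assumes "dyadic_pl Pos g a b" shows "g a < g b"
  using dyadic_pl_strict_mono[OF assms] dyadic_pl_less[OF assms] by (auto simp: strict_mono_on_def)

text \<open>The affine function meets the level \<open>e\<close> at \<open>x0 = (e - c) / s\<close>,
  and \<open>x0\<close> is dyadic because division by a signed power of 2 preserves dyadic numbers.
  The property \<open>P\<close> is left abstract because the same cut serves composition of maps and
  the construction of maps with a given density.\<close>

lemma affine_split_at: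
  fixes g :: "real \<Rightarrow> real"
  assumes ab: "dyadic a" "dyadic b" "a < b" and s: "s \<in> Sgn" and "dyadic c" "dyadic e"
    and g: "\<And>x. x \<in> {a..b} \<Longrightarrow> g x = s * x + c"
    and lo: "\<And>p q. \<lbrakk>dyadic p; dyadic q; p < q; {p..q} \<subseteq> {a..b}; \<And>x. x \<in> {p..q} \<Longrightarrow> g x \<le> e\<rbrakk> \<Longrightarrow> P p q"
    and hi: "\<And>p q. \<lbrakk>dyadic p; dyadic q; p < q; {p..q} \<subseteq> {a..b}; \<And>x. x \<in> {p..q} \<Longrightarrow> e \<le> g x\<rbrakk> \<Longrightarrow> P p q"
    and join: "\<And>p q r. P p q \<Longrightarrow> P q r \<Longrightarrow> P p r"
  shows "P a b"
proof -
  define x0 where "x0 = (e - c) / s"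
  have s0: "s \<noteq> 0" using s by (rule Sgn_nonzero)
  have gx0: "s * x0 + c = e" using s0 by (simp add: x0_def)
  have dx0: "dyadic x0" unfolding x0_def by (intro dyadic_divide_Sgn dyadic_diff assms)
  have le: "g x \<le> e \<longleftrightarrow> s * (x - x0) \<le> 0" if "x \<in> {a..b}" for x
    unfolding g[OF that] gx0[symmetric] by (simp add: algebra_simps)
  have ge: "e \<le> g x \<longleftrightarrow> 0 \<le> s * (x - x0)" if "x \<in> {a..b}" for x
    unfolding g[OF that] gx0[symmetric] by (simp add: algebra_simps)
  have lo': "P p q" if "dyadic p" "dyadic q" "p < q" "a \<le> p" "q \<le> b"
    "\<And>x. x \<in> {p..q} \<Longrightarrow> s * (x - x0) \<le> 0" for p q
    using that by (intro lo) (auto simp: le)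
  have hi': "P p q" if "dyadic p" "dyadic q" "p < q" "a \<le> p" "q \<le> b"
    "\<And>x. x \<in> {p..q} \<Longrightarrow> 0 \<le> s * (x - x0)" for p q
    using that by (intro hi) (auto simp: ge)
  have left: "P p q" if "dyadic p" "dyadic q" "p < q" "a \<le> p" "q \<le> b" "q \<le> x0" for p q
  proof (cases "s > 0")
    case True
    then show ?thesis using that(6) by (intro lo'[OF that(1-5)] mult_nonneg_nonpos) auto
  next
    case False
    then show ?thesis using that(6) by (intro hi'[OF that(1-5)] mult_nonpos_nonpos) auto
  qed
  have right: "P p q" if "dyadic p" "dyadic q" "p < q" "a \<le> p" "q \<le> b" "x0 \<le> p" for p q
  proof (cases "s > 0")
    case True
    then show ?thesis using that(6) by (intro hi'[OF that(1-5)] mult_nonneg_nonneg) auto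
  next
    case False
    then show ?thesis using that(6) by (intro lo'[OF that(1-5)] mult_nonpos_nonneg) auto
  qed
  consider "x0 \<le> a" | "b \<le> x0" | "a < x0" "x0 < b" by linarith
  then show "P a b"
  proof cases
    case 3
    have "P a x0" by (rule left) (use 3 ab dx0 in auto)
    moreover have "P x0 b" by (rule right) (use 3 ab dx0 in auto)
    ultimately show ?thesis by (rule join)
  qed (use ab in \<open>auto intro: left right\<close>)
qed

text \<open>Induction on the outer map: at a break point \<open>e\<close> of \<open>f\<close> the
  interval is cut where \<open>g\<close> takes the value \<open>e\<close>. The slope sets
  \<open>S\<close>, \<open>T\<close>, \<open>R\<close> are parameters so that increasing, decreasing
  and general maps are covered at once.\<close>

lemma dyadic_pl_comp_affine:
  assumes "dyadic_pl T f u v" "dyadic a" "dyadic b" "a < b" "s \<in> S" "dyadic c"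
    "\<And>x. x \<in> {a..b} \<Longrightarrow> g x = s * x + c" "g ` {a..b} \<subseteq> {u..v}" "S \<subseteq> Sgn" "T \<subseteq> Sgn"
    "\<And>s t. s \<in> S \<Longrightarrow> t \<in> T \<Longrightarrow> t * s \<in> R"
  shows "dyadic_pl R (\<lambda>x. f (g x)) a b"
  using assms
proof (induction arbitrary: a b rule: dyadic_pl.induct)
  case (affine u v t d)
  show ?case
  proof (rule dyadic_pl.affine[of a b "t * s" _ "t * c + d"])
    fix x assume "x \<in> {a..b}"
    moreover then have "g x \<in> {u..v}" using affine by blast
    ultimately show "f (g x) = t * s * x + (t * c + d)"
      using affine by (simp add: algebra_simps)
  next
    have "t \<in> Sgn" using affine by blast
    then show "dyadic (t * c + d)" using affine Sgn_dyadic by simp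
  qed (use affine in auto)
next
  case (join u e v)
  have s: "s \<in> Sgn" using join.prems(4,8) by blast
  have e: "dyadic e" using join.hyps(1) by (rule dyadic_pl_dyadic)
  have guv: "g x \<in> {u..v}" if "x \<in> {a..b}" for x using join.prems(7) that by blast
  show ?case
  proof (rule affine_split_at[of a b s c e g, OF join.prems(1-3) s join.prems(5) e join.prems(6)])
    fix p q assume pq: "dyadic p" "dyadic q" "p < q" "{p..q} \<subseteq> {a..b}" and "\<And>x. x \<in> {p..q} \<Longrightarrow> g x \<le> e"
    then have im: "g ` {p..q} \<subseteq> {u..e}" using guv by fastforce
    show "dyadic_pl R (\<lambda>x. f (g x)) p q"
      by (rule join.IH(1)[OF pq(1-3) join.prems(4,5,6) im join.prems(8-10)]) (use pq in auto)
  next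
    fix p q assume pq: "dyadic p" "dyadic q" "p < q" "{p..q} \<subseteq> {a..b}" and "\<And>x. x \<in> {p..q} \<Longrightarrow> e \<le> g x"
    then have im: "g ` {p..q} \<subseteq> {e..v}" using guv by fastforce
    show "dyadic_pl R (\<lambda>x. f (g x)) p q"
      by (rule join.IH(2)[OF pq(1-3) join.prems(4,5,6) im join.prems(8-10)]) (use pq in auto)
  qed (blast intro: dyadic_pl.join)+
qed

lemma dyadic_pl_comp:
  assumes "dyadic_pl S g a b" "g ` {a..b} \<subseteq> {u..v}" "dyadic_pl T f u v" "S \<subseteq> Sgn" "T \<subseteq> Sgn"
    "\<And>s t. s \<in> S \<Longrightarrow> t \<in> T \<Longrightarrow> t * s \<in> R"
  shows "dyadic_pl R (\<lambda>x. f (g x)) a b"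
  using assms
proof (induction rule: dyadic_pl.induct)
  case (affine a b s c)
  show ?case
    by (rule dyadic_pl_comp_affine[of T f u v a b s S c g]) (use affine in auto)
next
  case (join a b c)
  have "a < b" "b < c" using join by (auto dest: dyadic_pl_less)
  then have "g ` {a..b} \<subseteq> {u..v}" "g ` {b..c} \<subseteq> {u..v}"
    using join.prems(1) by auto
  then show ?case using join by (blast intro: dyadic_pl.join)
qed

text \<open>An arbitrary left inverse \<open>h\<close> is allowed, because the same \<open>h\<close>
  then serves on both halves in the joining step; an inverse formed from the interval would change
  with it.\<close>

lemma dyadic_pl_inverse:
  assumes "dyadic_pl Pos f a b" "\<And>x. x \<in> {a..b} \<Longrightarrow> h (f x) = x"
  shows "dyadic_pl Pos h (f a) (f b)"
  using assms
proof (induction rule: dyadic_pl.induct)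
  case (affine a b s c)
  have s: "s > 0" "s \<in> Sgn" using affine Pos_pos Pos_Sgn by auto
  have f: "f a = s * a + c" "f b = s * b + c" using affine by auto
  show ?case
  proof (rule dyadic_pl.affine[of _ _ "inverse s" _ "- (c / s)"])
    fix y assume y: "y \<in> {f a..f b}"
    define x where "x = (y - c) / s"
    have "x \<in> {a..b}" using y s f by (auto simp: x_def field_simps)
    moreover then have "f x = y" using affine s by (simp add: x_def)
    ultimately have "h y = x" using affine by blast
    then show "h y = inverse s * y + - (c / s)" using s by (simp add: x_def field_simps)
  qed (use affine s f Sgn_dyadic in \<open>auto intro: Pos_inverse dyadic_uminus dyadic_divide_Sgn\<close>)
next
  case (join a b c)
  have "a < b" "b < c" using join.hyps by (auto dest: dyadic_pl_less)
  then have "dyadic_pl Pos h (f a) (f b)" "dyadic_pl Pos h (f b) (f c)"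
    by (intro join.IH join.prems; simp)+
  then show ?case by (rule dyadic_pl.join)
qed

lemma dyadic_pl_the_inv_into:
  assumes "dyadic_pl Pos f a b"
  shows "dyadic_pl Pos (the_inv_into {a..b} f) (f a) (f b)"
proof (rule dyadic_pl_inverse[OF assms])
  fix x assume "x \<in> {a..b}"
  then show "the_inv_into {a..b} f (f x) = x"
    using the_inv_into_f_f strict_mono_on_imp_inj_on[OF dyadic_pl_strict_mono[OF assms]] by metis
qed

lemma dyadic_pl_glue:
  assumes "dyadic_pl S f a b" "dyadic_pl S g b c" "f b = g b"
  shows "dyadic_pl S (\<lambda>x. if x \<le> b then f x else g x) a c"
proof (rule dyadic_pl.join[of _ _ a b c])
  show "dyadic_pl S (\<lambda>x. if x \<le> b then f x else g x) a b"
    by (rule dyadic_pl_cong[OF assms(1)]) auto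
  show "dyadic_pl S (\<lambda>x. if x \<le> b then f x else g x) b c"
    by (rule dyadic_pl_cong[OF assms(2)]) (use assms(3) in auto)
qed

text \<open>
  A dyadic interval splits into \<open>n\<close> intervals whose lengths are powers of 2 for every large \<open>n\<close>, so two
  dyadic intervals have such subdivisions with equally many parts, which are matched affinely.
\<close>

fun powi_chain :: "nat \<Rightarrow> real \<Rightarrow> real \<Rightarrow> bool" where
  "powi_chain 0 a b \<longleftrightarrow> a = b"
| "powi_chain (Suc n) a b \<longleftrightarrow> (\<exists>k::int. powi_chain n (a + 2 powi k) b)"

text \<open>Halving the first part gives one part more. The chain has to be nonempty, hence
  \<open>Suc n\<close>.\<close>

lemma powi_chain_Suc: "powi_chain (Suc n) a b \<Longrightarrow> powi_chain (Suc (Suc n)) a b"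
proof -
  assume "powi_chain (Suc n) a b"
  then obtain k :: int where k: "powi_chain n (a + 2 powi k) b" by auto
  have "(2::real) powi k = 2 powi (k - 1) + 2 powi (k - 1)"
    by (simp add: power_int_diff)
  then have "powi_chain n (a + 2 powi (k - 1) + 2 powi (k - 1)) b"
    using k by (simp only: add.assoc)
  then show ?thesis unfolding powi_chain.simps by blast
qed

lemma powi_chain_le:
  assumes "powi_chain n a b" "0 < n" "n \<le> m" shows "powi_chain m a b"
  using assms(3,1,2)
proof (induction rule: dec_induct)
  case (step m)
  then obtain m' where "m = Suc m'" by (cases m) auto
  then show ?case using step powi_chain_Suc by blast
qed

text \<open>The length is \<open>m / 2 ^ n\<close> with \<open>m > 0\<close>, so \<open>m\<close>
  equal parts of length \<open>2 powi (- n)\<close> do.\<close>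

lemma powi_chain_exists:
  assumes "dyadic a" "dyadic b" "a < b" shows "\<exists>n>0. powi_chain n a b"
proof -
  obtain m n where mn: "b - a = of_int m / 2 ^ n"
    using dyadic_diff[OF assms(2,1)] unfolding dyadic_def by blast
  have "of_int m > (0::real)" using mn assms(3) zero_less_divide_iff[of "of_int m" "(2::real) ^ n"] by simp
  then have m: "m > 0" by simp
  have chain: "powi_chain l x (x + of_nat l / 2 ^ n)" for l x
  proof (induction l arbitrary: x)
    case (Suc l)
    have "powi_chain l (x + 2 powi (- int n)) (x + 2 powi (- int n) + of_nat l / 2 ^ n)"
      by (rule Suc)
    moreover have "x + 2 powi (- int n) + of_nat l / 2 ^ n = x + of_nat (Suc l) / 2 ^ n"
      by (simp add: power_int_minus field_simps)
    ultimately show ?case by auto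
  qed simp
  have "b = a + of_nat (nat m) / 2 ^ n" using mn m by simp
  then have "powi_chain (nat m) a b" using chain by metis
  then show ?thesis using m by (intro exI[of _ "nat m"]) simp
qed

lemma dyadic_pl_powi_chain:
  assumes "powi_chain (Suc n) a b" "powi_chain (Suc n) c d" "dyadic a" "dyadic c"
  shows "\<exists>f. dyadic_pl Pos f a b \<and> f a = c \<and> f b = d"
  using assms
proof (induction n arbitrary: a c)
  case 0
  then obtain k l :: int where kl: "b = a + 2 powi k" "d = c + 2 powi l" by auto
  define f where "f = (\<lambda>x. 2 powi (l - k) * x + (c - 2 powi (l - k) * a))"
  have "dyadic_pl Pos f a b"
    by (rule dyadic_pl.affine[of _ _ "2 powi (l - k)" _ "c - 2 powi (l - k) * a"])
      (use 0 kl in \<open>auto simp: f_def\<close>)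
  moreover have "(2::real) powi (l - k) * 2 powi k = 2 powi l" by (simp add: power_int_diff)
  then have "f a = c" "f b = d" by (auto simp: f_def kl algebra_simps)
  ultimately show ?case by blast
next
  case (Suc n)
  then obtain k l :: int where kl: "powi_chain (Suc n) (a + 2 powi k) b"
    "powi_chain (Suc n) (c + 2 powi l) d" by (metis powi_chain.simps(2))
  then obtain g where g: "dyadic_pl Pos g (a + 2 powi k) b" "g (a + 2 powi k) = c + 2 powi l" "g b = d"
    using Suc.IH[OF kl] Suc.prems by auto
  define f where "f = (\<lambda>x. 2 powi (l - k) * x + (c - 2 powi (l - k) * a))"
  have f: "dyadic_pl Pos f a (a + 2 powi k)"
    by (rule dyadic_pl.affine[of _ _ "2 powi (l - k)" _ "c - 2 powi (l - k) * a"])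
      (use Suc.prems in \<open>auto simp: f_def\<close>)
  have "(2::real) powi (l - k) * 2 powi k = 2 powi l" by (simp add: power_int_diff)
  then have fb: "f a = c" "f (a + 2 powi k) = c + 2 powi l"
    by (auto simp: f_def algebra_simps)
  have "a + 2 powi k < b" using dyadic_pl_less[OF g(1)] .
  moreover have "a < a + 2 powi k" using dyadic_pl_less[OF f] .
  moreover have "dyadic_pl Pos (\<lambda>x. if x \<le> a + 2 powi k then f x else g x) a b"
    by (rule dyadic_pl_glue[OF f g(1)]) (use fb g in simp)
  ultimately show ?case
    using fb g by (intro exI[of _ "\<lambda>x. if x \<le> a + 2 powi k then f x else g x"]) auto
qed

lemma dyadic_pl_interpolate:
  assumes "dyadic a" "dyadic b" "a < b" "dyadic c" "dyadic d" "c < d"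
  obtains f where "dyadic_pl Pos f a b" "f a = c" "f b = d"
proof -
  obtain n m where nm: "n > 0" "powi_chain n a b" "m > 0" "powi_chain m c d"
    using powi_chain_exists assms by meson
  then have "powi_chain (Suc (n + m)) a b" "powi_chain (Suc (n + m)) c d"
    by (auto intro: powi_chain_le simp del: powi_chain.simps)
  then show ?thesis using dyadic_pl_powi_chain assms that by blast
qed

section \<open>Characterisation of the Thompson group and monoid\<close>

lemma has_real_derivative_unique_interval:
  fixes f :: "real \<Rightarrow> real"
  assumes "(f has_real_derivative D) (at x within {a..b})" "(f has_real_derivative E) (at x within {a..b})"
    "a < b" "x \<in> {a..b}"
  shows "D = E"
  using vector_derivative_unique_within_closed_interval[of a b x f D E] assms
  by (simp add: has_real_derivative_iff_has_vector_derivative)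

lemma affine_has_real_derivative:
  assumes "\<And>x. x \<in> {a..b} \<Longrightarrow> g x = s * x + c" "x \<in> {a..b}"
  shows "(g has_real_derivative s) (at x within {a..b})"
proof (rule has_field_derivative_transform_within[of "\<lambda>x. s * x + c" s x "{a..b}" 1])
  show "((\<lambda>x. s * x + c) has_real_derivative s) (at x within {a..b})"
    by (auto intro!: derivative_eq_intros)
qed (use assms in auto)

text \<open>A derivative within \<open>X\<close> restricts to the piece, where it is unique even at
  an end point. So a derivative at a point shared by two pieces equals both of their slopes.\<close>

lemma affine_derivative_unique:
  assumes "\<And>x. x \<in> {a..b} \<Longrightarrow> g x = s * x + c" "x \<in> {a..b}" "a < b" "{a..b} \<subseteq> X"
    "(g has_real_derivative D) (at x within X)"
  shows "D = s"
  using has_real_derivative_unique_interval[OF DERIV_subset[OF assms(5,4)]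
      affine_has_real_derivative[OF assms(1,2)] assms(3,2)] .

lemma dyadic_pl_derivative:
  assumes "dyadic_pl S g a b" "x \<in> {a..b}" "(g has_real_derivative D) (at x within {a..b})"
  shows "D \<in> S"
  using assms
proof (induction rule: dyadic_pl.induct)
  case (affine a b s c)
  have "D = s" by (rule affine_derivative_unique[OF _ affine.prems(1) _ _ affine.prems(2)]) (use affine in auto)
  then show ?case using affine by simp
next
  case (join a b c)
  have ab: "a < b" "b < c" using join.hyps by (auto dest: dyadic_pl_less)
  show ?case
  proof (cases "x \<le> b")
    case True
    then show ?thesis using join.prems ab by (intro join.IH(1) DERIV_subset[OF join.prems(2)]) auto
  next
    case False
    then show ?thesis using join.prems ab by (intro join.IH(2) DERIV_subset[OF join.prems(2)]) auto
  qed
qed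

lemma dyadic_pl_differentiable:
  assumes "dyadic_pl S g a b"
  shows "\<exists>P. finite P \<and> (\<forall>p\<in>P. dyadic p) \<and> (\<forall>x\<in>{a..b} - P. g differentiable (at x))"
  using assms
proof (induction rule: dyadic_pl.induct)
  case (affine a b s c)
  have "g differentiable (at x)" if "x \<in> {a..b} - {a, b}" for x
  proof -
    have x: "x \<in> {a<..<b}" using that by auto
    have "((\<lambda>x. s * x + c) has_real_derivative s) (at x)"
      by (auto intro!: derivative_eq_intros)
    then have "(g has_real_derivative s) (at x)"
      by (rule has_field_derivative_transform_within_open[OF _ _ x]) (use affine in auto)
    then show ?thesis by (auto simp: real_differentiable_def)
  qed
  then show ?case using affine by (intro exI[of _ "{a, b}"]) auto
next
  case (join a b c)
  obtain P where P: "finite P" "\<forall>p\<in>P. dyadic p" "\<forall>x\<in>{a..b} - P. g differentiable (at x)"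
    using join.IH(1) by blast
  obtain Q where Q: "finite Q" "\<forall>p\<in>Q. dyadic p" "\<forall>x\<in>{b..c} - Q. g differentiable (at x)"
    using join.IH(2) by blast
  have "\<forall>x\<in>{a..c} - (P \<union> Q). g differentiable (at x)"
  proof
    fix x assume x: "x \<in> {a..c} - (P \<union> Q)"
    then show "g differentiable (at x)" using P(3) Q(3) by (cases "x \<le> b") auto
  qed
  then show ?case using P Q by (intro exI[of _ "P \<union> Q"]) auto
qed

lemma dyadic_pl_nondiff_points:
  assumes "dyadic_pl S g 0 1"
  shows "finite (nondiff_points g)" "\<forall>x\<in>nondiff_points g. dyadic x"
proof -
  obtain P where P: "finite P" "\<forall>p\<in>P. dyadic p" "\<forall>x\<in>{0..1} - P. g differentiable (at x)"
    using dyadic_pl_differentiable[OF assms] by blast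
  have "nondiff_points g \<subseteq> P"
    unfolding nondiff_points_def using P(3) by (auto dest: differentiable_at_withinI)
  then show "finite (nondiff_points g)" "\<forall>x\<in>nondiff_points g. dyadic x"
    using P by (auto intro: finite_subset)
qed

lemma dyadic_pl_piecewise_affine:
  assumes "dyadic_pl S g a b"
  shows "\<exists>(n::nat) p. p 0 = a \<and> p n = b \<and>
    (\<forall>i<n. p i < p (Suc i) \<and> (\<exists>m c. \<forall>x\<in>{p i..p (Suc i)}. g x = m * x + c))"
  using assms
proof (induction rule: dyadic_pl.induct)
  case (affine a b s c)
  then show ?case
    by (intro exI[of _ 1] exI[of _ "\<lambda>i. if i = 0 then a else b"]) auto
next
  case (join a b c)
  obtain n p where p: "p 0 = a" "p (n::nat) = b"
    "\<And>i. i < n \<Longrightarrow> p i < p (Suc i) \<and> (\<exists>m c. \<forall>x\<in>{p i..p (Suc i)}. g x = m * x + c)"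
    using join.IH(1) by blast
  obtain k q where q: "q 0 = b" "q (k::nat) = c"
    "\<And>i. i < k \<Longrightarrow> q i < q (Suc i) \<and> (\<exists>m c. \<forall>x\<in>{q i..q (Suc i)}. g x = m * x + c)"
    using join.IH(2) by blast
  define r where "r i = (if i \<le> n then p i else q (i - n))" for i
  have "r i < r (Suc i) \<and> (\<exists>m c. \<forall>x\<in>{r i..r (Suc i)}. g x = m * x + c)" if "i < n + k" for i
  proof (cases "i < n")
    case True
    then show ?thesis using p(3)[of i] by (simp add: r_def)
  next
    case False
    then have "r i = q (i - n)" "r (Suc i) = q (Suc (i - n))"
      using p(2) q(1) by (auto simp: r_def Suc_diff_le)
    then show ?thesis using q(3)[of "i - n"] False that by simp
  qed
  moreover have "r 0 = a" "r (n + k) = c" using p q by (auto simp: r_def)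
  ultimately show ?case by blast
qed

lemma dyadic_pl_add_const:
  assumes "dyadic_pl S h a b" "dyadic e" "\<And>x. x \<in> {a..b} \<Longrightarrow> g x = h x + e"
  shows "dyadic_pl S g a b"
  using assms
proof (induction rule: dyadic_pl.induct)
  case (affine a b s c)
  then show ?case by (intro dyadic_pl.affine[of a b s _ "c + e"]) auto
next
  case (join a b c)
  have "a < b" "b < c" using join.hyps by (auto dest: dyadic_pl_less)
  then show ?case
    by (intro dyadic_pl.join[of _ _ a b c] join.IH join.prems) auto
qed

text \<open>The alternative \<open>d = 0\<close> stands for an empty initial part. The intercept
  \<open>c\<close> is dyadic because \<open>h d = s * d + c\<close> and \<open>h d\<close>,
  \<open>s\<close>, \<open>d\<close> are dyadic.\<close>

lemma dyadic_pl_extend_affine: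
  assumes "d = 0 \<or> dyadic_pl S h 0 d" "h 0 = 0" "dyadic d" "dyadic q" "d < q" "s \<in> S" "S \<subseteq> Sgn"
    "\<And>x. x \<in> {d..q} \<Longrightarrow> h x = s * x + c"
  shows "dyadic_pl S h 0 q"
proof -
  have "dyadic (h d)" using assms(1)
  proof
    assume "dyadic_pl S h 0 d"
    from dyadic_pl_less[OF this] show ?thesis
      by (intro dyadic_pl_value[of S h 0 d] assms \<open>dyadic_pl S h 0 d\<close>) auto
  qed (use assms(2) in simp)
  moreover have "h d = s * d + c" using assms(5,8) by simp
  moreover have "dyadic s" using assms(6,7) Sgn_dyadic by blast
  ultimately have "dyadic c" using dyadic_diff[of "h d" "s * d"] assms(3) by simp
  then have "dyadic_pl S h d q" by (intro dyadic_pl.affine[of d q s _ c]) (use assms in auto)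
  then show ?thesis using assms(1) dyadic_pl.join by blast
qed

text \<open>The partition supplied by \<open>piecewise_affine\<close> may contain points that are
  not dyadic. At such a point the map is differentiable, so the slopes on both sides agree and the
  two pieces merge. Subtracting \<open>g 0\<close> lets the induction start from the dyadic value
  0.\<close>

lemma piecewise_affine_dyadic_pl_diff:
  assumes pa: "piecewise_affine g" and nd: "\<And>x. x \<in> nondiff_points g \<Longrightarrow> dyadic x"
    and der: "\<And>x D. x \<in> {0..1} \<Longrightarrow> (g has_real_derivative D) (at x within {0..1}) \<Longrightarrow> D \<in> S"
    and S: "S \<subseteq> Sgn"
  shows "dyadic_pl S (\<lambda>x. g x - g 0) 0 1"
proof -
  define h where "h x = g x - g 0" for x
  obtain n p where p: "p 0 = 0" "p (n::nat) = 1" "\<And>i. i < n \<Longrightarrow> p i < p (Suc i)"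
    and aff: "\<And>i. i < n \<Longrightarrow> \<exists>m c. \<forall>x\<in>{p i..p (Suc i)}. g x = m * x + c"
    using pa unfolding piecewise_affine_def by blast
  have mono: "p i \<le> p j" if "i \<le> j" "j \<le> n" for i j
    using that
  proof (induction j rule: dec_induct)
    case (step j)
    then show ?case using p(3)[of j] by simp
  qed simp
  have I: "{p i..p (Suc i)} \<subseteq> {0..1}" if "i < n" for i
    using mono[of 0 i] mono[of "Suc i" n] p that by auto
  have h0: "h 0 = 0" by (simp add: h_def)
  have derh: "D \<in> S" if "x \<in> {0..1}" "(h has_real_derivative D) (at x within {0..1})" for x D
  proof -
    have "((\<lambda>x. h x + g 0) has_real_derivative D) (at x within {0..1})"
      using DERIV_add[OF that(2) DERIV_const[of "g 0"]] by simp
    then show ?thesis using der[OF that(1)] by (simp add: h_def)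
  qed
  have affh: "\<exists>s c. s \<in> S \<and> (\<forall>x\<in>{p i..p (Suc i)}. h x = s * x + c)" if "i < n" for i
  proof -
    obtain m c where m: "\<And>x. x \<in> {p i..p (Suc i)} \<Longrightarrow> g x = m * x + c" using aff[OF \<open>i < n\<close>] by blast
    define x where "x = (p i + p (Suc i)) / 2"
    have x: "x \<in> {p i<..<p (Suc i)}" using p(3)[OF that] by (auto simp: x_def)
    have "((\<lambda>x. m * x + c) has_real_derivative m) (at x)"
      by (auto intro!: derivative_eq_intros)
    then have "(g has_real_derivative m) (at x)"
      by (rule has_field_derivative_transform_within_open[OF _ _ x]) (use m in auto)
    then have "m \<in> S" using der[of x m] x I[OF that] by (auto intro: has_field_derivative_at_within)
    then show ?thesis using m by (intro exI[of _ m] exI[of _ "c - g 0"]) (auto simp: h_def)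
  qed
  \<comment> \<open>Invariant: \<open>d\<close> is 0 or the last point of non-differentiability met
    so far, and a single affine piece reaches from \<open>d\<close> to
    \<open>p (Suc i)\<close>.\<close>
  have "\<exists>d s c. dyadic d \<and> d \<le> p i \<and> 0 \<le> d \<and> (d = 0 \<or> dyadic_pl S h 0 d) \<and> s \<in> S \<and>
      (\<forall>x\<in>{d..p (Suc i)}. h x = s * x + c)" if "i < n" for i
    using that
  proof (induction i)
    case 0
    obtain s c where "s \<in> S" "\<forall>x\<in>{p 0..p (Suc 0)}. h x = s * x + c" using affh[OF 0] by blast
    then show ?case using p(1) by (intro exI[of _ 0] exI[of _ s] exI[of _ c]) auto
  next
    case (Suc i)
    have "i < n" using Suc.prems by simp
    then obtain d s c where d: "dyadic d" "d \<le> p i" "0 \<le> d" "d = 0 \<or> dyadic_pl S h 0 d" "s \<in> S"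
      "\<And>x. x \<in> {d..p (Suc i)} \<Longrightarrow> h x = s * x + c" using Suc.IH by blast
    obtain s' c' where s': "s' \<in> S" "\<And>x. x \<in> {p (Suc i)..p (Suc (Suc i))} \<Longrightarrow> h x = s' * x + c'"
      using affh[OF Suc.prems] by blast
    define q where "q = p (Suc i)"
    have lt: "d < q" "q < p (Suc (Suc i))" "q \<in> {0..1}"
      using d p(3)[of i] p(3)[of "Suc i"] Suc.prems I[OF Suc.prems] by (auto simp: q_def)
    show ?case
    proof (cases "q \<in> nondiff_points g")
      case True
      then have "dyadic q" by (rule nd)
      moreover have "dyadic_pl S h 0 q"
        by (rule dyadic_pl_extend_affine[of d S h q s c]) (use d lt h0 S \<open>dyadic q\<close> in \<open>auto simp: q_def\<close>)
      ultimately show ?thesis using lt s'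
        by (intro exI[of _ q] exI[of _ s'] exI[of _ c']) (auto simp: q_def)
    next
      case False
      then have "g differentiable (at q within {0..1})" using lt by (auto simp: nondiff_points_def)
      then obtain D where "(g has_real_derivative D) (at q within {0..1})"
        by (auto simp: real_differentiable_def)
      then have D: "(h has_real_derivative D) (at q within {0..1})"
        unfolding h_def by (auto intro!: derivative_eq_intros)
      have "D = s"
        by (rule affine_derivative_unique[of d q h s c q "{0..1}"])
          (use lt d D in \<open>auto simp: q_def\<close>)
      moreover have "D = s'"
        by (rule affine_derivative_unique[of q "p (Suc (Suc i))" h s' c' q "{0..1}"])
          (use lt s' D I[OF Suc.prems] in \<open>auto simp: q_def\<close>)
      ultimately have "s' = s" by simp
      moreover have "h q = s * q + c" "h q = s' * q + c'"
        using d(6)[of q] s'(2)[of q] lt by (auto simp: q_def)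
      ultimately have "c' = c" by simp
      have "h x = s * x + c" if "x \<in> {d..p (Suc (Suc i))}" for x
        using that d(6)[of x] s'(2)[of x] \<open>s' = s\<close> \<open>c' = c\<close> by (cases "x \<le> p (Suc i)") auto
      moreover have "d \<le> p (Suc i)" using lt by (simp add: q_def)
      ultimately show ?thesis using d by (intro exI[of _ d] exI[of _ s] exI[of _ c]) auto
    qed
  qed
  moreover obtain n' where n': "n = Suc n'" using p(1,2) by (cases n) auto
  ultimately obtain d s c where d: "dyadic d" "d \<le> p n'" "0 \<le> d" "d = 0 \<or> dyadic_pl S h 0 d" "s \<in> S"
      "\<And>x. x \<in> {d..1} \<Longrightarrow> h x = s * x + c"
    using p(2) by (metis lessI)
  have "d < 1" using d(2) p(2) p(3)[of n'] n' by auto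
  then have "dyadic_pl S h 0 1" using d S h0 by (intro dyadic_pl_extend_affine[of d S h 1 s c]) auto
  then show ?thesis unfolding h_def .
qed

text \<open>Let \<open>g x0 = 0\<close>. If \<open>x0\<close> were an interior point of
  differentiability, the derivative at this minimum would be 0, which is not a signed power of 2. So
  \<open>x0\<close> is an end point or a break point, hence dyadic, and the dyadic difference
  \<open>g x0 - g 0\<close> shows that \<open>g 0\<close> is dyadic.\<close>

lemma piecewise_affine_dyadic_pl:
  assumes pa: "piecewise_affine g" and nd: "\<And>x. x \<in> nondiff_points g \<Longrightarrow> dyadic x"
    and der: "\<And>x D. x \<in> {0..1} \<Longrightarrow> (g has_real_derivative D) (at x within {0..1}) \<Longrightarrow> D \<in> S"
    and S: "S \<subseteq> Sgn" and im: "g ` {0..1} = {0..1}"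
  shows "dyadic_pl S g 0 1"
proof -
  have d: "dyadic_pl S (\<lambda>x. g x - g 0) 0 1" by (rule piecewise_affine_dyadic_pl_diff) fact+
  obtain x0 where x0: "x0 \<in> {0..1}" "g x0 = 0" using im by (metis atLeastAtMost_iff image_iff order_refl zero_le_one)
  have "dyadic x0"
  proof (cases "x0 = 0 \<or> x0 = 1 \<or> x0 \<in> nondiff_points g")
    case True
    then show ?thesis using nd by auto
  next
    case False
    then have x: "0 < x0" "x0 < 1" using x0 by auto
    have at: "at x0 within {0..1} = at x0" using x by (simp add: at_within_Icc_at)
    have "g differentiable (at x0 within {0..1})" using False x0 by (auto simp: nondiff_points_def)
    then obtain D where D: "(g has_real_derivative D) (at x0 within {0..1})"
      by (auto simp: real_differentiable_def)
    have "D = 0"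
    proof (rule DERIV_local_min)
      show "DERIV g x0 :> D" using D at by simp
      show "0 < min x0 (1 - x0)" using x by simp
      show "\<forall>y. \<bar>x0 - y\<bar> < min x0 (1 - x0) \<longrightarrow> g x0 \<le> g y"
      proof (intro allI impI)
        fix y assume "\<bar>x0 - y\<bar> < min x0 (1 - x0)"
        then have "y \<in> {0..1}" by auto
        then show "g x0 \<le> g y" using im x0 by (metis atLeastAtMost_iff imageI)
      qed
    qed
    then show ?thesis using der[OF x0(1) D] S Sgn_nonzero by blast
  qed
  then have "dyadic (g x0 - g 0)" by (rule dyadic_pl_value[OF d S x0(1)])
  then have "dyadic (g 0)" using dyadic_uminus[of "g x0 - g 0"] x0(2) by simp
  then show ?thesis by (rule dyadic_pl_add_const[OF d]) simp
qed

lemma thompson_monoid_iff: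
  "g \<in> thompson_monoid \<longleftrightarrow>
    g \<in> extensional {0..1} \<and> dyadic_pl Sgn g 0 1 \<and> g ` {0..1} = {0..1} \<and> lambda_preserving g"
proof
  assume g: "g \<in> thompson_monoid"
  have "dyadic_pl Sgn g 0 1"
    by (rule piecewise_affine_dyadic_pl) (use g in \<open>auto simp: thompson_monoid_def Sgn_iff\<close>)
  then show "g \<in> extensional {0..1} \<and> dyadic_pl Sgn g 0 1 \<and> g ` {0..1} = {0..1} \<and> lambda_preserving g"
    using g by (simp add: thompson_monoid_def)
next
  assume g: "g \<in> extensional {0..1} \<and> dyadic_pl Sgn g 0 1 \<and> g ` {0..1} = {0..1} \<and> lambda_preserving g"
  then have d: "dyadic_pl Sgn g 0 1" by simp
  show "g \<in> thompson_monoid" unfolding thompson_monoid_def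
    using g dyadic_pl_continuous[OF d] dyadic_pl_nondiff_points[OF d] dyadic_pl_piecewise_affine[OF d] dyadic_pl_derivative[OF d]
    by (simp add: piecewise_affine_def Sgn_iff)
qed

lemma thompson_group_iff:
  "f \<in> thompson_group \<longleftrightarrow> f \<in> extensional {0..1} \<and> dyadic_pl Pos f 0 1 \<and> f 0 = 0 \<and> f 1 = 1"
proof
  assume f: "f \<in> thompson_group"
  then have im: "f ` {0..1} = {0..1}" by (auto simp: thompson_group_def homeomorphism_def)
  have d: "dyadic_pl Pos f 0 1"
  proof (rule piecewise_affine_dyadic_pl[OF _ _ _ Pos_Sgn im])
    fix x D assume "x \<in> {0..1}" "(f has_real_derivative D) (at x within {0..1})"
    then show "D \<in> Pos" using f unfolding thompson_group_def Pos_def by blast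
  qed (use f in \<open>auto simp: thompson_group_def\<close>)
  have "{f 0..f 1} = {0..1}" using dyadic_pl_image[OF d] im by simp
  then have "f 0 = 0" "f 1 = 1" using dyadic_pl_value_less[OF d] by (auto simp: Icc_eq_Icc)
  then show "f \<in> extensional {0..1} \<and> dyadic_pl Pos f 0 1 \<and> f 0 = 0 \<and> f 1 = 1"
    using d f by (simp add: thompson_group_def)
next
  assume f: "f \<in> extensional {0..1} \<and> dyadic_pl Pos f 0 1 \<and> f 0 = 0 \<and> f 1 = 1"
  then have d: "dyadic_pl Pos f 0 1" by simp
  have "\<exists>f'. homeomorphism {0..1} {0..1} f f'"
    by (rule homeomorphism_compact)
      (use f dyadic_pl_continuous[OF d] dyadic_pl_image[OF d] strict_mono_on_imp_inj_on[OF dyadic_pl_strict_mono[OF d]] in auto)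
  moreover have "\<exists>k::int. D = 2 powi k"
    if "x \<in> {0..1}" "(f has_real_derivative D) (at x within {0..1})" for x D
    using dyadic_pl_derivative[OF d that] unfolding Pos_def by blast
  ultimately show "f \<in> thompson_group" unfolding thompson_group_def
    using f dyadic_pl_nondiff_points[OF d] dyadic_pl_piecewise_affine[OF d]
    by (simp add: piecewise_affine_def)
qed

section \<open>Restoring measure preservation by a right factor\<close>

text \<open>A relational form of "\<open>E\<close> is the derivative of \<open>f\<close>".
  \<open>E\<close> is prescribed only on the open pieces: end points are null sets, so nothing has
  to match there when pieces are joined.\<close>

inductive pl_density :: "(real \<Rightarrow> real) \<Rightarrow> (real \<Rightarrow> real) \<Rightarrow> real \<Rightarrow> real \<Rightarrow> bool"
  for f E :: "real \<Rightarrow> real" where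
  affine: "\<lbrakk>dyadic a; dyadic b; a < b; s \<in> Pos; dyadic c; \<And>x. x \<in> {a..b} \<Longrightarrow> f x = s * x + c;
     \<And>x. x \<in> {a<..<b} \<Longrightarrow> E x = s\<rbrakk> \<Longrightarrow> pl_density f E a b"
| join: "\<lbrakk>pl_density f E a b; pl_density f E b c\<rbrakk> \<Longrightarrow> pl_density f E a c"

lemma pl_density_dyadic_pl: "pl_density f E a b \<Longrightarrow> dyadic_pl Pos f a b"
proof (induction rule: pl_density.induct)
  case (affine a b s c)
  show ?case by (rule dyadic_pl.affine[of a b s _ c]) (use affine in auto)
next
  case (join a b c)
  then show ?case by (blast intro: dyadic_pl.join)
qed

lemma pl_density_cong:
  assumes "pl_density f E a b" "\<And>x. x \<in> {a..b} \<Longrightarrow> h x = f x" "\<And>x. x \<in> {a<..<b} \<Longrightarrow> D x = E x"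
  shows "pl_density h D a b"
  using assms
proof (induction rule: pl_density.induct)
  case (affine a b s c)
  show ?case by (rule pl_density.affine[of a b s c]) (use affine in auto)
next
  case (join a b c)
  then have "a < b" "b < c" by (auto dest: pl_density_dyadic_pl dyadic_pl_less)
  then show ?case using join by (intro pl_density.join[of h D a b c]) auto
qed

lemma dyadic_pl_pl_density:
  assumes "dyadic_pl Pos f a b"
  shows "\<exists>E. E \<in> borel_measurable borel \<and> pl_density f E a b"
  using assms
proof (induction rule: dyadic_pl.induct)
  case (affine a b s c)
  have "pl_density f (\<lambda>x. s) a b" by (rule pl_density.affine[of a b s c]) (use affine in auto)
  then show ?case by (intro exI[of _ "\<lambda>x. s"]) auto
next
  case (join a b c)
  obtain E where E [measurable]: "E \<in> borel_measurable borel" and E': "pl_density f E a b" using join.IH(1) by blast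
  obtain D where D [measurable]: "D \<in> borel_measurable borel" and D': "pl_density f D b c" using join.IH(2) by blast
  define H where "H x = (if x < b then E x else D x)" for x
  have "H \<in> borel_measurable borel" unfolding H_def by measurable
  moreover have "pl_density f H a b" by (rule pl_density_cong[OF E']) (auto simp: H_def)
  moreover have "pl_density f H b c" by (rule pl_density_cong[OF D']) (auto simp: H_def)
  ultimately show ?case using pl_density.join by blast
qed

text \<open>The initial value \<open>w\<close> is quantified so that the second piece can start
  where the first one ends.\<close>

lemma pl_density_exists_join:
  assumes "\<forall>w. dyadic w \<longrightarrow> (\<exists>\<psi>. pl_density \<psi> E a b \<and> \<psi> a = w)"
    and "\<forall>w. dyadic w \<longrightarrow> (\<exists>\<psi>. pl_density \<psi> E b c \<and> \<psi> b = w)"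
  shows "\<forall>w. dyadic w \<longrightarrow> (\<exists>\<psi>. pl_density \<psi> E a c \<and> \<psi> a = w)"
proof (intro allI impI)
  fix w assume "dyadic w"
  then obtain f where f: "pl_density f E a b" "f a = w" using assms(1) by blast
  have ab: "a < b" "dyadic b" using pl_density_dyadic_pl[OF f(1)] dyadic_pl_less dyadic_pl_dyadic by auto
  then have "dyadic (f b)" by (intro dyadic_pl_value[OF pl_density_dyadic_pl[OF f(1)] Pos_Sgn]) auto
  then obtain g where g: "pl_density g E b c" "g b = f b" using assms(2) by blast
  define h where "h x = (if x \<le> b then f x else g x)" for x
  have "pl_density h E a b" by (rule pl_density_cong[OF f(1)]) (auto simp: h_def)
  moreover have "pl_density h E b c" by (rule pl_density_cong[OF g(1)]) (use g in \<open>auto simp: h_def\<close>)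
  moreover have "h a = w" using f ab by (simp add: h_def)
  ultimately show "\<exists>\<psi>. pl_density \<psi> E a c \<and> \<psi> a = w" using pl_density.join by blast
qed

lemma nn_integral_Icc_split:
  fixes F :: "real \<Rightarrow> ennreal"
  assumes [measurable]: "F \<in> borel_measurable borel" and "a \<le> b" "b \<le> c"
  shows "(\<integral>\<^sup>+x\<in>{a..c}. F x \<partial>lborel) = (\<integral>\<^sup>+x\<in>{a..b}. F x \<partial>lborel) + (\<integral>\<^sup>+x\<in>{b..c}. F x \<partial>lborel)"
proof -
  have "(\<integral>\<^sup>+x\<in>{a..c}. F x \<partial>lborel) = (\<integral>\<^sup>+x. F x * indicator {a..b} x + F x * indicator {b..c} x \<partial>lborel)"
  proof (rule nn_integral_cong_AE, rule AE_mp[OF AE_lborel_singleton[of b]], rule AE_I2, rule impI)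
    fix x assume "x \<noteq> b"
    then show "F x * indicator {a..c} x = F x * indicator {a..b} x + F x * indicator {b..c} x"
      using assms(2,3) by (auto simp: indicator_def)
  qed
  also have "\<dots> = (\<integral>\<^sup>+x\<in>{a..b}. F x \<partial>lborel) + (\<integral>\<^sup>+x\<in>{b..c}. F x \<partial>lborel)"
    by (rule nn_integral_add) measurable
  finally show ?thesis .
qed

lemma nn_integral_affine_Icc:
  fixes F :: "real \<Rightarrow> ennreal"
  assumes [measurable]: "F \<in> borel_measurable borel" and s: "s \<noteq> 0"
  shows "ennreal \<bar>s\<bar> * (\<integral>\<^sup>+x\<in>{a..b}. F (s * x + c) \<partial>lborel) =
    (\<integral>\<^sup>+y\<in>(\<lambda>x. s * x + c) ` {a..b}. F y \<partial>lborel)"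
proof -
  define J where "J = (\<lambda>x. s * x + c) ` {a..b}"
  have J [measurable]: "J \<in> sets borel"
    unfolding J_def by (intro borel_compact compact_continuous_image) (auto intro!: continuous_intros)
  have ind: "indicator J (c + s * x) = (indicator {a..b} x :: ennreal)" for x
    using s by (auto simp: J_def indicator_def)
  have "(\<integral>\<^sup>+y\<in>J. F y \<partial>lborel) = ennreal \<bar>s\<bar> * (\<integral>\<^sup>+x. F (c + s * x) * indicator J (c + s * x) \<partial>lborel)"
    by (rule nn_integral_real_affine[OF _ s]) measurable
  also have "(\<integral>\<^sup>+x. F (c + s * x) * indicator J (c + s * x) \<partial>lborel) = (\<integral>\<^sup>+x\<in>{a..b}. F (s * x + c) \<partial>lborel)"
    by (simp only: ind add.commute)
  finally show ?thesis unfolding J_def by (rule sym)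
qed

text \<open>Change of variables \<open>y = f x\<close>, with \<open>E\<close> in the role of the
  derivative.\<close>

lemma pl_density_nn_integral:
  fixes F :: "real \<Rightarrow> ennreal"
  assumes "pl_density f E a b" and [measurable]: "F \<in> borel_measurable borel" "f \<in> borel_measurable borel" "E \<in> borel_measurable borel"
  shows "(\<integral>\<^sup>+x\<in>{a..b}. F (f x) * ennreal (E x) \<partial>lborel) = (\<integral>\<^sup>+y\<in>{f a..f b}. F y \<partial>lborel)"
  using assms(1)
proof (induction rule: pl_density.induct)
  case (affine a b s c)
  have s: "s > 0" using affine Pos_pos by auto
  have "(\<integral>\<^sup>+x\<in>{a..b}. F (f x) * ennreal (E x) \<partial>lborel) = (\<integral>\<^sup>+x. ennreal \<bar>s\<bar> * (F (s * x + c) * indicator {a..b} x) \<partial>lborel)"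
  proof (rule nn_integral_cong_AE, rule AE_mp[OF AE_lborel_singleton[of a]], 
      rule AE_mp[OF AE_lborel_singleton[of b]], rule AE_I2, intro impI)
    fix x assume "x \<noteq> a" "x \<noteq> b"
    then show "F (f x) * ennreal (E x) * indicator {a..b} x = ennreal \<bar>s\<bar> * (F (s * x + c) * indicator {a..b} x)"
      using affine s by (auto simp: indicator_def mult.commute)
  qed
  also have "\<dots> = ennreal \<bar>s\<bar> * (\<integral>\<^sup>+x\<in>{a..b}. F (s * x + c) \<partial>lborel)"
    by (rule nn_integral_cmult) measurable
  also have "\<dots> = (\<integral>\<^sup>+y\<in>(\<lambda>x. s * x + c) ` {a..b}. F y \<partial>lborel)"
    using s by (intro nn_integral_affine_Icc) auto
  also have "(\<lambda>x. s * x + c) ` {a..b} = {f a..f b}"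
    using s affine by (simp add: image_affinity_atLeastAtMost)
  finally show ?case .
next
  case (join a b c)
  have d: "dyadic_pl Pos f a b" "dyadic_pl Pos f b c" using join.hyps pl_density_dyadic_pl by auto
  have "a \<le> b" "b \<le> c" "f a \<le> f b" "f b \<le> f c"
    using dyadic_pl_less[OF d(1)] dyadic_pl_less[OF d(2)] dyadic_pl_value_less[OF d(1)] dyadic_pl_value_less[OF d(2)] by auto
  then show ?case using join.IH
    by (simp add: nn_integral_Icc_split[of _ a b c] nn_integral_Icc_split[of _ "f a" "f b" "f c"])
qed

text \<open>On each piece the slope of \<open>\<psi>\<close> is the value \<open>t\<close> of
  \<open>D\<close> and does not involve the slope \<open>s\<close> of \<open>g\<close>; hence
  \<open>\<psi>\<close> increases even where \<open>g\<close> decreases. Cuts are needed only where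
  \<open>g\<close> meets a break point of \<open>f\<close>.\<close>

lemma pl_density_exists_comp_affine:
  assumes "pl_density f D u v" "dyadic a" "dyadic b" "a < b" "s \<in> Sgn" "dyadic c"
    "\<And>x. x \<in> {a..b} \<Longrightarrow> g x = s * x + c" "g ` {a..b} \<subseteq> {u..v}" "dyadic w"
  shows "\<exists>\<psi>. pl_density \<psi> (\<lambda>x. D (g x)) a b \<and> \<psi> a = w"
  using assms
proof (induction arbitrary: a b w rule: pl_density.induct)
  case (affine u v t d)
  have s: "s \<noteq> 0" using affine.prems Sgn_nonzero by auto
  have t: "dyadic t" using affine.hyps Pos_Sgn Sgn_dyadic by auto
  have "pl_density (\<lambda>x. t * x + (w - t * a)) (\<lambda>x. D (g x)) a b"
  proof (rule pl_density.affine[of a b t "w - t * a"])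
    fix x assume x: "x \<in> {a<..<b}"
    have im: "g a \<in> {u..v}" "g b \<in> {u..v}"
      using affine.prems(3) by (intro subsetD[OF affine.prems(7)] imageI; simp)+
    \<comment> \<open>\<open>D\<close> is known only on the open interval \<open>{u<..<v}\<close>.
      Since \<open>g\<close> is injective, an interior \<open>x\<close> is mapped strictly between
      \<open>g a\<close> and \<open>g b\<close>, hence into that interval.\<close>
    have "g x \<noteq> g a" "g x \<noteq> g b" using x s affine.prems(6)[of x] affine.prems(6)[of a] affine.prems(6)[of b] by auto
    moreover have "g x \<in> {min (g a) (g b)..max (g a) (g b)}"
    proof (cases "s > 0")
      case True
      then show ?thesis using x affine.prems(6)[of x] affine.prems(6)[of a] affine.prems(6)[of b] by auto
    next
      case False
      then show ?thesis using x s affine.prems(6)[of x] affine.prems(6)[of a] affine.prems(6)[of b] by auto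
    qed
    ultimately have "g x \<in> {u<..<v}" using im by auto
    then show "D (g x) = t" by (rule affine.hyps)
  qed (use affine t in auto)
  then show ?case by (intro exI[of _ "\<lambda>x. t * x + (w - t * a)"]) simp
next
  case (join u e v)
  have e: "dyadic e" using pl_density_dyadic_pl[OF join.hyps(1)] by (rule dyadic_pl_dyadic)
  have guv: "g x \<in> {u..v}" if "x \<in> {a..b}" for x using join.prems(7) that by blast
  have "\<forall>w. dyadic w \<longrightarrow> (\<exists>\<psi>. pl_density \<psi> (\<lambda>x. D (g x)) a b \<and> \<psi> a = w)"
  proof (rule affine_split_at[of a b s c e g, OF join.prems(1-5) e join.prems(6)])
    fix p q assume pq: "dyadic p" "dyadic q" "p < q" "{p..q} \<subseteq> {a..b}" and "\<And>x. x \<in> {p..q} \<Longrightarrow> g x \<le> e"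
    then have im: "g ` {p..q} \<subseteq> {u..e}" using guv by fastforce
    show "\<forall>w. dyadic w \<longrightarrow> (\<exists>\<psi>. pl_density \<psi> (\<lambda>x. D (g x)) p q \<and> \<psi> p = w)"
      using join.IH(1)[OF pq(1-3) join.prems(4,5,6) im] pq(4) by blast
  next
    fix p q assume pq: "dyadic p" "dyadic q" "p < q" "{p..q} \<subseteq> {a..b}" and "\<And>x. x \<in> {p..q} \<Longrightarrow> e \<le> g x"
    then have im: "g ` {p..q} \<subseteq> {e..v}" using guv by fastforce
    show "\<forall>w. dyadic w \<longrightarrow> (\<exists>\<psi>. pl_density \<psi> (\<lambda>x. D (g x)) p q \<and> \<psi> p = w)"
      using join.IH(2)[OF pq(1-3) join.prems(4,5,6) im] pq(4) by blast
  qed (assumption | rule pl_density_exists_join)+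
  then show ?case using join.prems(8) by blast
qed

lemma pl_density_exists_comp:
  assumes "pl_density f D u v" "dyadic_pl Sgn g a b" "g ` {a..b} \<subseteq> {u..v}" "dyadic w"
  shows "\<exists>\<psi>. pl_density \<psi> (\<lambda>x. D (g x)) a b \<and> \<psi> a = w"
  using assms(2-)
proof (induction arbitrary: w rule: dyadic_pl.induct)
  case (affine a b s c)
  show ?case by (rule pl_density_exists_comp_affine[OF assms(1)]) (use affine in auto)
next
  case (join a b c)
  have "a < b" "b < c" using join.hyps by (auto dest: dyadic_pl_less)
  then have im: "g ` {a..b} \<subseteq> {u..v}" "g ` {b..c} \<subseteq> {u..v}" using join.prems(1) by auto
  have "\<forall>w. dyadic w \<longrightarrow> (\<exists>\<psi>. pl_density \<psi> (\<lambda>x. D (g x)) a b \<and> \<psi> a = w)"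
    using join.IH(1)[OF im(1)] by blast
  moreover have "\<forall>w. dyadic w \<longrightarrow> (\<exists>\<psi>. pl_density \<psi> (\<lambda>x. D (g x)) b c \<and> \<psi> b = w)"
    using join.IH(2)[OF im(2)] by blast
  ultimately show ?case using pl_density_exists_join[of "\<lambda>x. D (g x)" a b c] join.prems(2) by blast
qed

text \<open>\<open>lambda_preserving g\<close> says that the image under \<open>g\<close> of
  Lebesgue measure on \<open>{0..1}\<close> is that measure itself; this is its form for
  integrals.\<close>

lemma lambda_preserving_nn_integral:
  fixes F :: "real \<Rightarrow> ennreal"
  assumes lp: "lambda_preserving g" and g [measurable]: "g \<in> borel_measurable borel"
    and im: "g ` {0..1} \<subseteq> {0..1}" and [measurable]: "F \<in> borel_measurable borel"
  shows "(\<integral>\<^sup>+x\<in>{0..1}. F (g x) \<partial>lborel) = (\<integral>\<^sup>+y\<in>{0..1}. F y \<partial>lborel)"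
proof -
  define M where "M = restrict_space lborel {0..1::real}"
  have gM: "g \<in> measurable M M"
    unfolding M_def by (rule measurable_restrict_space3) (use im in auto)
  have "distr M M g = M"
  proof (rule measure_eqI)
    fix A assume "A \<in> sets (distr M M g)"
    then have A: "A \<in> sets borel" "A \<subseteq> {0..1}" by (auto simp: M_def sets_restrict_space)
    then have AM: "A \<in> sets M" by (auto simp: M_def sets_restrict_space)
    have "emeasure (distr M M g) A = emeasure M (g -` A \<inter> space M)"
      by (rule emeasure_distr[OF gM AM])
    also have "\<dots> = emeasure lborel (g -` A \<inter> {0..1})"
      unfolding M_def by (subst emeasure_restrict_space) (auto simp: space_restrict_space)
    also have "\<dots> = emeasure lborel A"
      using lp[unfolded lambda_preserving_def, rule_format, OF A] by simp
    also have "\<dots> = emeasure M A"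
      unfolding M_def using A by (subst emeasure_restrict_space) auto
    finally show "emeasure (distr M M g) A = emeasure M A" .
  qed simp
  then have "(\<integral>\<^sup>+y. F y \<partial>M) = (\<integral>\<^sup>+y. F y \<partial>distr M M g)" by simp
  also have "\<dots> = (\<integral>\<^sup>+x. F (g x) \<partial>M)"
    by (rule nn_integral_distr[OF gM]) (auto simp: M_def intro: measurable_restrict_space1)
  finally show ?thesis unfolding M_def by (simp add: nn_integral_restrict_space)
qed


section \<open>The group and the monoid under composition\<close>

lemma lambda_preserving_cong:
  assumes "\<And>x. x \<in> {0..1} \<Longrightarrow> h x = g x" shows "lambda_preserving h \<longleftrightarrow> lambda_preserving g"
proof -
  have "h -` A \<inter> {0..1} = g -` A \<inter> {0..1}" for A using assms by auto
  then show ?thesis unfolding lambda_preserving_def by simp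
qed

lemma restrict_in_thompson_group:
  assumes "dyadic_pl Pos f 0 1" "f 0 = 0" "f 1 = 1" shows "restrict f {0..1} \<in> thompson_group"
  unfolding thompson_group_iff using assms by (auto intro: dyadic_pl_cong)

lemma restrict_in_thompson_monoid:
  assumes "dyadic_pl Sgn g 0 1" "g ` {0..1} = {0..1}" "lambda_preserving g"
  shows "restrict g {0..1} \<in> thompson_monoid"
proof -
  have "lambda_preserving (restrict g {0..1})"
    using assms(3) lambda_preserving_cong[of "restrict g {0..1}" g] by simp
  moreover have "dyadic_pl Sgn (restrict g {0..1}) 0 1" by (rule dyadic_pl_cong[OF assms(1)]) auto
  ultimately show ?thesis unfolding thompson_monoid_iff using assms(2) by simp
qed

lemma extensional_borel_measurable:
  fixes g :: "real \<Rightarrow> real"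
  assumes "g \<in> extensional {0..1}" "continuous_on {0..1} g" shows "g \<in> borel_measurable borel"
proof -
  have "(\<lambda>x. if x \<in> {0..1} then g x else undefined) \<in> borel_measurable borel"
    by (rule borel_measurable_continuous_on_if) (use assms(2) in auto)
  also have "(\<lambda>x. if x \<in> {0..1} then g x else undefined) = g"
    using assms(1) by (auto simp: extensional_def)
  finally show ?thesis .
qed

lemma thompson_group_image: "f \<in> thompson_group \<Longrightarrow> f ` {0..1} = {0..1}"
  using dyadic_pl_image[of f 0 1] by (auto simp: thompson_group_iff)

lemma thompson_group_funcset: "f \<in> thompson_group \<Longrightarrow> f \<in> {0..1} \<rightarrow> {0..1}"
  using thompson_group_image by blast

lemma thompson_monoid_funcset: "g \<in> thompson_monoid \<Longrightarrow> g \<in> {0..1} \<rightarrow> {0..1}"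
  unfolding thompson_monoid_iff by blast

lemma g0_plus_thompson_group: "g0_plus \<in> thompson_group"
  unfolding g0_plus_def
  by (rule restrict_in_thompson_group[OF dyadic_pl.affine[of 0 1 1 _ 0]]) (use Pos_powi[of 0] in auto)

lemma thompson_group_compose:
  assumes "f \<in> thompson_group" "h \<in> thompson_group" shows "compose {0..1} f h \<in> thompson_group"
  unfolding compose_def
proof (rule restrict_in_thompson_group)
  show "dyadic_pl Pos (\<lambda>x. f (h x)) 0 1"
    by (rule dyadic_pl_comp[of Pos h 0 1 0 1 Pos f])
      (use assms thompson_group_image[OF assms(2)] Pos_Sgn Pos_mult in \<open>auto simp: thompson_group_iff\<close>)
qed (use assms in \<open>auto simp: thompson_group_iff\<close>)

lemma thompson_group_inverse:
  assumes "f \<in> thompson_group"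
  obtains h where "h \<in> thompson_group" "compose {0..1} f h = g0_plus" "compose {0..1} h f = g0_plus"
proof -
  have d: "dyadic_pl Pos f 0 1" and f: "f 0 = 0" "f 1 = 1" using assms by (auto simp: thompson_group_iff)
  have inj: "inj_on f {0..1}" using dyadic_pl_strict_mono[OF d] by (rule strict_mono_on_imp_inj_on)
  define h where "h = restrict (the_inv_into {0..1} f) {0..1}"
  have hf: "the_inv_into {0..1} f (f x) = x" if "x \<in> {0..1}" for x
    using inj that by (rule the_inv_into_f_f)
  have "h \<in> thompson_group" unfolding h_def
    using dyadic_pl_the_inv_into[OF d] hf[of 0] hf[of 1] f by (intro restrict_in_thompson_group) auto
  moreover have "compose {0..1} f h = g0_plus"
    using f_the_inv_into_f[OF inj] thompson_group_image[OF assms]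
    by (auto simp: compose_def g0_plus_def h_def restrict_def fun_eq_iff)
  moreover have "compose {0..1} h f = g0_plus"
    using hf funcset_mem[OF thompson_group_funcset[OF assms]]
    by (auto simp: compose_def g0_plus_def h_def restrict_def fun_eq_iff)
  ultimately show ?thesis by (rule that)
qed

lemma thompson_monoid_compose:
  assumes "g \<in> thompson_monoid" "h \<in> thompson_monoid" shows "compose {0..1} g h \<in> thompson_monoid"
  unfolding compose_def
proof (rule restrict_in_thompson_monoid)
  have g: "g \<in> extensional {0..1}" "dyadic_pl Sgn g 0 1" "g ` {0..1} = {0..1}" "lambda_preserving g"
    and h: "dyadic_pl Sgn h 0 1" "h ` {0..1} = {0..1}" "lambda_preserving h"
    using assms by (auto simp: thompson_monoid_iff)
  show "dyadic_pl Sgn (\<lambda>x. g (h x)) 0 1"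
    by (rule dyadic_pl_comp[of Sgn h 0 1 0 1 Sgn g]) (use g h Sgn_mult in auto)
  show "(\<lambda>x. g (h x)) ` {0..1} = {0..1}" using g(3) h(2) by (simp add: image_image[symmetric])
  have gm [measurable]: "g \<in> borel_measurable borel"
    using g(1) dyadic_pl_continuous[OF g(2)] by (rule extensional_borel_measurable)
  show "lambda_preserving (\<lambda>x. g (h x))"
    unfolding lambda_preserving_def
  proof (intro ballI impI)
    fix A :: "real set" assume A: "A \<in> sets borel" "A \<subseteq> {0..1}"
    have B: "g -` A \<inter> {0..1} \<in> sets borel"
      using measurable_sets[OF gm A(1)] by auto
    have "emeasure lborel A = emeasure lborel (g -` A \<inter> {0..1})"
      using g(4)[unfolded lambda_preserving_def, rule_format, OF A] .
    also have "\<dots> = emeasure lborel (h -` (g -` A \<inter> {0..1}) \<inter> {0..1})"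
      by (rule h(3)[unfolded lambda_preserving_def, rule_format, OF B]) simp
    also have "h -` (g -` A \<inter> {0..1}) \<inter> {0..1} = (\<lambda>x. g (h x)) -` A \<inter> {0..1}"
      using h(2) by auto
    finally show "emeasure lborel A = emeasure lborel ((\<lambda>x. g (h x)) -` A \<inter> {0..1})" .
  qed
qed

text \<open>\<open>\<phi>\<close> is the inverse of the map \<open>\<psi>\<close> with density \<open>f' \<circ> g\<close>.\<close>

lemma thompson_group_correction:
  assumes "f \<in> thompson_group" "g \<in> thompson_monoid"
  shows "\<exists>\<phi>\<in>thompson_group. compose {0..1} f (compose {0..1} g \<phi>) \<in> thompson_monoid"
proof -
  have f: "f \<in> extensional {0..1}" "dyadic_pl Pos f 0 1" "f 0 = 0" "f 1 = 1" and fim: "f ` {0..1} = {0..1}"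
    using assms(1) thompson_group_image by (auto simp: thompson_group_iff)
  have g: "g \<in> extensional {0..1}" "dyadic_pl Sgn g 0 1" "g ` {0..1} = {0..1}" "lambda_preserving g"
    using assms(2) by (auto simp: thompson_monoid_iff)
  have fm [measurable]: "f \<in> borel_measurable borel"
    using f(1) dyadic_pl_continuous[OF f(2)] by (rule extensional_borel_measurable)
  have gm [measurable]: "g \<in> borel_measurable borel"
    using g(1) dyadic_pl_continuous[OF g(2)] by (rule extensional_borel_measurable)
  obtain E where E [measurable]: "E \<in> borel_measurable borel" and dE: "pl_density f E 0 1"
    using dyadic_pl_pl_density[OF f(2)] by blast
  obtain \<psi>0 where \<psi>0: "pl_density \<psi>0 (\<lambda>x. E (g x)) 0 1" "\<psi>0 0 = 0"
    using pl_density_exists_comp[OF dE g(2) eq_refl[OF g(3)] dyadic_0] by blast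
  define \<psi> where "\<psi> = restrict \<psi>0 {0..1}"
  have d\<psi>: "pl_density \<psi> (\<lambda>x. E (g x)) 0 1" unfolding \<psi>_def by (rule pl_density_cong[OF \<psi>0(1)]) auto
  have \<psi>p: "dyadic_pl Pos \<psi> 0 1" and "\<psi> 0 = 0" using pl_density_dyadic_pl[OF d\<psi>] \<psi>0(2) by (auto simp: \<psi>_def)
  have \<psi>m [measurable]: "\<psi> \<in> borel_measurable borel"
    by (rule extensional_borel_measurable[OF _ dyadic_pl_continuous[OF \<psi>p]]) (simp add: \<psi>_def)
  have int\<psi>: "(\<integral>\<^sup>+x\<in>{0..1}. F (\<psi> x) * ennreal (E (g x)) \<partial>lborel) = (\<integral>\<^sup>+y\<in>{\<psi> 0..\<psi> 1}. F y \<partial>lborel)"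
    if [measurable]: "F \<in> borel_measurable borel" for F
    by (rule pl_density_nn_integral[OF d\<psi>]) measurable
  have intf: "(\<integral>\<^sup>+x\<in>{0..1}. F (f x) * ennreal (E x) \<partial>lborel) = (\<integral>\<^sup>+y\<in>{0..1}. F y \<partial>lborel)"
    if [measurable]: "F \<in> borel_measurable borel" for F
    using pl_density_nn_integral[OF dE, of F] f by simp
  have intg: "(\<integral>\<^sup>+x\<in>{0..1}. F (g x) \<partial>lborel) = (\<integral>\<^sup>+y\<in>{0..1}. F y \<partial>lborel)"
    if [measurable]: "F \<in> borel_measurable borel" for F
    by (rule lambda_preserving_nn_integral[OF g(4)]) (use g(3) in auto)
  have "\<psi> 0 < \<psi> 1" by (rule dyadic_pl_value_less[OF \<psi>p])
  \<comment> \<open>The total mass of the density \<open>E \<circ> g\<close> equals that of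
    \<open>E\<close> because \<open>g\<close> preserves \<open>\<lambda>\<close>, and the latter is
    1 because \<open>f\<close> maps \<open>[0, 1]\<close> onto itself. So \<open>\<psi>\<close> ends
    at 1 and lies in the group.\<close>
  have "ennreal (\<psi> 1) = (\<integral>\<^sup>+y\<in>{\<psi> 0..\<psi> 1}. 1 \<partial>lborel)"
    using \<open>\<psi> 0 < \<psi> 1\<close> \<open>\<psi> 0 = 0\<close> by simp
  also have "\<dots> = (\<integral>\<^sup>+x\<in>{0..1}. ennreal (E (g x)) \<partial>lborel)" using int\<psi>[of "\<lambda>_. 1"] by simp
  also have "\<dots> = (\<integral>\<^sup>+x\<in>{0..1}. ennreal (E x) \<partial>lborel)" by (rule intg) measurable
  also have "\<dots> = 1" using intf[of "\<lambda>_. 1"] by simp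
  finally have "\<psi> 1 = 1" by simp
  have \<psi>G: "\<psi> \<in> thompson_group" unfolding thompson_group_iff
    using \<psi>p \<open>\<psi> 0 = 0\<close> \<open>\<psi> 1 = 1\<close> by (simp add: \<psi>_def)
  obtain \<phi> where \<phi>: "\<phi> \<in> thompson_group" "compose {0..1} \<phi> \<psi> = g0_plus" using thompson_group_inverse[OF \<psi>G] by metis
  have \<phi>\<psi>: "\<phi> (\<psi> x) = x" if "x \<in> {0..1}" for x
    using fun_cong[OF \<phi>(2), of x] that by (simp add: compose_def g0_plus_def)
  have \<psi>I: "\<psi> x \<in> {0..1}" if "x \<in> {0..1}" for x using thompson_group_image[OF \<psi>G] that by blast
  have \<phi>I: "\<phi> ` {0..1} = {0..1}" by (rule thompson_group_image[OF \<phi>(1)])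
  have \<phi>d: "dyadic_pl Pos \<phi> 0 1" using \<phi>(1) by (simp add: thompson_group_iff)
  define h where "h = compose {0..1} f (compose {0..1} g \<phi>)"
  have h: "h x = f (g (\<phi> x))" if "x \<in> {0..1}" for x using that by (simp add: h_def compose_def)
  have hext: "h \<in> extensional {0..1}" by (simp add: h_def)
  have "dyadic_pl Sgn (\<lambda>x. g (\<phi> x)) 0 1"
    by (rule dyadic_pl_comp[OF \<phi>d _ g(2)]) (use \<phi>I Pos_Sgn Sgn_mult in auto)
  then have "dyadic_pl Sgn (\<lambda>x. f (g (\<phi> x))) 0 1"
    by (rule dyadic_pl_comp[OF _ _ f(2)]) (use \<phi>I g(3) Pos_Sgn Sgn_mult in \<open>auto simp: image_image[symmetric]\<close>)
  then have hd: "dyadic_pl Sgn h 0 1" by (rule dyadic_pl_cong) (use h in auto)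
  have "h ` {0..1} = f ` g ` \<phi> ` {0..1}" using h by (auto simp: image_image)
  then have him: "h ` {0..1} = {0..1}" using \<phi>I g(3) fim by simp
  have hm [measurable]: "h \<in> borel_measurable borel"
    using hext dyadic_pl_continuous[OF hd] by (rule extensional_borel_measurable)
  have "lambda_preserving h" unfolding lambda_preserving_def
  proof (intro ballI impI)
    fix A :: "real set" assume A: "A \<in> sets borel" "A \<subseteq> {0..1}"
    note A(1) [measurable]
    define B where "B = h -` A \<inter> {0..1}"
    have B [measurable]: "B \<in> sets borel" unfolding B_def using measurable_sets[OF hm A(1)] by auto
    \<comment> \<open>Substituting \<open>y = \<psi> x\<close> turns \<open>h y\<close> into
      \<open>f (g x)\<close> with weight \<open>E (g x)\<close>. Then \<open>g\<close> disappears by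
      invariance, and \<open>f\<close> by its own change of variables with weight
      \<open>E\<close>.\<close>
    have "emeasure lborel B = (\<integral>\<^sup>+y. indicator B y \<partial>lborel)" by simp
    also have "\<dots> = (\<integral>\<^sup>+y\<in>{\<psi> 0..\<psi> 1}. indicator B y \<partial>lborel)"
      by (rule nn_integral_cong) (auto simp: B_def indicator_def \<open>\<psi> 0 = 0\<close> \<open>\<psi> 1 = 1\<close>)
    also have "\<dots> = (\<integral>\<^sup>+x\<in>{0..1}. indicator B (\<psi> x) * ennreal (E (g x)) \<partial>lborel)"
      by (rule int\<psi>[symmetric]) measurable
    also have "\<dots> = (\<integral>\<^sup>+x\<in>{0..1}. indicator A (f (g x)) * ennreal (E (g x)) \<partial>lborel)"
    proof (rule nn_integral_cong)
      fix x :: real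
      show "indicator B (\<psi> x) * ennreal (E (g x)) * indicator {0..1} x =
        indicator A (f (g x)) * ennreal (E (g x)) * indicator {0..1} x"
        using h[OF \<psi>I[of x]] \<phi>\<psi>[of x] \<psi>I[of x]
        by (cases "x \<in> {0..1}") (auto simp: B_def indicator_def)
    qed
    also have "\<dots> = (\<integral>\<^sup>+y\<in>{0..1}. indicator A (f y) * ennreal (E y) \<partial>lborel)"
      by (rule intg) measurable
    also have "\<dots> = (\<integral>\<^sup>+y\<in>{0..1}. indicator A y \<partial>lborel)" by (rule intf) measurable
    also have "\<dots> = (\<integral>\<^sup>+y. indicator A y \<partial>lborel)"
      by (rule nn_integral_cong) (use A(2) in \<open>auto simp: indicator_def\<close>)
    also have "\<dots> = emeasure lborel A" by simp
    finally show "emeasure lborel A = emeasure lborel (h -` A \<inter> {0..1})" by (simp add: B_def)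
  qed
  then have "h \<in> thompson_monoid" unfolding thompson_monoid_iff using hext hd him by simp
  then show ?thesis using \<phi>(1) unfolding h_def by blast
qed

section \<open>The generators preserve Lebesgue measure\<close>

lemma measure_lborel_Icc_split:
  assumes [measurable]: "B \<in> sets borel" and "a \<le> b" "b \<le> (c::real)"
  shows "measure lborel (B \<inter> {a..c}) = measure lborel (B \<inter> {a..b}) + measure lborel (B \<inter> {b..c})"
proof -
  have e: "emeasure lborel (B \<inter> {u..v}) = (\<integral>\<^sup>+x\<in>{u..v}. indicator B x \<partial>lborel)" for u v :: real
  proof -
    have "(\<integral>\<^sup>+x\<in>{u..v}. indicator B x \<partial>lborel) = (\<integral>\<^sup>+x. indicator (B \<inter> {u..v}) x \<partial>lborel)"
      by (rule nn_integral_cong) (auto simp: indicator_def)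
    then show ?thesis by simp
  qed
  have fin: "emeasure lborel (B \<inter> {u..v}) \<noteq> \<infinity>" for u v :: real
    using emeasure_mono[of "B \<inter> {u..v}" "{u..v}" lborel] emeasure_lborel_cbox_finite[of u v]
    by (auto simp: top_unique)
  have "emeasure lborel (B \<inter> {a..c}) = emeasure lborel (B \<inter> {a..b}) + emeasure lborel (B \<inter> {b..c})"
    unfolding e by (rule nn_integral_Icc_split) (use assms in auto)
  then show ?thesis
    using fin by (simp add: measure_def enn2real_plus top.not_eq_extremum)
qed

lemma measure_affine_vimage:
  assumes [measurable]: "A \<in> sets borel" and s: "s \<noteq> 0"
    and h: "\<And>x. x \<in> {a..b} \<Longrightarrow> h x = s * x + c"
  shows "\<bar>s\<bar> * measure lborel (h -` A \<inter> {a..b}) = measure lborel (A \<inter> (\<lambda>x. s * x + c) ` {a..b})"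
proof -
  have J [measurable]: "(\<lambda>x. s * x + c) ` {a..b} \<in> sets borel"
    by (intro borel_compact compact_continuous_image) (auto intro!: continuous_intros)
  have B [measurable]: "(\<lambda>x. s * x + c) -` A \<in> sets borel"
    using measurable_sets_borel[of "\<lambda>x. s * x + c" borel A] by simp
  have "h -` A \<inter> {a..b} = (\<lambda>x. s * x + c) -` A \<inter> {a..b}" using h by auto
  then have "ennreal \<bar>s\<bar> * emeasure lborel (h -` A \<inter> {a..b}) =
      ennreal \<bar>s\<bar> * emeasure lborel ((\<lambda>x. s * x + c) -` A \<inter> {a..b})" by simp
  also have "emeasure lborel ((\<lambda>x. s * x + c) -` A \<inter> {a..b}) =
      (\<integral>\<^sup>+x. indicator ((\<lambda>x. s * x + c) -` A \<inter> {a..b}) x \<partial>lborel)" by simp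
  also have "\<dots> = (\<integral>\<^sup>+x\<in>{a..b}. indicator A (s * x + c) \<partial>lborel)"
    by (rule nn_integral_cong) (auto simp: indicator_def)
  also have "ennreal \<bar>s\<bar> * \<dots> = (\<integral>\<^sup>+y\<in>(\<lambda>x. s * x + c) ` {a..b}. indicator A y \<partial>lborel)"
    by (rule nn_integral_affine_Icc) (use s in auto)
  also have "\<dots> = (\<integral>\<^sup>+y. indicator (A \<inter> (\<lambda>x. s * x + c) ` {a..b}) y \<partial>lborel)"
    by (rule nn_integral_cong) (auto simp: indicator_def)
  also have "\<dots> = emeasure lborel (A \<inter> (\<lambda>x. s * x + c) ` {a..b})" by simp
  finally have "enn2real (ennreal \<bar>s\<bar> * emeasure lborel (h -` A \<inter> {a..b})) =
      enn2real (emeasure lborel (A \<inter> (\<lambda>x. s * x + c) ` {a..b}))" by (rule arg_cong)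
  then show ?thesis by (simp add: measure_def enn2real_mult)
qed

lemma measure_affine_vimage_pos:
  assumes "A \<in> sets borel" "0 < s" "a \<le> b" "\<And>x. x \<in> {a..b} \<Longrightarrow> h x = s * x + c" "u = s * a + c" "v = s * b + c"
  shows "s * measure lborel (h -` A \<inter> {a..b}) = measure lborel (A \<inter> {u..v})"
  using measure_affine_vimage[OF assms(1) _ assms(4)] assms(2,3,5,6)
  by (simp add: image_affinity_atLeastAtMost)

lemma measure_affine_vimage_neg:
  assumes "A \<in> sets borel" "s < 0" "a \<le> b" "\<And>x. x \<in> {a..b} \<Longrightarrow> h x = s * x + c" "u = s * b + c" "v = s * a + c"
  shows "- s * measure lborel (h -` A \<inter> {a..b}) = measure lborel (A \<inter> {u..v})"
  using measure_affine_vimage[OF assms(1) _ assms(4)] assms(2,3,5,6)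
  by (simp add: image_affinity_atLeastAtMost)

lemma continuous_image_unit_interval:
  fixes h :: "real \<Rightarrow> real"
  assumes "continuous_on {0..1} h" "h ` {0..1} \<subseteq> {0..1}" "x \<in> {0..1}" "h x = 0" "y \<in> {0..1}" "h y = 1"
  shows "h ` {0..1} = {0..1}"
proof
  have "connected (h ` {0..1})" using assms(1) by (rule connected_continuous_image) simp
  moreover have "0 \<in> h ` {0..1}" using assms(3,4) by (metis imageI)
  moreover have "1 \<in> h ` {0..1}" using assms(5,6) by (metis imageI)
  ultimately show "{0..1} \<subseteq> h ` {0..1}" by (rule connected_contains_Icc)
qed (rule assms)

text \<open>With real-valued measures, and \<open>A\<close> not confined to the unit interval, each
  affine branch contributes one linear equation between measures, and invariance becomes linear
  arithmetic.\<close>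

lemma thompson_monoidI:
  assumes ext: "h \<in> extensional {0..1}" and d: "dyadic_pl Sgn h 0 1" and im: "h ` {0..1} = {0..1}"
    and meas: "\<And>A. \<lbrakk>A \<in> sets borel; h -` A \<in> sets borel\<rbrakk> \<Longrightarrow>
      measure lborel (h -` A \<inter> {0..1}) = measure lborel (A \<inter> {0..1})"
  shows "h \<in> thompson_monoid"
proof -
  have hm: "h \<in> borel_measurable borel"
    using ext dyadic_pl_continuous[OF d] by (rule extensional_borel_measurable)
  have "lambda_preserving h" unfolding lambda_preserving_def
  proof (intro ballI impI)
    fix A :: "real set" assume A: "A \<in> sets borel" "A \<subseteq> {0..1}"
    have B: "h -` A \<in> sets borel" using measurable_sets_borel[OF hm A(1)] .
    have fin: "emeasure lborel (B \<inter> {0..1}) \<noteq> \<infinity>" if "B \<in> sets borel" for B :: "real set"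
      using emeasure_mono[of "B \<inter> {0..1}" "{0..1}" lborel] that
      by (auto simp: top_unique)
    have "emeasure lborel (A \<inter> {0..1}) = emeasure lborel (h -` A \<inter> {0..1})"
      using meas[OF A(1) B] fin[OF A(1)] fin[OF B] by (simp add: emeasure_eq_ennreal_measure)
    then show "emeasure lborel A = emeasure lborel (h -` A \<inter> {0..1})" using A(2) by (simp add: Int_absorb2)
  qed
  then show ?thesis using ext d im by (simp add: thompson_monoid_iff)
qed

lemma Sgn_numeral: "1 \<in> Sgn" "-1 \<in> Sgn" "2 \<in> Sgn" "-2 \<in> Sgn" "4 \<in> Sgn" "-4 \<in> Sgn"
  unfolding Sgn_iff by (rule exI[of _ 0] exI[of _ 1] exI[of _ 2]; simp)+

lemma g0_plus_thompson_monoid: "g0_plus \<in> thompson_monoid"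
  using restrict_in_thompson_monoid[of "\<lambda>x. x"] dyadic_pl.affine[of 0 1 1 Sgn 0 "\<lambda>x. x"] Sgn_numeral
  by (simp add: g0_plus_def lambda_preserving_def Int_absorb2)

lemma g0_minus_thompson_monoid: "g0_minus \<in> thompson_monoid"
proof (rule thompson_monoidI)
  have h: "g0_minus x = -1 * x + 1" if "x \<in> {0..1}" for x using that by (simp add: g0_minus_def)
  show "g0_minus \<in> extensional {0..1}" by (simp add: g0_minus_def)
  show d: "dyadic_pl Sgn g0_minus 0 1"
    by (rule dyadic_pl.affine[of 0 1 "-1" _ 1]) (use h Sgn_numeral in auto)
  show "g0_minus ` {0..1} = {0..1}"
    by (rule continuous_image_unit_interval[OF dyadic_pl_continuous[OF d], of 1 0]) (auto simp: g0_minus_def)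
  fix A :: "real set" assume "A \<in> sets borel"
  then show "measure lborel (g0_minus -` A \<inter> {0..1}) = measure lborel (A \<inter> {0..1})"
    using measure_affine_vimage_neg[of A "-1" 0 1 g0_minus 1 0 1] h by simp
qed

lemma w2_full_affine:
  "x \<in> {0..1/2} \<Longrightarrow> w2_full x = 2 * x + 0"
  "x \<in> {1/2..1} \<Longrightarrow> w2_full x = -2 * x + 2"
  by (auto simp: w2_full_def)

text \<open>Measure is preserved because the reciprocals of the absolute slopes over each value add
  up to 1, here \<open>1/2 + 1/2\<close>.\<close>

lemma w2_full_thompson_monoid: "w2_full \<in> thompson_monoid"
proof (rule thompson_monoidI)
  note h = w2_full_affine
  show "w2_full \<in> extensional {0..1}" by (simp add: w2_full_def)
  show d: "dyadic_pl Sgn w2_full 0 1"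
    by (rule dyadic_pl.join[of _ _ _ "1/2"], rule dyadic_pl.affine[of _ _ "2" _ 0, OF _ _ _ _ _ h(1)],
        simp_all add: Sgn_numeral,
        rule dyadic_pl.affine[of _ _ "-2" _ 2, OF _ _ _ _ _ h(2)]) (simp_all add: Sgn_numeral)
  show "w2_full ` {0..1} = {0..1}"
    by (rule continuous_image_unit_interval[OF dyadic_pl_continuous[OF d], of 0 "1/2"]) (auto simp: w2_full_def)
  fix A :: "real set" assume A: "A \<in> sets borel" "w2_full -` A \<in> sets borel"
  have "2 * measure lborel (w2_full -` A \<inter> {0..1/2}) = measure lborel (A \<inter> {0..1})"
    by (rule measure_affine_vimage_pos[OF A(1) _ _ h(1)]) auto
  moreover have "- (- 2) * measure lborel (w2_full -` A \<inter> {1/2..1}) = measure lborel (A \<inter> {0..1})"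
    by (rule measure_affine_vimage_neg[OF A(1) _ _ h(2)]) auto
  ultimately show "measure lborel (w2_full -` A \<inter> {0..1}) = measure lborel (A \<inter> {0..1})"
    using measure_lborel_Icc_split[OF A(2), of 0 "1/2" 1] by simp
qed

lemma w2_right_affine:
  "x \<in> {0..3/4} \<Longrightarrow> w2_right x = 1 * x + 0"
  "x \<in> {3/4..7/8} \<Longrightarrow> w2_right x = 2 * x + -3/4"
  "x \<in> {7/8..1} \<Longrightarrow> w2_right x = -2 * x + 11/4"
  by (auto simp: w2_right_def)

lemma w2_right_thompson_monoid: "w2_right \<in> thompson_monoid"
proof (rule thompson_monoidI)
  note h = w2_right_affine
  show "w2_right \<in> extensional {0..1}" by (simp add: w2_right_def)
  have "dyadic_pl Sgn w2_right 0 (3/4)"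
    by (rule dyadic_pl.affine[of _ _ 1 _ 0, OF _ _ _ _ _ h(1)]) (simp_all add: Sgn_numeral)
  moreover have "dyadic_pl Sgn w2_right (3/4) (7/8)"
    by (rule dyadic_pl.affine[of _ _ 2 _ "-3/4", OF _ _ _ _ _ h(2)]) (simp_all add: Sgn_numeral)
  moreover have "dyadic_pl Sgn w2_right (7/8) 1"
    by (rule dyadic_pl.affine[of _ _ "-2" _ "11/4", OF _ _ _ _ _ h(3)]) (simp_all add: Sgn_numeral)
  ultimately show d: "dyadic_pl Sgn w2_right 0 1" by (blast intro: dyadic_pl.join)
  show "w2_right ` {0..1} = {0..1}"
    by (rule continuous_image_unit_interval[OF dyadic_pl_continuous[OF d], of 0 "7/8"]) (auto simp: w2_right_def)
  fix A :: "real set" assume A: "A \<in> sets borel" "w2_right -` A \<in> sets borel"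
  have "1 * measure lborel (w2_right -` A \<inter> {0..3/4}) = measure lborel (A \<inter> {0..3/4})"
    by (rule measure_affine_vimage_pos[OF A(1) _ _ h(1)]) auto
  moreover have "2 * measure lborel (w2_right -` A \<inter> {3/4..7/8}) = measure lborel (A \<inter> {3/4..1})"
    by (rule measure_affine_vimage_pos[OF A(1) _ _ h(2)]) auto
  moreover have "- (- 2) * measure lborel (w2_right -` A \<inter> {7/8..1}) = measure lborel (A \<inter> {3/4..1})"
    by (rule measure_affine_vimage_neg[OF A(1) _ _ h(3)]) auto
  ultimately show "measure lborel (w2_right -` A \<inter> {0..1}) = measure lborel (A \<inter> {0..1})"
    using measure_lborel_Icc_split[OF A(2), of 0 "3/4" 1] measure_lborel_Icc_split[OF A(2), of "3/4" "7/8" 1]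
      measure_lborel_Icc_split[OF A(1), of 0 "3/4" 1] by simp
qed

lemma w3_bar_affine:
  "x \<in> {0..1/4} \<Longrightarrow> w3_bar x = 1 * x + 0"
  "x \<in> {1/4..3/8} \<Longrightarrow> w3_bar x = 2 * x + -1/4"
  "x \<in> {3/8..7/16} \<Longrightarrow> w3_bar x = -4 * x + 2"
  "x \<in> {7/16..1/2} \<Longrightarrow> w3_bar x = 4 * x + -3/2"
  "x \<in> {1/2..1} \<Longrightarrow> w3_bar x = 1 * x + 0"
  by (auto simp: w3_bar_def)

text \<open>The branches with slopes 2, -4, 4 each cover \<open>[1/4, 1/2]\<close>, and
  \<open>1/2 + 1/4 + 1/4 = 1\<close>.\<close>

lemma w3_bar_thompson_monoid: "w3_bar \<in> thompson_monoid"
proof (rule thompson_monoidI)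
  note h = w3_bar_affine
  show "w3_bar \<in> extensional {0..1}" by (simp add: w3_bar_def)
  have "dyadic_pl Sgn w3_bar 0 (1/4)"
    by (rule dyadic_pl.affine[of _ _ 1 _ 0, OF _ _ _ _ _ h(1)]) (simp_all add: Sgn_numeral)
  moreover have "dyadic_pl Sgn w3_bar (1/4) (3/8)"
    by (rule dyadic_pl.affine[of _ _ 2 _ "-1/4", OF _ _ _ _ _ h(2)]) (simp_all add: Sgn_numeral)
  moreover have "dyadic_pl Sgn w3_bar (3/8) (7/16)"
    by (rule dyadic_pl.affine[of _ _ "-4" _ "2", OF _ _ _ _ _ h(3)]) (simp_all add: Sgn_numeral)
  moreover have "dyadic_pl Sgn w3_bar (7/16) (1/2)"
    by (rule dyadic_pl.affine[of _ _ "4" _ "-3/2", OF _ _ _ _ _ h(4)]) (simp_all add: Sgn_numeral)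
  moreover have "dyadic_pl Sgn w3_bar (1/2) 1"
    by (rule dyadic_pl.affine[of _ _ 1 _ 0, OF _ _ _ _ _ h(5)]) (simp_all add: Sgn_numeral)
  ultimately show d: "dyadic_pl Sgn w3_bar 0 1" by (blast intro: dyadic_pl.join)
  show "w3_bar ` {0..1} = {0..1}"
    by (rule continuous_image_unit_interval[OF dyadic_pl_continuous[OF d], of 0 1]) (auto simp: w3_bar_def)
  fix A :: "real set" assume A: "A \<in> sets borel" "w3_bar -` A \<in> sets borel"
  have "1 * measure lborel (w3_bar -` A \<inter> {0..1/4}) = measure lborel (A \<inter> {0..1/4})"
    by (rule measure_affine_vimage_pos[OF A(1) _ _ h(1)]) auto
  moreover have "2 * measure lborel (w3_bar -` A \<inter> {1/4..3/8}) = measure lborel (A \<inter> {1/4..1/2})"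
    by (rule measure_affine_vimage_pos[OF A(1) _ _ h(2)]) auto
  moreover have "- (- 4) * measure lborel (w3_bar -` A \<inter> {3/8..7/16}) = measure lborel (A \<inter> {1/4..1/2})"
    by (rule measure_affine_vimage_neg[OF A(1) _ _ h(3)]) auto
  moreover have "4 * measure lborel (w3_bar -` A \<inter> {7/16..1/2}) = measure lborel (A \<inter> {1/4..1/2})"
    by (rule measure_affine_vimage_pos[OF A(1) _ _ h(4)]) auto
  moreover have "1 * measure lborel (w3_bar -` A \<inter> {1/2..1}) = measure lborel (A \<inter> {1/2..1})"
    by (rule measure_affine_vimage_pos[OF A(1) _ _ h(5)]) auto
  ultimately show "measure lborel (w3_bar -` A \<inter> {0..1}) = measure lborel (A \<inter> {0..1})"
    using measure_lborel_Icc_split[OF A(2), of 0 "1/4" 1] measure_lborel_Icc_split[OF A(2), of "1/4" "3/8" 1]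
      measure_lborel_Icc_split[OF A(2), of "3/8" "7/16" 1] measure_lborel_Icc_split[OF A(2), of "7/16" "1/2" 1]
      measure_lborel_Icc_split[OF A(1), of 0 "1/4" 1] measure_lborel_Icc_split[OF A(1), of "1/4" "1/2" 1] by simp
qed

lemma generating_sets_thompson_monoid: "\<Phi> \<in> generating_sets \<Longrightarrow> \<Phi> \<subseteq> thompson_monoid"
  unfolding generating_sets_def
  using g0_plus_thompson_monoid g0_minus_thompson_monoid w3_bar_thompson_monoid
    w2_right_thompson_monoid w2_full_thompson_monoid by auto

section \<open>The monoid of products of equivalence classes\<close>

abbreviation icomp :: "(real \<Rightarrow> real) \<Rightarrow> (real \<Rightarrow> real) \<Rightarrow> real \<Rightarrow> real" (infixr "\<bullet>" 70) where
  "f \<bullet> g \<equiv> compose {0..1} f g"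

abbreviation selfmaps :: "(real \<Rightarrow> real) set" where
  "selfmaps \<equiv> {0..1} \<rightarrow>\<^sub>E {0..1}"

lemma selfmaps_compose [simp]: "f \<in> selfmaps \<Longrightarrow> g \<in> selfmaps \<Longrightarrow> f \<bullet> g \<in> selfmaps"
  by (auto simp: compose_def PiE_iff)

lemma icomp_assoc [simp]: "h \<in> selfmaps \<Longrightarrow> (f \<bullet> g) \<bullet> h = f \<bullet> g \<bullet> h"
  by (rule compose_assoc[symmetric]) auto

lemma g0_plus_selfmaps [simp]: "g0_plus \<in> selfmaps"
  by (auto simp: g0_plus_def)

lemma g0_plus_icomp [simp]: "g \<in> selfmaps \<Longrightarrow> g0_plus \<bullet> g = g"
  unfolding g0_plus_def by (rule Id_compose) (auto simp: PiE_def)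

lemma icomp_g0_plus [simp]: "g \<in> selfmaps \<Longrightarrow> g \<bullet> g0_plus = g"
  unfolding g0_plus_def by (rule compose_Id) (auto simp: PiE_def)

lemma thompson_group_selfmaps [simp]: "f \<in> thompson_group \<Longrightarrow> f \<in> selfmaps"
  using thompson_group_funcset unfolding PiE_def by (simp add: thompson_group_iff)

lemma thompson_monoid_selfmaps [simp]: "g \<in> thompson_monoid \<Longrightarrow> g \<in> selfmaps"
  using thompson_monoid_funcset unfolding PiE_def by (simp add: thompson_monoid_iff)

lemma icomp_cancel: "f \<bullet> h = g0_plus \<Longrightarrow> h \<in> selfmaps \<Longrightarrow> g \<in> selfmaps \<Longrightarrow> f \<bullet> h \<bullet> g = g"
  by (simp add: icomp_assoc[symmetric])

section \<open>The equivalence classes\<close>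

lemma mem_eclass_iff:
  "h \<in> eclass g \<longleftrightarrow> h \<in> thompson_monoid \<and> g \<in> thompson_monoid \<and>
    (\<exists>f1\<in>thompson_group. \<exists>f2\<in>thompson_group. g = f1 \<bullet> h \<bullet> f2)"
  unfolding eclass_def thompson_equiv_def by auto

lemma eclass_self: "g \<in> thompson_monoid \<Longrightarrow> g \<in> eclass g"
  unfolding mem_eclass_iff using g0_plus_thompson_group
  by (intro conjI bexI[of _ g0_plus]) simp_all

lemma eclass_sym:
  assumes "h \<in> eclass g" shows "g \<in> eclass h"
proof -
  obtain f1 f2 where f: "f1 \<in> thompson_group" "f2 \<in> thompson_group" "g = f1 \<bullet> h \<bullet> f2"
    "h \<in> thompson_monoid" "g \<in> thompson_monoid" using assms unfolding mem_eclass_iff by blast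
  obtain k1 where k1: "k1 \<in> thompson_group" "k1 \<bullet> f1 = g0_plus" using thompson_group_inverse[OF f(1)] by metis
  obtain k2 where k2: "k2 \<in> thompson_group" "f2 \<bullet> k2 = g0_plus" using thompson_group_inverse[OF f(2)] by metis
  have "k1 \<bullet> g \<bullet> k2 = h" using f k1 k2 by (simp add: icomp_cancel)
  then show ?thesis unfolding mem_eclass_iff using f(4,5) k1(1) k2(1) by metis
qed

lemma eclass_trans:
  assumes "h \<in> eclass g" "k \<in> eclass h" shows "k \<in> eclass g"
proof -
  obtain f1 f2 where f: "f1 \<in> thompson_group" "f2 \<in> thompson_group" "g = f1 \<bullet> h \<bullet> f2"
    "g \<in> thompson_monoid" using assms unfolding mem_eclass_iff by blast
  obtain k1 k2 where k: "k1 \<in> thompson_group" "k2 \<in> thompson_group" "h = k1 \<bullet> k \<bullet> k2"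
    "k \<in> thompson_monoid" using assms unfolding mem_eclass_iff by blast
  have "g = (f1 \<bullet> k1) \<bullet> k \<bullet> (k2 \<bullet> f2)" using f k by simp
  then show ?thesis unfolding mem_eclass_iff using f k thompson_group_compose by blast
qed

lemma eclass_eq: "h \<in> eclass g \<Longrightarrow> eclass h = eclass g"
  using eclass_trans eclass_sym by blast

text \<open>A member \<open>h\<close> lies both in the group and in the monoid. Being increasing, it
  pulls \<open>[0, h x]\<close> back to \<open>[0, x]\<close>; equality of the two measures gives
  \<open>h x = x\<close>. That the class is a singleton is what makes it neutral for
  \<open>\<odot>\<close>.\<close>

lemma eclass_g0_plus: "eclass g0_plus = {g0_plus}"
proof -
  have "h = g0_plus" if h: "h \<in> eclass g0_plus" for h
  proof -
    obtain f1 f2 where f: "f1 \<in> thompson_group" "f2 \<in> thompson_group" "h = f1 \<bullet> g0_plus \<bullet> f2"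
      "h \<in> thompson_monoid" using eclass_sym[OF h] unfolding mem_eclass_iff by blast
    then have "h \<in> thompson_group" using thompson_group_compose by simp
    then have d: "dyadic_pl Pos h 0 1" "h 0 = 0" "h 1 = 1" by (auto simp: thompson_group_iff)
    have lp: "lambda_preserving h" using f(4) by (simp add: thompson_monoid_iff)
    have "h x = x" if x: "x \<in> {0..1}" for x
    proof -
      have hx: "h x \<in> {0..1}" using dyadic_pl_image_le[OF d(1) x] unfolding d(2,3) .
      have iff: "h y \<in> {0..h x} \<longleftrightarrow> y \<le> x" if y: "y \<in> {0..1}" for y
      proof (cases "y \<le> x")
        case True
        have "h y \<le> h x" by (rule strict_mono_on_leD[OF dyadic_pl_strict_mono[OF d(1)] y x True])
        moreover have "0 \<le> h y" using dyadic_pl_image_le[OF d(1) y] unfolding d(2) by simp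
        ultimately show ?thesis using True by simp
      next
        case False
        then have "x < y" by simp
        then have "h x < h y" by (rule strict_mono_onD[OF dyadic_pl_strict_mono[OF d(1)] x y])
        then show ?thesis using False by simp
      qed
      have "h -` {0..h x} \<inter> {0..1} = {0..x}"
      proof (rule Set.set_eqI)
        fix y
        have "y \<in> {0..x} \<longleftrightarrow> y \<in> {0..1} \<and> y \<le> x" using x by auto
        then show "y \<in> h -` {0..h x} \<inter> {0..1} \<longleftrightarrow> y \<in> {0..x}"
          using iff[of y] unfolding Int_iff vimage_eq by blast
      qed
      moreover have "emeasure lborel {0..h x} = emeasure lborel (h -` {0..h x} \<inter> {0..1})"
        by (rule lp[unfolded lambda_preserving_def, rule_format]) (use hx in auto)
      ultimately show ?thesis using x hx by simp
    qed
    moreover have "h \<in> selfmaps" using f(4) by simp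
    ultimately show ?thesis
      by (intro extensionalityI[of h "{0..1}" g0_plus]) (auto simp: g0_plus_def PiE_def)
  qed
  then show ?thesis using eclass_self[OF g0_plus_thompson_monoid] by blast
qed

text \<open>For such \<open>A\<close> the union \<open>\<Union>A\<close> is closed under equivalence
  and determines \<open>A\<close>, so products can be computed with representatives taken from
  \<open>\<Union>A\<close>.\<close>

definition class_set :: "(real \<Rightarrow> real) set set \<Rightarrow> bool" where
  "class_set A \<longleftrightarrow> A \<subseteq> eclass ` thompson_monoid"

lemma class_set_Union_subset: "class_set A \<Longrightarrow> \<Union>A \<subseteq> thompson_monoid"
  unfolding class_set_def by (auto simp: mem_eclass_iff)

lemma class_set_mem [simp]: "class_set A \<Longrightarrow> h \<in> \<Union>A \<Longrightarrow> h \<in> thompson_monoid"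
  using class_set_Union_subset by blast

lemma class_set_saturated:
  assumes "class_set A" "h \<in> \<Union>A" "k \<in> eclass h" shows "k \<in> \<Union>A"
proof -
  obtain C where "C \<in> A" "h \<in> C" using assms(2) by blast
  moreover obtain g where "C = eclass g" using assms(1) \<open>C \<in> A\<close> unfolding class_set_def by blast
  ultimately show ?thesis using eclass_trans assms(3) by blast
qed

lemma class_set_eq_image:
  assumes "class_set A" shows "A = eclass ` \<Union>A"
proof (intro equalityI subsetI)
  fix C assume C: "C \<in> A"
  then obtain g where g: "g \<in> thompson_monoid" "C = eclass g" using assms unfolding class_set_def by blast
  then show "C \<in> eclass ` \<Union>A" using C eclass_self by blast
next
  fix D assume "D \<in> eclass ` \<Union>A"
  then obtain h C where h: "D = eclass h" "h \<in> C" "C \<in> A" by blast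
  then obtain g where "C = eclass g" using assms unfolding class_set_def by blast
  then show "D \<in> A" using h eclass_eq by simp
qed

lemma eprod_eq: "A \<odot> B = {eclass (h1 \<bullet> h2) |h1 h2. h1 \<in> \<Union>A \<and> h2 \<in> \<Union>B}"
  unfolding eprod_def by blast

lemma class_set_eprod: "class_set A \<Longrightarrow> class_set B \<Longrightarrow> class_set (A \<odot> B)"
proof -
  assume A: "class_set A" and B: "class_set B"
  show ?thesis unfolding class_set_def eprod_eq
  proof (rule subsetI)
    fix X assume "X \<in> {eclass (h1 \<bullet> h2) |h1 h2. h1 \<in> \<Union>A \<and> h2 \<in> \<Union>B}"
    then obtain h1 h2 where "X = eclass (h1 \<bullet> h2)" "h1 \<in> \<Union>A" "h2 \<in> \<Union>B" by blast
    then show "X \<in> eclass ` thompson_monoid"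
      using thompson_monoid_compose[OF class_set_mem[OF A] class_set_mem[OF B]] by blast
  qed
qed

lemma Union_eprodI:
  assumes "class_set A" "class_set B" "h1 \<in> \<Union>A" "h2 \<in> \<Union>B" shows "h1 \<bullet> h2 \<in> \<Union>(A \<odot> B)"
proof -
  have "h1 \<bullet> h2 \<in> thompson_monoid"
    by (intro thompson_monoid_compose class_set_mem[OF assms(1,3)] class_set_mem[OF assms(2,4)])
  then have "h1 \<bullet> h2 \<in> eclass (h1 \<bullet> h2)" by (rule eclass_self)
  then show ?thesis unfolding eprod_eq using assms(3,4) by blast
qed

text \<open>A group element on the left of a factor is traded for one on its right, while the new
  factor stays in \<open>\<Union>A\<close>. The inverse \<open>\<phi>'\<close> is what gets handed
  on to the next factor.\<close>

lemma class_set_shift: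
  assumes "class_set A" "h \<in> \<Union>A" "f \<in> thompson_group"
  obtains \<phi> \<phi>' where "\<phi> \<in> thompson_group" "\<phi>' \<in> thompson_group" "\<phi> \<bullet> \<phi>' = g0_plus" "f \<bullet> h \<bullet> \<phi> \<in> \<Union>A"
proof -
  obtain \<phi> where p: "\<phi> \<in> thompson_group" "f \<bullet> h \<bullet> \<phi> \<in> thompson_monoid"
    using thompson_group_correction[OF assms(3) class_set_mem[OF assms(1,2)]] by blast
  then have "h \<in> eclass (f \<bullet> h \<bullet> \<phi>)"
    unfolding mem_eclass_iff using assms by auto
  then have "f \<bullet> h \<bullet> \<phi> \<in> \<Union>A"
    using class_set_saturated[OF assms(1,2)] eclass_sym by blast
  then show ?thesis using that p thompson_group_inverse[OF p(1)] by metis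
qed

lemma eclass_icomp_right:
  assumes "k \<in> thompson_monoid" "k \<bullet> \<phi> \<in> thompson_monoid" "\<phi> \<in> thompson_group"
  shows "eclass (k \<bullet> \<phi>) = eclass k"
proof -
  have "k \<in> eclass (k \<bullet> \<phi>)"
    unfolding mem_eclass_iff using assms g0_plus_thompson_group
    by (intro conjI bexI[of _ g0_plus] bexI[of _ \<phi>]) simp_all
  then show ?thesis using eclass_eq by blast
qed

text \<open>The common value of both bracketings, in which no partial product is replaced by an
  equivalent map.\<close>

definition triple_prod :: "(real \<Rightarrow> real) set set \<Rightarrow> (real \<Rightarrow> real) set set \<Rightarrow> (real \<Rightarrow> real) set set \<Rightarrow> (real \<Rightarrow> real) set set" where
  "triple_prod A B C = {eclass (h1 \<bullet> h2 \<bullet> h3) |h1 h2 h3. h1 \<in> \<Union>A \<and> h2 \<in> \<Union>B \<and> h3 \<in> \<Union>C}"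

lemma triple_prodI: "h1 \<in> \<Union>A \<Longrightarrow> h2 \<in> \<Union>B \<Longrightarrow> h3 \<in> \<Union>C \<Longrightarrow> eclass (h1 \<bullet> h2 \<bullet> h3) \<in> triple_prod A B C"
  unfolding triple_prod_def by blast

lemma mem_Union_eprodE:
  assumes "class_set A" "class_set B" "k \<in> \<Union>(A \<odot> B)"
  obtains h1 h2 f1 f2 where "h1 \<in> \<Union>A" "h2 \<in> \<Union>B" "f1 \<in> thompson_group" "f2 \<in> thompson_group"
    "k = f1 \<bullet> h1 \<bullet> h2 \<bullet> f2" "k \<in> thompson_monoid"
proof -
  obtain h1 h2 where h: "h1 \<in> \<Union>A" "h2 \<in> \<Union>B" "k \<in> eclass (h1 \<bullet> h2)"
    using assms(3) unfolding eprod_eq by blast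
  obtain f1 f2 where "f1 \<in> thompson_group" "f2 \<in> thompson_group" "k = f1 \<bullet> (h1 \<bullet> h2) \<bullet> f2" "k \<in> thompson_monoid"
    using eclass_sym[OF h(3)] unfolding mem_eclass_iff by blast
  then show ?thesis using that h by simp
qed

text \<open>A representative \<open>k\<close> of the partial product brings in \<open>f1\<close>
  before \<open>h1\<close> and \<open>f2\<close> between \<open>h2\<close> and \<open>h3\<close>.
  Both are pushed to the right through the factors; what is left over at the right end does not
  change the class.\<close>

lemma eprod_left_eq_triple:
  assumes A: "class_set A" and B: "class_set B" and C: "class_set C"
  shows "A \<odot> B \<odot> C = triple_prod A B C"
proof (intro equalityI subsetI)
  fix X assume "X \<in> A \<odot> B \<odot> C"
  then obtain k h3 where k: "k \<in> \<Union>(A \<odot> B)" "h3 \<in> \<Union>C" "X = eclass (k \<bullet> h3)"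
    unfolding eprod_eq[of "A \<odot> B" C] by blast
  obtain h1 h2 f1 f2 where h: "h1 \<in> \<Union>A" "h2 \<in> \<Union>B" "f1 \<in> thompson_group" "f2 \<in> thompson_group"
    "k = f1 \<bullet> h1 \<bullet> h2 \<bullet> f2" "k \<in> thompson_monoid" using mem_Union_eprodE[OF A B k(1)] .
  obtain \<phi>1 \<phi>1' where p1: "\<phi>1 \<in> thompson_group" "\<phi>1' \<in> thompson_group" "\<phi>1 \<bullet> \<phi>1' = g0_plus" "f1 \<bullet> h1 \<bullet> \<phi>1 \<in> \<Union>A"
    using class_set_shift[OF A h(1,3)] .
  obtain \<phi>2 \<phi>2' where p2: "\<phi>2 \<in> thompson_group" "\<phi>2' \<in> thompson_group" "\<phi>2 \<bullet> \<phi>2' = g0_plus" "\<phi>1' \<bullet> h2 \<bullet> \<phi>2 \<in> \<Union>B"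
    using class_set_shift[OF B h(2) p1(2)] .
  have p2f: "\<phi>2' \<bullet> f2 \<in> thompson_group" using p2 h thompson_group_compose by blast
  obtain \<phi>3 \<phi>3' where p3: "\<phi>3 \<in> thompson_group" "\<phi>3' \<in> thompson_group" "\<phi>3 \<bullet> \<phi>3' = g0_plus"
      "(\<phi>2' \<bullet> f2) \<bullet> h3 \<bullet> \<phi>3 \<in> \<Union>C"
    using class_set_shift[OF C k(2) p2f] .
  have m [simp]: "h1 \<in> selfmaps" "h2 \<in> selfmaps" "h3 \<in> selfmaps"
    using class_set_mem A B C h k by simp_all
  \<comment> \<open>The pairs \<open>\<phi>1 \<bullet> \<phi>1'\<close> and
    \<open>\<phi>2 \<bullet> \<phi>2'\<close> cancel, and only \<open>\<phi>3\<close>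
    survives.\<close>
  have "(f1 \<bullet> h1 \<bullet> \<phi>1) \<bullet> (\<phi>1' \<bullet> h2 \<bullet> \<phi>2) \<bullet> ((\<phi>2' \<bullet> f2) \<bullet> h3 \<bullet> \<phi>3) = (k \<bullet> h3) \<bullet> \<phi>3"
    using h(3-5) p1(1-3) p2(1-3) p3(1-3) by (simp add: icomp_cancel)
  moreover have "(f1 \<bullet> h1 \<bullet> \<phi>1) \<bullet> (\<phi>1' \<bullet> h2 \<bullet> \<phi>2) \<bullet> ((\<phi>2' \<bullet> f2) \<bullet> h3 \<bullet> \<phi>3) \<in> thompson_monoid"
    by (intro thompson_monoid_compose class_set_mem[OF A p1(4)] class_set_mem[OF B p2(4)] class_set_mem[OF C p3(4)])
  moreover have "k \<bullet> h3 \<in> thompson_monoid"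
    using h(6) class_set_mem[OF C k(2)] by (rule thompson_monoid_compose)
  ultimately have "X = eclass ((f1 \<bullet> h1 \<bullet> \<phi>1) \<bullet> (\<phi>1' \<bullet> h2 \<bullet> \<phi>2) \<bullet> ((\<phi>2' \<bullet> f2) \<bullet> h3 \<bullet> \<phi>3))"
    unfolding k(3) using eclass_icomp_right[of "k \<bullet> h3" \<phi>3] p3(1) by metis
  then show "X \<in> triple_prod A B C" using triple_prodI[OF p1(4) p2(4) p3(4)] by simp
next
  fix X assume "X \<in> triple_prod A B C"
  then obtain h1 h2 h3 where h: "h1 \<in> \<Union>A" "h2 \<in> \<Union>B" "h3 \<in> \<Union>C" "X = eclass (h1 \<bullet> h2 \<bullet> h3)"
    unfolding triple_prod_def by blast
  have "X = eclass ((h1 \<bullet> h2) \<bullet> h3)" using h class_set_mem[OF C] by simp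
  then show "X \<in> A \<odot> B \<odot> C"
    unfolding eprod_eq[of "A \<odot> B" C] using Union_eprodI[OF A B h(1,2)] h(3) by blast
qed

text \<open>Now \<open>f1\<close> stands between \<open>h1\<close> and \<open>h2\<close>, so the
  shifting starts at \<open>h2\<close>. The discrepancy at the right end is the group element
  \<open>f2' \<bullet> \<phi>3\<close>.\<close>

lemma eprod_right_eq_triple:
  assumes A: "class_set A" and B: "class_set B" and C: "class_set C"
  shows "A \<odot> (B \<odot> C) = triple_prod A B C"
proof (intro equalityI subsetI)
  fix X assume "X \<in> A \<odot> (B \<odot> C)"
  then obtain h1 k where k: "h1 \<in> \<Union>A" "k \<in> \<Union>(B \<odot> C)" "X = eclass (h1 \<bullet> k)"
    unfolding eprod_eq[of A "B \<odot> C"] by blast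
  obtain h2 h3 f1 f2 where h: "h2 \<in> \<Union>B" "h3 \<in> \<Union>C" "f1 \<in> thompson_group" "f2 \<in> thompson_group"
    "k = f1 \<bullet> h2 \<bullet> h3 \<bullet> f2" "k \<in> thompson_monoid" using mem_Union_eprodE[OF B C k(2)] .
  obtain \<phi>2 \<phi>2' where p2: "\<phi>2 \<in> thompson_group" "\<phi>2' \<in> thompson_group" "\<phi>2 \<bullet> \<phi>2' = g0_plus" "f1 \<bullet> h2 \<bullet> \<phi>2 \<in> \<Union>B"
    using class_set_shift[OF B h(1,3)] .
  obtain \<phi>3 \<phi>3' where p3: "\<phi>3 \<in> thompson_group" "\<phi>3' \<in> thompson_group" "\<phi>3 \<bullet> \<phi>3' = g0_plus" "\<phi>2' \<bullet> h3 \<bullet> \<phi>3 \<in> \<Union>C"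
    using class_set_shift[OF C h(2) p2(2)] .
  obtain f2' where f2': "f2' \<in> thompson_group" "f2 \<bullet> f2' = g0_plus"
    using thompson_group_inverse[OF h(4)] by metis
  have m [simp]: "h1 \<in> selfmaps" "h2 \<in> selfmaps" "h3 \<in> selfmaps"
    using class_set_mem A B C h k by simp_all
  have "h1 \<bullet> (f1 \<bullet> h2 \<bullet> \<phi>2) \<bullet> (\<phi>2' \<bullet> h3 \<bullet> \<phi>3) = (h1 \<bullet> k) \<bullet> (f2' \<bullet> \<phi>3)"
    using h(3-5) p2(1-3) p3(1-3) f2' by (simp add: icomp_cancel)
  moreover have "h1 \<bullet> (f1 \<bullet> h2 \<bullet> \<phi>2) \<bullet> (\<phi>2' \<bullet> h3 \<bullet> \<phi>3) \<in> thompson_monoid"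
    by (intro thompson_monoid_compose class_set_mem[OF A k(1)] class_set_mem[OF B p2(4)] class_set_mem[OF C p3(4)])
  moreover have "h1 \<bullet> k \<in> thompson_monoid"
    using class_set_mem[OF A k(1)] h(6) by (rule thompson_monoid_compose)
  moreover have "f2' \<bullet> \<phi>3 \<in> thompson_group" using f2'(1) p3(1) by (rule thompson_group_compose)
  ultimately have "X = eclass (h1 \<bullet> (f1 \<bullet> h2 \<bullet> \<phi>2) \<bullet> (\<phi>2' \<bullet> h3 \<bullet> \<phi>3))"
    unfolding k(3) using eclass_icomp_right[of "h1 \<bullet> k" "f2' \<bullet> \<phi>3"] by metis
  then show "X \<in> triple_prod A B C" using triple_prodI[OF k(1) p2(4) p3(4)] by simp
next
  fix X assume "X \<in> triple_prod A B C"
  then obtain h1 h2 h3 where h: "h1 \<in> \<Union>A" "h2 \<in> \<Union>B" "h3 \<in> \<Union>C" "X = eclass (h1 \<bullet> h2 \<bullet> h3)"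
    unfolding triple_prod_def by blast
  then show "X \<in> A \<odot> (B \<odot> C)"
    unfolding eprod_eq[of A "B \<odot> C"] using Union_eprodI[OF B C h(2,3)] by blast
qed

lemma eprod_assoc:
  "class_set A \<Longrightarrow> class_set B \<Longrightarrow> class_set C \<Longrightarrow> A \<odot> B \<odot> C = A \<odot> (B \<odot> C)"
  by (simp add: eprod_left_eq_triple eprod_right_eq_triple)

section \<open>Unit, closure and generation of the monoid of products\<close>

lemma eclasses_g0_plus: "eclasses {g0_plus} = {{g0_plus}}"
  unfolding eclasses_def by (simp add: eclass_g0_plus)

lemma eprod_one_left: "class_set A \<Longrightarrow> eclasses {g0_plus} \<odot> A = A"
proof -
  assume A: "class_set A"
  have "eclasses {g0_plus} \<odot> A = (\<lambda>h. eclass (g0_plus \<bullet> h)) ` \<Union>A"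
    unfolding eprod_eq eclasses_g0_plus by auto
  also have "\<dots> = eclass ` \<Union>A" using class_set_mem[OF A] by (intro image_cong) auto
  finally show ?thesis using class_set_eq_image[OF A] by simp
qed

lemma eprod_one_right: "class_set A \<Longrightarrow> A \<odot> eclasses {g0_plus} = A"
proof -
  assume A: "class_set A"
  have "A \<odot> eclasses {g0_plus} = (\<lambda>h. eclass (h \<bullet> g0_plus)) ` \<Union>A"
    unfolding eprod_eq eclasses_g0_plus by auto
  also have "\<dots> = eclass ` \<Union>A" using class_set_mem[OF A] by (intro image_cong) auto
  finally show ?thesis using class_set_eq_image[OF A] by simp
qed

lemma class_set_generating: "\<Phi> \<in> generating_sets \<Longrightarrow> class_set (eclasses \<Phi>)"
  unfolding class_set_def eclasses_def using generating_sets_thompson_monoid by blast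

lemma class_set_foldl:
  "\<Phi> \<in> generating_sets \<Longrightarrow> set \<Phi>s \<subseteq> generating_sets \<Longrightarrow>
    class_set (foldl (\<odot>) (eclasses \<Phi>) (map eclasses \<Phi>s))"
  by (induction \<Phi>s rule: rev_induct) (auto intro: class_set_eprod class_set_generating)

lemma class_set_eproducts: "A \<in> eproducts \<Longrightarrow> class_set A"
  unfolding eproducts_def using class_set_foldl by blast

lemma eclasses_eproducts: "\<Phi> \<in> generating_sets \<Longrightarrow> eclasses \<Phi> \<in> eproducts"
  unfolding eproducts_def by (rule CollectI, intro exI[of _ \<Phi>] exI[of _ "[]"]) simp

lemma eproducts_eprod_generator:
  assumes "A \<in> eproducts" "\<Phi> \<in> generating_sets" shows "A \<odot> eclasses \<Phi> \<in> eproducts"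
proof -
  obtain \<Psi> \<Psi>s where "A = foldl (\<odot>) (eclasses \<Psi>) (map eclasses \<Psi>s)" "\<Psi> \<in> generating_sets" "set \<Psi>s \<subseteq> generating_sets"
    using assms(1) unfolding eproducts_def by blast
  then show ?thesis using assms(2) unfolding eproducts_def
    by (intro CollectI exI[of _ \<Psi>] exI[of _ "\<Psi>s @ [\<Phi>]"]) simp
qed

lemma eproducts_induct [consumes 1, case_names generator eprod]:
  assumes "A \<in> eproducts"
    and gen: "\<And>\<Phi>. \<Phi> \<in> generating_sets \<Longrightarrow> P (eclasses \<Phi>)"
    and step: "\<And>A \<Phi>. A \<in> eproducts \<Longrightarrow> P A \<Longrightarrow> \<Phi> \<in> generating_sets \<Longrightarrow> P (A \<odot> eclasses \<Phi>)"
  shows "P A"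
proof -
  obtain \<Psi> \<Psi>s where A: "A = foldl (\<odot>) (eclasses \<Psi>) (map eclasses \<Psi>s)" and \<Psi>: "\<Psi> \<in> generating_sets"
    and \<Psi>s: "set \<Psi>s \<subseteq> generating_sets"
    using assms(1) unfolding eproducts_def by blast
  have "foldl (\<odot>) (eclasses \<Psi>) (map eclasses \<Psi>s) \<in> eproducts \<and> P (foldl (\<odot>) (eclasses \<Psi>) (map eclasses \<Psi>s))"
    using \<Psi>s
  proof (induction \<Psi>s rule: rev_induct)
    case Nil
    then show ?case using \<Psi> gen eclasses_eproducts by simp
  next
    case (snoc \<Phi> \<Psi>s)
    then show ?case using step eproducts_eprod_generator by simp
  qed
  then show ?thesis unfolding A by blast
qed

lemma eproducts_eprod:
  assumes "A \<in> eproducts" "B \<in> eproducts" shows "A \<odot> B \<in> eproducts"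
  using assms(2)
proof (induction rule: eproducts_induct)
  case (generator \<Phi>)
  then show ?case using assms(1) by (rule eproducts_eprod_generator[rotated])
next
  case (eprod B \<Phi>)
  then show ?case
    using eproducts_eprod_generator class_set_eproducts class_set_generating assms(1)
    by (metis eprod_assoc)
qed

lemma g0_plus_generating: "{g0_plus} \<in> generating_sets"
  by (simp add: generating_sets_def)

lemma monoid_eproducts: "monoid \<lparr>carrier = eproducts, mult = (\<odot>), one = eclasses {g0_plus}\<rparr>"
  by (rule monoidI)
    (simp_all add: eproducts_eprod eclasses_eproducts g0_plus_generating eprod_assoc class_set_eproducts
      eprod_one_left eprod_one_right)

lemma finitely_generated_eproducts:
  "finitely_generated_monoid \<lparr>carrier = eproducts, mult = (\<odot>), one = eclasses {g0_plus}\<rparr>" (is "finitely_generated_monoid ?M")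
  unfolding finitely_generated_monoid_def
proof (intro conjI monoid_eproducts exI[of _ "eclasses ` generating_sets"] allI impI)
  show "finite (eclasses ` generating_sets)" by (simp add: generating_sets_def)
  show "eclasses ` generating_sets \<subseteq> carrier ?M" using eclasses_eproducts by auto
  fix H assume H: "submonoid H ?M \<and> eclasses ` generating_sets \<subseteq> H"
  then interpret submonoid H ?M by blast
  have "A \<in> H" if "A \<in> eproducts" for A
    using that by (induction rule: eproducts_induct) (use H m_closed in auto)
  then show "H = carrier ?M" using subset by auto
qed

text \<open>The factor \<open>\<phi>\<close> admits maps that do not preserve
  \<open>\<lambda>\<close>, in particular all elements of Thompson's group, so the intermediate maps
  of a factorisation are covered.\<close>

definition representable :: "(real \<Rightarrow> real) \<Rightarrow> bool" where
  "representable s \<longleftrightarrow> (\<exists>\<phi>\<in>thompson_group. \<exists>A\<in>eproducts. s \<bullet> \<phi> \<in> \<Union>A)"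

text \<open>The \<open>\<phi>\<close> behind \<open>s\<close> is cancelled by putting its inverse in
  front of \<open>t \<bullet> \<psi>\<close>; a shift then repairs the second factor at the cost of
  a further group element on the right.\<close>

lemma representable_compose:
  assumes "representable s" "representable t" "s \<in> selfmaps" "t \<in> selfmaps"
  shows "representable (s \<bullet> t)"
proof -
  obtain \<phi> A where p: "\<phi> \<in> thompson_group" "A \<in> eproducts" "s \<bullet> \<phi> \<in> \<Union>A"
    using assms(1) unfolding representable_def by blast
  obtain \<psi> B where q: "\<psi> \<in> thompson_group" "B \<in> eproducts" "t \<bullet> \<psi> \<in> \<Union>B"
    using assms(2) unfolding representable_def by blast
  obtain \<phi>' where p': "\<phi>' \<in> thompson_group" "\<phi> \<bullet> \<phi>' = g0_plus" using thompson_group_inverse[OF p(1)] by metis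
  obtain \<theta> \<theta>' where r: "\<theta> \<in> thompson_group" "\<theta>' \<in> thompson_group" "\<theta> \<bullet> \<theta>' = g0_plus" "\<phi>' \<bullet> (t \<bullet> \<psi>) \<bullet> \<theta> \<in> \<Union>B"
    using class_set_shift[OF class_set_eproducts[OF q(2)] q(3) p'(1)] .
  have "(s \<bullet> \<phi>) \<bullet> (\<phi>' \<bullet> (t \<bullet> \<psi>) \<bullet> \<theta>) \<in> \<Union>(A \<odot> B)"
    using Union_eprodI class_set_eproducts p q r by blast
  also have "(s \<bullet> \<phi>) \<bullet> (\<phi>' \<bullet> (t \<bullet> \<psi>) \<bullet> \<theta>) = (s \<bullet> t) \<bullet> (\<psi> \<bullet> \<theta>)"
    using p(1) p' q(1) r(1) assms(3,4) by (simp add: icomp_cancel)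
  finally show ?thesis unfolding representable_def
    using eproducts_eprod thompson_group_compose p q r by blast
qed

lemma representable_generator:
  assumes "{g} \<in> generating_sets" shows "representable g"
proof -
  have g: "g \<in> thompson_monoid" using generating_sets_thompson_monoid[OF assms] by simp
  have "g \<bullet> g0_plus \<in> \<Union>(eclasses {g})" using g eclass_self by (simp add: eclasses_def)
  then show ?thesis unfolding representable_def
    using g0_plus_thompson_group eclasses_eproducts[OF assms] by blast
qed

lemma representable_thompson_group:
  assumes "f \<in> thompson_group" shows "representable f"
proof -
  obtain h where "h \<in> thompson_group" "f \<bullet> h = g0_plus" using thompson_group_inverse[OF assms] by metis
  moreover have "g0_plus \<in> \<Union>(eclasses {g0_plus})" by (simp add: eclasses_g0_plus)
  ultimately show ?thesis unfolding representable_def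
    using eclasses_eproducts[OF g0_plus_generating] by metis
qed

lemma representable_Union_eproducts:
  assumes "g \<in> thompson_monoid" "representable g" shows "g \<in> \<Union>(\<Union>eproducts)"
proof -
  obtain \<phi> A where p: "\<phi> \<in> thompson_group" "A \<in> eproducts" "g \<bullet> \<phi> \<in> \<Union>A"
    using assms(2) unfolding representable_def by blast
  have "g \<bullet> \<phi> \<in> thompson_monoid" using class_set_mem[OF class_set_eproducts[OF p(2)] p(3)] .
  then have "g \<in> eclass (g \<bullet> \<phi>)" using eclass_icomp_right[OF assms(1) _ p(1)] eclass_self[OF assms(1)] by simp
  then have "g \<in> \<Union>A" using class_set_saturated[OF class_set_eproducts[OF p(2)] p(3)] by blast
  then show ?thesis using p(2) by blast
qed

section \<open>Zigzags\<close>

definition lap :: "(real \<Rightarrow> real) \<Rightarrow> real \<Rightarrow> real \<Rightarrow> real \<Rightarrow> real \<Rightarrow> bool" where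
  "lap g a b u v \<longleftrightarrow> (dyadic_pl Pos g a b \<or> dyadic_pl Neg g a b) \<and> g a = u \<and> g b = v"

lemma uminus_Neg: "uminus ` Neg = Pos"
  unfolding Neg_def by (simp add: image_image)

lemma uminus_Pos: "uminus ` Pos = Neg"
  unfolding Neg_def ..

text \<open>Reduces the facts about decreasing laps to those about increasing ones.\<close>

lemma lap_uminus:
  assumes "lap g a b u v" shows "lap (\<lambda>x. - g x) a b (- u) (- v)"
  using assms dyadic_pl_uminus[of Pos g a b] dyadic_pl_uminus[of Neg g a b]
  unfolding lap_def uminus_Neg uminus_Pos by auto

lemma dyadic_pl_Neg_value_less:
  assumes "dyadic_pl Neg g a b" shows "g b < g a"
  using dyadic_pl_value_less[OF dyadic_pl_uminus[OF assms, unfolded uminus_Neg]] by simp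

lemma lap_Pos_iff: "lap g a b u v \<Longrightarrow> u < v \<longleftrightarrow> dyadic_pl Pos g a b"
  and lap_Neg_iff: "lap g a b u v \<Longrightarrow> v < u \<longleftrightarrow> dyadic_pl Neg g a b"
  unfolding lap_def using dyadic_pl_value_less[of g a b] dyadic_pl_Neg_value_less[of g a b] by auto

lemma lap_neq: "lap g a b u v \<Longrightarrow> u \<noteq> v"
  unfolding lap_def using dyadic_pl_value_less[of g a b] dyadic_pl_Neg_value_less[of g a b] by auto

lemma lap_less: "lap g a b u v \<Longrightarrow> a < b"
  unfolding lap_def by (auto dest: dyadic_pl_less)

lemma lap_dyadic_pl_Sgn: "lap g a b u v \<Longrightarrow> dyadic_pl Sgn g a b"
  unfolding lap_def using dyadic_pl_mono Pos_Sgn Neg_Sgn by blast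

lemma lap_dyadic:
  assumes "lap g a b u v" shows "dyadic a" "dyadic b" "dyadic u" "dyadic v"
proof -
  note d = lap_dyadic_pl_Sgn[OF assms]
  show "dyadic a" "dyadic b" using dyadic_pl_dyadic[OF d] .
  then show "dyadic u" "dyadic v"
    using dyadic_pl_value[OF d order.refl, of a] dyadic_pl_value[OF d order.refl, of b] dyadic_pl_less[OF d] assms
    by (auto simp: lap_def)
qed

lemma lap_cong:
  assumes "lap g a b u v" "\<And>x. x \<in> {a..b} \<Longrightarrow> h x = g x" shows "lap h a b u v"
  using assms dyadic_pl_cong[OF _ assms(2), of Pos] dyadic_pl_cong[OF _ assms(2), of Neg] lap_less[OF assms(1)]
  unfolding lap_def by auto

lemma lap_image_Pos: "lap g a b u v \<Longrightarrow> u < v \<Longrightarrow> g ` {a..b} = {u..v}"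
  using dyadic_pl_image[of g a b] lap_Pos_iff[of g a b u v] by (auto simp: lap_def)

lemma lap_image:
  assumes "lap g a b u v" shows "g ` {a..b} = {min u v..max u v}"
proof (cases "u < v")
  case True
  then show ?thesis using lap_image_Pos[OF assms] by simp
next
  case False
  then have "v < u" using lap_neq[OF assms] by simp
  then have "uminus ` (\<lambda>x. - g x) ` {a..b} = uminus ` {- u..- v}"
    using lap_image_Pos[OF lap_uminus[OF assms]] by simp
  then show ?thesis using \<open>v < u\<close> by (simp add: image_image)
qed

lemma lap_comp:
  assumes w: "lap w a b p q" and g: "dyadic_pl Pos g c d \<or> dyadic_pl Neg g c d"
    and "{p, q} \<subseteq> {c..d}"
  shows "lap (\<lambda>x. g (w x)) a b (g p) (g q)"
proof -
  have im: "w ` {a..b} \<subseteq> {c..d}" using lap_image[OF w] assms(3) by auto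
  have "dyadic_pl Pos (\<lambda>x. g (w x)) a b \<or> dyadic_pl Neg (\<lambda>x. g (w x)) a b"
    using w g dyadic_pl_comp[OF _ im, of Pos Pos g Pos] dyadic_pl_comp[OF _ im, of Pos Neg g Neg]
      dyadic_pl_comp[OF _ im, of Neg Pos g Neg] dyadic_pl_comp[OF _ im, of Neg Neg g Pos]
      Pos_mult Pos_Neg_mult Neg_Pos_mult Neg_mult Pos_Sgn Neg_Sgn
    unfolding lap_def by blast
  then show ?thesis using w unfolding lap_def by auto
qed

lemma lap_exists:
  assumes "dyadic a" "dyadic b" "a < b" "dyadic u" "dyadic v" "u \<noteq> v"
  shows "\<exists>g. lap g a b u v"
proof -
  have *: "\<exists>g. lap g a b u v" if "dyadic u" "dyadic v" "u < v" for u v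
    using dyadic_pl_interpolate[OF assms(1-3) that] unfolding lap_def by metis
  show ?thesis
  proof (cases "u < v")
    case True
    then show ?thesis using * assms by blast
  next
    case False
    then obtain g where "lap g a b (- u) (- v)" using *[of "- u" "- v"] assms by auto
    from lap_uminus[OF this] show ?thesis by auto
  qed
qed

lemma lap_join:
  assumes "lap g a b u v" "lap g b c v w" "u < v \<and> v < w \<or> w < v \<and> v < u"
  shows "lap g a c u w"
proof -
  have "dyadic_pl Pos g a b \<and> dyadic_pl Pos g b c \<or> dyadic_pl Neg g a b \<and> dyadic_pl Neg g b c"
    using assms lap_Pos_iff[OF assms(1)] lap_Pos_iff[OF assms(2)] lap_Neg_iff[OF assms(1)] lap_Neg_iff[OF assms(2)]
    by auto
  then show ?thesis using assms(1,2) unfolding lap_def by (auto intro: dyadic_pl.join)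
qed

text \<open>Take for \<open>f\<close> the map \<open>g\<close> followed by the inverse of
  \<open>h\<close>.\<close>

lemma lap_factor_Pos:
  assumes g: "lap g a b u v" and h: "lap h c d u v" and "u < v"
  shows "\<exists>f. dyadic_pl Pos f a b \<and> f a = c \<and> f b = d \<and> (\<forall>x\<in>{a..b}. g x = h (f x))"
proof -
  have d: "dyadic_pl Pos g a b" "dyadic_pl Pos h c d" using assms lap_Pos_iff by blast+
  have inj: "inj_on h {c..d}" using dyadic_pl_strict_mono[OF d(2)] by (rule strict_mono_on_imp_inj_on)
  have im: "g ` {a..b} = {u..v}" "h ` {c..d} = {u..v}" using lap_image_Pos assms by auto
  define k where "k = the_inv_into {c..d} h"
  have k: "dyadic_pl Pos k u v" using dyadic_pl_the_inv_into[OF d(2)] h unfolding k_def lap_def by simp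
  have "dyadic_pl Pos (\<lambda>x. k (g x)) a b"
    by (rule dyadic_pl_comp[OF d(1) _ k]) (use im Pos_Sgn Pos_mult in auto)
  moreover have "k (g a) = c" "k (g b) = d"
    using the_inv_into_f_f[OF inj, of c] the_inv_into_f_f[OF inj, of d] g h lap_less[OF h]
    by (auto simp: k_def lap_def)
  moreover have "g x = h (k (g x))" if "x \<in> {a..b}" for x
    using f_the_inv_into_f[OF inj, of "g x"] im that unfolding k_def by (metis imageI)
  ultimately show ?thesis by (intro exI[of _ "\<lambda>x. k (g x)"]) auto
qed

lemma lap_factor:
  assumes g: "lap g a b u v" and h: "lap h c d u v"
  shows "\<exists>f. dyadic_pl Pos f a b \<and> f a = c \<and> f b = d \<and> (\<forall>x\<in>{a..b}. g x = h (f x))"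
proof (cases "u < v")
  case True
  then show ?thesis using lap_factor_Pos[OF g h] by blast
next
  case False
  then have "- u < - v" using lap_neq[OF g] by simp
  from lap_factor_Pos[OF lap_uminus[OF g] lap_uminus[OF h] this] show ?thesis by simp
qed

lemma lap_preimage:
  assumes g: "lap g a b u v" and "dyadic x" "min u v \<le> x" "x \<le> max u v"
  obtains p where "dyadic p" "p \<in> {a..b}" "g p = x"
proof -
  have *: "\<exists>p. dyadic p \<and> p \<in> {a..b} \<and> g p = x"
    if g: "lap g a b u v" and "u < v" "dyadic x" "x \<in> {u..v}" for g u v x
  proof -
    have d: "dyadic_pl Pos g a b" using that lap_Pos_iff by blast
    have inj: "inj_on g {a..b}" using dyadic_pl_strict_mono[OF d] by (rule strict_mono_on_imp_inj_on)
    have x: "x \<in> g ` {a..b}" using lap_image_Pos[OF g] that by simp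
    have "dyadic_pl Pos (the_inv_into {a..b} g) u v" using dyadic_pl_the_inv_into[OF d] g by (simp add: lap_def)
    from dyadic_pl_value[OF this Pos_Sgn that(4,3)] show ?thesis
      using the_inv_into_into[OF inj x order.refl] f_the_inv_into_f[OF inj x] by blast
  qed
  show ?thesis
  proof (cases "u < v")
    case True
    then show ?thesis using *[OF g True assms(2)] assms(3,4) that by auto
  next
    case False
    then have "v < u" using lap_neq[OF g] by simp
    then have "- u < - v" "- x \<in> {- u..- v}" using assms(3,4) by auto
    from *[OF lap_uminus[OF g] this(1) _ this(2)] show ?thesis using assms(2) that by auto
  qed
qed

text \<open>
  The list records the values at the end points of consecutive monotone laps, not necessarily turning
  points; a singleton belongs to the degenerate interval \<open>a = b\<close>, which makes lists easy to cut.
\<close>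

fun zigzag :: "(real \<Rightarrow> real) \<Rightarrow> real \<Rightarrow> real \<Rightarrow> real list \<Rightarrow> bool" where
  "zigzag g a b [] \<longleftrightarrow> False"
| "zigzag g a b [u] \<longleftrightarrow> a = b \<and> g a = u"
| "zigzag g a b (u # v # vs) \<longleftrightarrow> (\<exists>c. lap g a c u v \<and> zigzag g c b (v # vs))"

text \<open>Unfolding a two-element zigzag leaves the redundant conjunct \<open>g b = v\<close> of
  the singleton case; these rules remove it.\<close>

lemma lap_value [simp]: "lap g a b u v \<and> g b = v \<longleftrightarrow> lap g a b u v"
  "lap g a b u v \<and> g b = v \<and> P \<longleftrightarrow> lap g a b u v \<and> P"
  by (auto simp: lap_def)

section \<open>Basic properties of zigzags\<close>

lemma zigzag_two: "zigzag g a b [u, v] \<longleftrightarrow> lap g a b u v"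
  by simp

lemma zigzag_le: "zigzag g a b vs \<Longrightarrow> a \<le> b"
  by (induction g a b vs rule: zigzag.induct) (auto dest!: lap_less intro: less_imp_le order.trans)

lemma zigzag_hd: "zigzag g a b (u # vs) \<Longrightarrow> g a = u"
  by (cases vs) (auto simp: lap_def)

lemma zigzag_less: "zigzag g a b (u # v # vs) \<Longrightarrow> a < b"
  by (auto dest!: lap_less zigzag_le)

lemma zigzag_cong:
  assumes "zigzag g a b vs" "\<And>x. x \<in> {a..b} \<Longrightarrow> h x = g x" shows "zigzag h a b vs"
  using assms
proof (induction g a b vs rule: zigzag.induct)
  case (3 g a b u v vs)
  then obtain c where c: "lap g a c u v" "zigzag g c b (v # vs)" by auto
  have "a < c" "c \<le> b" using lap_less[OF c(1)] zigzag_le[OF c(2)] by auto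
  then have "lap h a c u v" "zigzag h c b (v # vs)"
    using lap_cong[OF c(1)] "3.IH"[OF c(2)] "3.prems"(2) by auto
  then show ?case by auto
qed auto

text \<open>Cutting happens at an entry: \<open>x\<close> closes the first part and opens the
  second. For \<open>us = []\<close> the first part is the degenerate interval.\<close>

lemma zigzag_append:
  "zigzag g a c (us @ x # vs) \<longleftrightarrow> (\<exists>b. zigzag g a b (us @ [x]) \<and> zigzag g b c (x # vs))"
proof (induction us arbitrary: a)
  case Nil
  then show ?case using zigzag_hd[of g a c x vs] by auto
next
  case (Cons u us)
  show ?case
  proof (cases us)
    case Nil
    then show ?thesis by simp
  next
    case (Cons u' us')
    then show ?thesis using Cons.IH by auto
  qed
qed

lemma zigzag_mem_image: "zigzag g a b vs \<Longrightarrow> set vs \<subseteq> g ` {a..b}"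
proof (induction g a b vs rule: zigzag.induct)
  case (3 g a b u v vs)
  then obtain c where c: "lap g a c u v" "zigzag g c b (v # vs)" by auto
  have "a < c" "c \<le> b" using lap_less[OF c(1)] zigzag_le[OF c(2)] by auto
  moreover have "set (v # vs) \<subseteq> g ` {c..b}" using "3.IH"[OF c(2)] .
  moreover have "u = g a" using c(1) by (simp add: lap_def)
  ultimately show ?case by fastforce
qed auto

lemma zigzag_value:
  assumes "zigzag g a b vs" "x \<in> {a..b}" "set vs \<subseteq> {l..r}" shows "g x \<in> {l..r}"
  using assms
proof (induction g a b vs rule: zigzag.induct)
  case (3 g a b u v vs)
  then obtain c where c: "lap g a c u v" "zigzag g c b (v # vs)" by auto
  show ?case
  proof (cases "x \<le> c")
    case True
    then have "g x \<in> {min u v..max u v}" using lap_image[OF c(1)] "3.prems"(2) by (metis atLeastAtMost_iff imageI)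
    then show ?thesis using "3.prems"(3) by auto
  next
    case False
    then show ?thesis using "3.IH"[OF c(2)] "3.prems" by auto
  qed
qed auto

lemma zigzag_distinct_adj: "zigzag g a b vs \<Longrightarrow> distinct_adj vs"
  by (induction g a b vs rule: zigzag.induct) (auto dest: lap_neq)

lemma zigzag_dyadic: "zigzag g a b (u # v # vs) \<Longrightarrow> w \<in> set (u # v # vs) \<Longrightarrow> dyadic w"
proof (induction vs arbitrary: a u v)
  case Nil
  then show ?case using lap_dyadic by auto
next
  case (Cons v' vs)
  then obtain c where c: "lap g a c u v" "zigzag g c b (v # v' # vs)" by auto
  show ?case using Cons.IH[OF c(2)] lap_dyadic[OF c(1)] Cons.prems(2) by auto
qed

lemma zigzag_exists:
  assumes "dyadic a" "dyadic b" "a < b" "\<And>w. w \<in> set (u # v # vs) \<Longrightarrow> dyadic w" "distinct_adj (u # v # vs)"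
  shows "\<exists>g. zigzag g a b (u # v # vs)"
  using assms
proof (induction vs arbitrary: a u v)
  case Nil
  then show ?case using lap_exists[of a b u v] by simp
next
  case (Cons v' vs)
  define c where "c = (a + b) / 2"
  have c: "dyadic c" "a < c" "c < b" using Cons.prems dyadic_divide_powi[of "a + b" 1] by (auto simp: c_def)
  obtain h where h: "zigzag h c b (v # v' # vs)" using Cons.IH[of c v v'] c Cons.prems by auto
  obtain f where f: "lap f a c u v" using lap_exists[of a c u v] c Cons.prems by auto
  define g where "g x = (if x \<le> c then f x else h x)" for x
  have "lap g a c u v" by (rule lap_cong[OF f]) (auto simp: g_def)
  moreover have "zigzag g c b (v # v' # vs)"
  proof (rule zigzag_cong[OF h])
    fix x assume "x \<in> {c..b}"
    then show "g x = h x" using f zigzag_hd[OF h] by (cases "x = c") (auto simp: g_def lap_def)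
  qed
  ultimately show ?case by auto
qed

lemma dyadic_pl_Sgn_zigzag:
  assumes "dyadic_pl Sgn g a b" shows "\<exists>u v vs. zigzag g a b (u # v # vs)"
  using assms
proof (induction rule: dyadic_pl.induct)
  case (affine a b s c)
  have "s \<in> Pos \<or> s \<in> Neg" using affine.hyps(4) by (simp add: Sgn_def)
  then have "lap g a b (g a) (g b)"
    unfolding lap_def using dyadic_pl.affine[of a b s Pos c g] dyadic_pl.affine[of a b s Neg c g] affine.hyps by auto
  then show ?case using zigzag_two by blast
next
  case (join a b c)
  obtain u v vs where 1: "zigzag g a b (u # v # vs)" using join.IH(1) by blast
  obtain u' v' vs' where 2: "zigzag g b c (u' # v' # vs')" using join.IH(2) by blast
  \<comment> \<open>The last value of the left list and the first of the right list are both
    \<open>g b\<close>; one copy is removed before concatenating.\<close>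
  define us x where "us = u # butlast (v # vs)" and "x = last (v # vs)"
  have us: "u # v # vs = us @ [x]" unfolding us_def x_def append_Cons
    by (subst append_butlast_last_id) auto
  have 3: "zigzag g a b (us @ [x])" using 1 unfolding us .
  then obtain b' where "zigzag g b' b [x]" using zigzag_append[of g a b us x "[]"] by blast
  then have "x = u'" using zigzag_hd[OF 2] by auto
  then have z: "zigzag g a c (us @ u' # v' # vs')" using 2 3 zigzag_append[of g a c us u' "v' # vs'"] by blast
  show ?case
  proof (cases "butlast (v # vs)")
    case Nil
    then have "zigzag g a c (u # u' # v' # vs')" using z by (simp only: us_def append_Cons append_Nil)
    then show ?thesis by blast
  next
    case (Cons y ys)
    then have "zigzag g a c (u # y # ys @ u' # v' # vs')" using z by (simp only: us_def append_Cons)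
    then show ?thesis by blast
  qed
qed

text \<open>The factors found on single laps agree at common end points and glue to one increasing
  map. Over the unit interval this map belongs to the group, so the list determines the map up to a
  right factor.\<close>

lemma zigzag_factor:
  assumes "zigzag g a b (u # v # vs)" "zigzag h c d (u # v # vs)"
  shows "\<exists>f. dyadic_pl Pos f a b \<and> f a = c \<and> f b = d \<and> (\<forall>x\<in>{a..b}. g x = h (f x))"
  using assms
proof (induction vs arbitrary: a c u v)
  case Nil
  then show ?case using lap_factor by simp
next
  case (Cons v' vs)
  obtain a' where a': "lap g a a' u v" "zigzag g a' b (v # v' # vs)" using Cons.prems(1) by auto
  obtain c' where c': "lap h c c' u v" "zigzag h c' d (v # v' # vs)" using Cons.prems(2) by auto
  obtain f1 where f1: "dyadic_pl Pos f1 a a'" "f1 a = c" "f1 a' = c'" "\<And>x. x \<in> {a..a'} \<Longrightarrow> g x = h (f1 x)"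
    using lap_factor[OF a'(1) c'(1)] by blast
  obtain f2 where f2: "dyadic_pl Pos f2 a' b" "f2 a' = c'" "f2 b = d" "\<And>x. x \<in> {a'..b} \<Longrightarrow> g x = h (f2 x)"
    using Cons.IH[OF a'(2) c'(2)] by blast
  have lt: "a < a'" "a' < b" using dyadic_pl_less f1 f2 by blast+
  define f where "f x = (if x \<le> a' then f1 x else f2 x)" for x
  have "dyadic_pl Pos f a b" unfolding f_def by (rule dyadic_pl_glue[OF f1(1) f2(1)]) (simp add: f1 f2)
  moreover have "f a = c" "f b = d" using f1 f2 lt by (auto simp: f_def)
  moreover have "g x = h (f x)" if "x \<in> {a..b}" for x
    using f1(4)[of x] f2(4)[of x] that by (auto simp: f_def)
  ultimately show ?case by blast
qed

lemma zigzag_map: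
  assumes "zigzag g a b (u # v # vs)" "dyadic_pl Pos f c d \<or> dyadic_pl Neg f c d" "set (u # v # vs) \<subseteq> {c..d}"
  shows "zigzag (\<lambda>x. f (g x)) a b (map f (u # v # vs))"
  using assms
proof (induction vs arbitrary: a u v)
  case Nil
  then show ?case using lap_comp[of g a b u v f c d] unfolding list.map zigzag_two by simp
next
  case (Cons v' vs)
  obtain a' where a': "lap g a a' u v" "zigzag g a' b (v # v' # vs)" using Cons.prems(1) by auto
  have "zigzag (\<lambda>x. f (g x)) a' b (map f (v # v' # vs))"
    using Cons.IH[OF a'(2) Cons.prems(2)] Cons.prems(3) by simp
  moreover have "lap (\<lambda>x. f (g x)) a a' (f u) (f v)"
    using lap_comp[OF a'(1) Cons.prems(2)] Cons.prems(3) by simp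
  ultimately show ?case by auto
qed

lemma lap_reflect:
  assumes "lap g a b u v" shows "lap (\<lambda>x. g (1 - x)) (1 - b) (1 - a) v u"
proof -
  have "lap (\<lambda>x. 1 - x) (1 - b) (1 - a) b a"
  proof -
    have "dyadic_pl Neg (\<lambda>x. 1 - x) (1 - b) (1 - a)"
      by (rule dyadic_pl.affine[of _ _ "-1" _ 1])
        (use lap_dyadic[OF assms] lap_less[OF assms] Pos_powi[of 0] in \<open>auto simp: Neg_def\<close>)
    then show ?thesis by (simp add: lap_def)
  qed
  from lap_comp[OF this, of g a b] show ?thesis using assms lap_less[OF assms] by (auto simp: lap_def)
qed

lemma zigzag_reflect:
  "zigzag g a b vs \<Longrightarrow> zigzag (\<lambda>x. g (1 - x)) (1 - b) (1 - a) (rev vs)"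
proof (induction g a b vs rule: zigzag.induct)
  case (3 g a b u v vs)
  then obtain c where c: "lap g a c u v" "zigzag g c b (v # vs)" by auto
  have "zigzag (\<lambda>x. g (1 - x)) (1 - b) (1 - c) (rev vs @ [v])" using "3.IH"[OF c(2)] by simp
  moreover have "zigzag (\<lambda>x. g (1 - x)) (1 - c) (1 - a) [v, u]" using lap_reflect[OF c(1)] unfolding zigzag_two .
  ultimately have "zigzag (\<lambda>x. g (1 - x)) (1 - b) (1 - a) (rev vs @ [v, u])" using zigzag_append by blast
  then show ?case by simp
qed auto

section \<open>Factorisation of zigzags into folds\<close>

text \<open>Follow the list as long as each lap lies strictly inside the previous one. This stops at
  a monotone continuation, at a lap at least as long as its predecessor, or at the end of the list.
  If \<open>b = d\<close> and the list ends at \<open>d\<close>, unfolding would need a middle fold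
  with \<open>q = 1\<close>, which \<open>w3_bar\<close> does not provide; but then the last lap is
  not longer than its neighbour, and \<open>short_end\<close> applies.\<close>

lemma zigzag_cases:
  fixes x y z :: real
  assumes "distinct_adj (x # y # z # ws)" "x < z \<and> z < y \<or> y < z \<and> z < x"
  obtains (monotone) us a b c vs where "x # y # z # ws = us @ a # b # c # vs"
      "a < b \<and> b < c \<or> c < b \<and> b < a"
    | (short_end) us a b c where "x # y # z # ws = us @ [a, b, c]"
      "b < c \<and> c \<le> a \<or> a \<le> c \<and> c < b"
    | (short_middle) us a b c d vs where "x # y # z # ws = us @ a # b # c # d # vs"
      "a < c \<and> c < b \<and> b \<le> d \<or> d \<le> b \<and> b < c \<and> c < a" "vs \<noteq> [] \<or> b \<noteq> d"
  using assms
proof (induction ws arbitrary: x y z thesis)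
  case Nil
  show ?case by (rule Nil.prems(2)[of "[]" x y z]) (use Nil.prems(5) in auto)
next
  case (Cons w ws)
  note monotone = Cons.prems(1) and short_end = Cons.prems(2) and short_middle = Cons.prems(3)
  have zw: "z \<noteq> w" using Cons.prems(4) by simp
  consider "y < z \<and> z < w \<or> w < z \<and> z < y" | "y < w \<and> w < z \<or> z < w \<and> w < y"
    | "z < y \<and> y \<le> w \<or> w \<le> y \<and> y < z" "ws \<noteq> [] \<or> y \<noteq> w" | "ws = []" "y = w"
    using zw Cons.prems(5) by linarith
  then show ?case
  proof cases
    case 1
    show ?thesis by (rule monotone[of "[x]" y z w ws]) (use 1 in auto)
  next
    case 2
    show ?thesis
    proof (rule Cons.IH[of y z w])
      show "distinct_adj (y # z # w # ws)" using Cons.prems(4) by simp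
      show "y < w \<and> w < z \<or> z < w \<and> w < y" by (rule 2)
    next
      fix us a b c vs assume "y # z # w # ws = us @ a # b # c # vs" "a < b \<and> b < c \<or> c < b \<and> b < a"
      then show thesis by (intro monotone[of "x # us" a b c vs]) simp_all
    next
      fix us a b c assume "y # z # w # ws = us @ [a, b, c]" "b < c \<and> c \<le> a \<or> a \<le> c \<and> c < b"
      then show thesis by (intro short_end[of "x # us" a b c]) simp_all
    next
      fix us a b c d vs assume "y # z # w # ws = us @ a # b # c # d # vs"
        "a < c \<and> c < b \<and> b \<le> d \<or> d \<le> b \<and> b < c \<and> c < a" "vs \<noteq> [] \<or> b \<noteq> d"
      then show thesis by (intro short_middle[of "x # us" a b c d vs]) simp_all
    qed
  next
    case 3
    show ?thesis by (rule short_middle[of "[]" x y z w ws]) (use 3 Cons.prems(5) in auto)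
  next
    case 4
    show ?thesis by (rule short_end[of "[x]" y z w]) (use 4 Cons.prems(5) in auto)
  qed
qed

text \<open>Only the values on \<open>{0..1}\<close> count, so terms such as
  \<open>\<lambda>x. 1 - x\<close> can be used without restricting them each time.\<close>

definition rep_unit :: "(real \<Rightarrow> real) \<Rightarrow> bool" where
  "rep_unit g \<longleftrightarrow> g ` {0..1} \<subseteq> {0..1} \<and> representable (restrict g {0..1})"

lemma rep_unit_cong: "rep_unit h \<Longrightarrow> (\<And>x. x \<in> {0..1} \<Longrightarrow> g x = h x) \<Longrightarrow> rep_unit g"
  unfolding rep_unit_def by (metis image_cong restrict_ext)

lemma rep_unit_comp:
  assumes "rep_unit g" "rep_unit w" shows "rep_unit (\<lambda>x. g (w x))"
proof -
  have im: "g x \<in> {0..1}" "w x \<in> {0..1}" if "x \<in> {0..1}" for x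
    using assms that unfolding rep_unit_def by blast+
  have "representable (restrict g {0..1} \<bullet> restrict w {0..1})"
    by (rule representable_compose) (use assms im in \<open>auto simp: rep_unit_def\<close>)
  also have "restrict g {0..1} \<bullet> restrict w {0..1} = restrict (\<lambda>x. g (w x)) {0..1}"
    unfolding compose_def by (rule restrict_ext) (use im in auto)
  finally show ?thesis unfolding rep_unit_def by (intro conjI image_subsetI im)
qed

lemma rep_unit_dyadic_pl_Pos:
  assumes "dyadic_pl Pos f 0 1" "f 0 = 0" "f 1 = 1" shows "rep_unit f"
  unfolding rep_unit_def
  using dyadic_pl_image[OF assms(1)] representable_thompson_group[OF restrict_in_thompson_group[OF assms]] assms
  by simp

lemma rep_unit_generator:
  assumes "{g} \<in> generating_sets" shows "rep_unit g"
proof -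
  have "g \<in> selfmaps" using generating_sets_thompson_monoid[OF assms] by auto
  then have "restrict g {0..1} = g" "g ` {0..1} \<subseteq> {0..1}"
    by (auto simp: PiE_def extensional_restrict)
  then show ?thesis using representable_generator[OF assms] unfolding rep_unit_def by simp
qed

lemma rep_unit_flip: "rep_unit (\<lambda>x. 1 - x)"
  by (rule rep_unit_cong[OF rep_unit_generator[of g0_minus]]) (auto simp: generating_sets_def g0_minus_def)

lemma rep_unit_reflect: "rep_unit g \<Longrightarrow> rep_unit (\<lambda>x. g (1 - x))"
  by (rule rep_unit_comp[OF _ rep_unit_flip])

lemma rep_unit_complement: "rep_unit g \<Longrightarrow> rep_unit (\<lambda>x. 1 - g x)"
  by (rule rep_unit_comp[OF rep_unit_flip])

lemma rep_unit_zigzag: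
  assumes "zigzag g 0 1 (u # v # vs)" "zigzag h 0 1 (u # v # vs)" "rep_unit h" shows "rep_unit g"
proof -
  obtain f where f: "dyadic_pl Pos f 0 1" "f 0 = 0" "f 1 = 1" "\<forall>x\<in>{0..1}. g x = h (f x)"
    using zigzag_factor[OF assms(1,2)] by blast
  show ?thesis
    by (rule rep_unit_cong[OF rep_unit_comp[OF assms(3) rep_unit_dyadic_pl_Pos[OF f(1-3)]]]) (use f(4) in blast)
qed

lemma zigzag_complement:
  assumes "zigzag g a b (u # v # vs)" "dyadic c" "dyadic d" "c < d" "set (u # v # vs) \<subseteq> {c..d}"
  shows "zigzag (\<lambda>x. 1 - g x) a b (map (\<lambda>x. 1 - x) (u # v # vs))"
proof (rule zigzag_map[OF assms(1) _ assms(5)])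
  show "dyadic_pl Pos ((-) 1) c d \<or> dyadic_pl Neg ((-) 1) c d"
    by (rule disjI2, rule dyadic_pl.affine[of _ _ "-1" _ 1])
      (use assms Pos_powi[of 0] in \<open>auto simp: Neg_def\<close>)
qed

lemma lap_affine:
  assumes "\<And>x. x \<in> {a..b} \<Longrightarrow> g x = s * x + c" "s \<in> Sgn" "dyadic a" "dyadic b" "a < b" "dyadic c"
    "u = s * a + c" "v = s * b + c"
  shows "lap g a b u v"
proof -
  have "s \<in> Pos \<or> s \<in> Neg" using assms(2) by (simp add: Sgn_def)
  then have "dyadic_pl Pos g a b \<or> dyadic_pl Neg g a b"
    using dyadic_pl.affine[of a b s Pos c g] dyadic_pl.affine[of a b s Neg c g] assms by blast
  then show ?thesis using assms unfolding lap_def by auto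
qed

section \<open>The generators and the two families of folds\<close>

lemma zigzag_w2_full: "zigzag w2_full 0 1 [0, 1, 0]"
proof -
  have "lap w2_full 0 (1/2) 0 1"
    by (rule lap_affine[OF w2_full_affine(1)]) (simp_all add: Sgn_numeral)
  moreover have "lap w2_full (1/2) 1 1 0"
    by (rule lap_affine[OF w2_full_affine(2)]) (simp_all add: Sgn_numeral)
  ultimately show ?thesis unfolding zigzag.simps(3)[of _ _ _ _ _ "[0]"] zigzag_two by blast
qed

lemma zigzag_w2_right: "zigzag w2_right 0 1 [0, 1, 3/4]"
proof -
  have "lap w2_right 0 (3/4) 0 (3/4)"
    by (rule lap_affine[OF w2_right_affine(1)]) (simp_all add: Sgn_numeral)
  moreover have "lap w2_right (3/4) (7/8) (3/4) 1"
    by (rule lap_affine[OF w2_right_affine(2)]) (simp_all add: Sgn_numeral)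
  \<comment> \<open>The identity part and the first branch both rise, so together they form one
    lap.\<close>
  ultimately have "lap w2_right 0 (7/8) 0 1" by (rule lap_join) simp
  moreover have "lap w2_right (7/8) 1 1 (3/4)"
    by (rule lap_affine[OF w2_right_affine(3)]) (simp_all add: Sgn_numeral)
  ultimately show ?thesis unfolding zigzag.simps(3)[of _ _ _ _ _ "[3/4]"] zigzag_two by blast
qed

lemma zigzag_w3_bar: "zigzag w3_bar 0 1 [0, 1/2, 1/4, 1]"
proof -
  have "lap w3_bar 0 (1/4) 0 (1/4)"
    by (rule lap_affine[OF w3_bar_affine(1)]) (simp_all add: Sgn_numeral)
  moreover have "lap w3_bar (1/4) (3/8) (1/4) (1/2)"
    by (rule lap_affine[OF w3_bar_affine(2)]) (simp_all add: Sgn_numeral)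
  ultimately have 1: "lap w3_bar 0 (3/8) 0 (1/2)" by (rule lap_join) simp
  have 2: "lap w3_bar (3/8) (7/16) (1/2) (1/4)"
    by (rule lap_affine[OF w3_bar_affine(3)]) (simp_all add: Sgn_numeral)
  have "lap w3_bar (7/16) (1/2) (1/4) (1/2)"
    by (rule lap_affine[OF w3_bar_affine(4)]) (simp_all add: Sgn_numeral)
  moreover have "lap w3_bar (1/2) 1 (1/2) 1"
    by (rule lap_affine[OF w3_bar_affine(5)]) (simp_all add: Sgn_numeral)
  ultimately have 3: "lap w3_bar (7/16) 1 (1/4) 1" by (rule lap_join) simp
  show ?thesis unfolding zigzag.simps(3)[of _ _ _ _ _ "[1/4, 1]"] zigzag.simps(3)[of _ _ _ _ _ "[1]"] zigzag_two
    using 1 2 3 by blast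
qed

text \<open>Used repeatedly, it yields group elements through prescribed dyadic points.\<close>

lemma dyadic_pl_extend:
  assumes "dyadic_pl Pos f a b" "dyadic c" "b < c" "dyadic (f b)" "dyadic d" "f b < d"
  obtains h where "dyadic_pl Pos h a c" "h c = d" "\<And>x. x \<le> b \<Longrightarrow> h x = f x"
proof -
  obtain k where k: "dyadic_pl Pos k b c" "k b = f b" "k c = d"
    using dyadic_pl_interpolate[OF dyadic_pl_dyadic(2)[OF assms(1)] assms(2-6)] .
  show ?thesis
    by (rule that[OF dyadic_pl_glue[OF assms(1) k(1)]]) (use k assms in auto)
qed

text \<open>Reflected in both coordinates, \<open>w2_right\<close> has the list
  \<open>[1/4, 0, 1]\<close>, and a group element taking 1/4 to \<open>p\<close> does the rest. As
  the group is injective and fixes 1, the value \<open>p = 1\<close> is out of its reach; there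
  \<open>w2_full\<close> is turned upside down.\<close>

lemma rep_unit_end_fold:
  assumes w: "zigzag w 0 1 [p, 0, 1]" and p: "0 < p" "p \<le> 1"
  shows "rep_unit w"
proof (cases "p = 1")
  case True
  have "zigzag (\<lambda>x. 1 - w2_full x) 0 1 (map (\<lambda>x. 1 - x) [0, 1, 0])"
    by (rule zigzag_complement[OF zigzag_w2_full, of 0 1]) auto
  then have "zigzag (\<lambda>x. 1 - w2_full x) 0 1 [1, 0, 1]" by (simp del: zigzag.simps)
  moreover have "rep_unit (\<lambda>x. 1 - w2_full x)"
    by (rule rep_unit_complement[OF rep_unit_generator]) (simp add: generating_sets_def)
  ultimately show ?thesis using w rep_unit_zigzag unfolding True by blast
next
  case False
  have dp: "dyadic p" by (rule zigzag_dyadic[OF w]) simp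
  define h where "h x = 1 - w2_right (1 - x)" for x
  have "zigzag (\<lambda>x. w2_right (1 - x)) 0 1 [3/4, 1, 0]"
    using zigzag_reflect[OF zigzag_w2_right] by (simp del: zigzag.simps)
  then have "zigzag h 0 1 (map (\<lambda>x. 1 - x) [3/4, 1, 0])"
    unfolding h_def by (rule zigzag_complement[of _ _ _ _ _ _ 0 1]) auto
  then have h: "zigzag h 0 1 [1/4, 0, 1]" by (simp del: zigzag.simps)
  have rh: "rep_unit h" unfolding h_def
    by (rule rep_unit_complement[OF rep_unit_reflect[OF rep_unit_generator]]) (simp add: generating_sets_def)
  obtain k where k: "dyadic_pl Pos k 0 (1/4)" "k 0 = 0" "k (1/4) = p"
    by (rule dyadic_pl_interpolate[of 0 "1/4" 0 p]) (use p dp in auto)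
  obtain f where f: "dyadic_pl Pos f 0 1" "f 1 = 1" "\<And>x. x \<le> 1/4 \<Longrightarrow> f x = k x"
    by (rule dyadic_pl_extend[OF k(1), of 1 1]) (use p dp k False in auto)
  have "zigzag (\<lambda>x. f (h x)) 0 1 (map f [1/4, 0, 1])"
    by (rule zigzag_map[OF h, of f 0 1]) (use f in auto)
  then have "zigzag (\<lambda>x. f (h x)) 0 1 [p, 0, 1]" using f k by (simp del: zigzag.simps)
  moreover have "rep_unit (\<lambda>x. f (h x))"
    by (rule rep_unit_comp[OF rep_unit_dyadic_pl_Pos rh]) (use f k in auto)
  ultimately show ?thesis using w rep_unit_zigzag by blast
qed

text \<open>Compose \<open>w3_bar\<close>, with list \<open>[0, 1/2, 1/4, 1]\<close>, with a group
  element that takes 1/4 to \<open>p\<close> and 1/2 to \<open>q\<close>.\<close>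

lemma rep_unit_middle_fold:
  assumes w: "zigzag w 0 1 [0, q, p, 1]" and pq: "0 < p" "p < q" "q < 1"
  shows "rep_unit w"
proof -
  have d: "dyadic p" "dyadic q" by (rule zigzag_dyadic[OF w]; simp)+
  obtain k where k: "dyadic_pl Pos k 0 (1/4)" "k 0 = 0" "k (1/4) = p"
    by (rule dyadic_pl_interpolate[of 0 "1/4" 0 p]) (use pq d in auto)
  obtain m where m: "dyadic_pl Pos m 0 (1/2)" "m (1/2) = q" "\<And>x. x \<le> 1/4 \<Longrightarrow> m x = k x"
    by (rule dyadic_pl_extend[OF k(1), of "1/2" q]) (use pq d k in auto)
  obtain f where f: "dyadic_pl Pos f 0 1" "f 1 = 1" "\<And>x. x \<le> 1/2 \<Longrightarrow> f x = m x"
    by (rule dyadic_pl_extend[OF m(1), of 1 1]) (use pq d m in auto)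
  have "zigzag (\<lambda>x. f (w3_bar x)) 0 1 (map f [0, 1/2, 1/4, 1])"
    by (rule zigzag_map[OF zigzag_w3_bar, of f 0 1]) (use f in auto)
  then have "zigzag (\<lambda>x. f (w3_bar x)) 0 1 [0, q, p, 1]" using f m k by (simp del: zigzag.simps)
  moreover have "rep_unit (\<lambda>x. f (w3_bar x))"
    by (rule rep_unit_comp[OF rep_unit_dyadic_pl_Pos rep_unit_generator])
      (use f m k in \<open>auto simp: generating_sets_def\<close>)
  ultimately show ?thesis using w rep_unit_zigzag by blast
qed

section \<open>Shortening the list of lap values\<close>

lemma zigzag_ConsE:
  assumes "zigzag g a b (u # v # vs)"
  obtains c where "lap g a c u v" "zigzag g c b (v # vs)"
  using assms unfolding zigzag.simps(3) by blast

lemma zigzag_ConsI: "lap g a c u v \<Longrightarrow> zigzag g c b (v # vs) \<Longrightarrow> zigzag g a b (u # v # vs)"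
  unfolding zigzag.simps(3) by blast

lemma zigzag_merge:
  assumes "zigzag g p q (us @ a # b # c # vs)" "a < b \<and> b < c \<or> c < b \<and> b < a"
  shows "zigzag g p q (us @ a # c # vs)"
proof -
  obtain r where r: "zigzag g p r (us @ [a])" "zigzag g r q (a # b # c # vs)"
    using assms(1) zigzag_append by blast
  obtain s where s: "lap g r s a b" "zigzag g s q (b # c # vs)" using r(2) by (rule zigzag_ConsE)
  obtain t where t: "lap g s t b c" "zigzag g t q (c # vs)" using s(2) by (rule zigzag_ConsE)
  have "zigzag g r q (a # c # vs)" using lap_join[OF s(1) t(1) assms(2)] t(2) by (rule zigzag_ConsI)
  then show ?thesis using r(1) zigzag_append by blast
qed

lemma lap_less_iff:
  assumes "lap g a b u v" "p \<in> {a..b}" "q \<in> {a..b}"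
  shows "u < v \<Longrightarrow> g p < g q \<longleftrightarrow> p < q" "v < u \<Longrightarrow> g p < g q \<longleftrightarrow> q < p"
proof -
  have *: "g p < g q \<longleftrightarrow> p < q" if "lap g a b u v" "u < v" for g u v
  proof -
    have "dyadic_pl Pos g a b" using that lap_Pos_iff by blast
    from strict_mono_on_less[OF dyadic_pl_strict_mono[OF this] assms(2,3)] show ?thesis .
  qed
  show "u < v \<Longrightarrow> g p < g q \<longleftrightarrow> p < q" using *[OF assms(1)] .
  have **: "g q < g p \<longleftrightarrow> p < q" if "v < u"
    using *[OF lap_uminus[OF assms(1)]] that by simp
  show "g p < g q \<longleftrightarrow> q < p" if "v < u"
  proof -
    have "dyadic_pl Pos (\<lambda>x. - g x) a b" using lap_Pos_iff[OF lap_uminus[OF assms(1)]] that by simp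
    from strict_mono_on_less[OF dyadic_pl_strict_mono[OF this] assms(3,2)] show ?thesis by simp
  qed
qed

lemma lap_id: "dyadic a \<Longrightarrow> dyadic b \<Longrightarrow> a < b \<Longrightarrow> (\<And>x. x \<in> {a..b} \<Longrightarrow> g x = x) \<Longrightarrow> lap g a b a b"
  by (rule lap_affine[of a b g 1 0]) (auto simp: Sgn_numeral)

text \<open>The values of the first lap all occur on the second one, so the first lap can be
  retraced on it. Let \<open>h\<close> have the list without \<open>x\<close>, and let
  \<open>h p = x\<close> on its first lap \<open>[0, b]\<close>. The fold \<open>w\<close> runs from
  \<open>p\<close> down to 0, back up to \<open>b\<close>, and is the identity afterwards; then
  \<open>h \<circ> w\<close> has the full list.\<close>

lemma rep_unit_zigzag_end:
  assumes g: "zigzag g 0 1 (x # y # z # ws)" and xyz: "y < x \<and> x \<le> z \<or> z \<le> x \<and> x < y"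
    and IH: "\<And>h. zigzag h 0 1 (y # z # ws) \<Longrightarrow> rep_unit h"
  shows "rep_unit g"
proof -
  have dy: "dyadic u" if "u \<in> set (x # y # z # ws)" for u by (rule zigzag_dyadic[OF g that])
  have "distinct_adj (x # y # z # ws)" using g by (rule zigzag_distinct_adj)
  then obtain h where h: "zigzag h 0 1 (y # z # ws)"
    using zigzag_exists[of 0 1 y z ws] dy by auto
  obtain b where b: "lap h 0 b y z" "zigzag h b 1 (z # ws)" using h by (rule zigzag_ConsE)
  have b1: "0 < b" "b \<le> 1" using lap_less[OF b(1)] zigzag_le[OF b(2)] by auto
  have db: "dyadic b" using lap_dyadic[OF b(1)] by blast
  have hd: "dyadic_pl Pos h 0 b \<or> dyadic_pl Neg h 0 b" and h0: "h 0 = y" "h b = z" using b(1) by (auto simp: lap_def)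
  have dx: "dyadic x" by (rule dy) simp
  have mm: "min y z \<le> x" "x \<le> max y z" using xyz by auto
  obtain p where p: "dyadic p" "p \<in> {0..b}" "h p = x"
    using lap_preimage[OF b(1) dx mm] .
  have p0: "0 < p" using p h0 xyz by (cases "p = 0") auto
  have "\<exists>w0. zigzag w0 0 b [p, 0, b]"
    by (rule zigzag_exists) (use db p b1 p0 in auto)
  then obtain w0 where w0: "zigzag w0 0 b [p, 0, b]" ..
  obtain t where t: "lap w0 0 t p 0" "lap w0 t b 0 b" using w0 unfolding zigzag.simps(3)[of _ _ _ _ _ "[b]"] zigzag_two by blast
  define w where "w x = (if x \<le> b then w0 x else x)" for x
  have tb: "t < b" "0 < t" using t lap_less by blast+
  have s1: "lap w 0 t p 0" by (rule lap_cong[OF t(1)]) (use tb in \<open>auto simp: w_def\<close>)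
  have s2: "lap w t b 0 b" by (rule lap_cong[OF t(2)]) (auto simp: w_def)
  have id: "w x = x" if "x \<in> {b..1}" for x
    using that t(2) by (cases "x = b") (auto simp: w_def lap_def)
  \<comment> \<open>The rise from 0 to \<open>b\<close> and the identity beyond \<open>b\<close>
    form one lap, so the list of \<open>w\<close> is \<open>[p, 0, 1]\<close>.\<close>
  have "lap w t 1 0 1"
  proof (cases "b = 1")
    case False
    then have "lap w b 1 b 1" using b1 db id by (intro lap_id) auto
    from lap_join[OF s2 this] False b1 show ?thesis by auto
  qed (use s2 in simp)
  then have "zigzag w 0 1 [p, 0, 1]" using s1 unfolding zigzag.simps(3)[of _ _ _ _ _ "[1]"] zigzag_two by blast
  then have "rep_unit w" using p0 p(2) b1 by (intro rep_unit_end_fold[of w p]) auto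
  then have rep_unit: "rep_unit (\<lambda>x. h (w x))" using IH[OF h] by (rule rep_unit_comp[rotated])
  have "lap (\<lambda>x. h (w x)) 0 t x y"
    using lap_comp[OF s1 hd] p b1 h0 by simp
  moreover have "lap (\<lambda>x. h (w x)) t b y z"
    using lap_comp[OF s2 hd] b1 h0 by simp
  moreover have "zigzag (\<lambda>x. h (w x)) b 1 (z # ws)"
    by (rule zigzag_cong[OF b(2)]) (use id in simp)
  ultimately have "zigzag (\<lambda>x. h (w x)) 0 1 (x # y # z # ws)" by (intro zigzag_ConsI)
  then show ?thesis using g rep_unit rep_unit_zigzag by blast
qed

lemma list_length_ge_2E:
  assumes "2 \<le> length vs" obtains u v ws where "vs = u # v # ws"
  using assms by (cases vs; cases "tl vs") auto

text \<open>As the lap from \<open>b\<close> to \<open>c\<close> lies inside both neighbours, the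
  values \<open>a, b, c, d\<close> arise from moving to and fro along one lap of \<open>h\<close>
  from \<open>a\<close> to \<open>d\<close>. If this lap lives on \<open>[l, r]\<close> with
  \<open>h q = b\<close> and \<open>h p = c\<close>, the fold \<open>w\<close> runs
  \<open>l, q, p, r\<close> there and is the identity elsewhere.\<close>

lemma rep_unit_zigzag_middle:
  assumes g: "zigzag g 0 1 (us @ a # b # c # d # vs)"
    and abcd: "a < c \<and> c < b \<and> b \<le> d \<or> d \<le> b \<and> b < c \<and> c < a" and ne: "vs \<noteq> [] \<or> b \<noteq> d"
    and IH: "\<And>h. zigzag h 0 1 (us @ a # d # vs) \<Longrightarrow> rep_unit h"
  shows "rep_unit g"
proof -
  have "2 \<le> length (us @ a # b # c # d # vs)" by simp
  then obtain u v ws where uv: "us @ a # b # c # d # vs = u # v # ws"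
    by (rule list_length_ge_2E)
  have dy: "dyadic x" if "x \<in> set (us @ a # b # c # d # vs)" for x
    using zigzag_dyadic[OF g[unfolded uv]] that unfolding uv .
  have da: "distinct_adj (us @ a # d # vs)"
    using zigzag_distinct_adj[OF g] abcd by (auto simp: distinct_adj_append_iff)
  have "2 \<le> length (us @ a # d # vs)" by simp
  then obtain u' v' ws' where uv': "us @ a # d # vs = u' # v' # ws'"
    by (rule list_length_ge_2E)
  have dy': "dyadic x" if "x \<in> set (us @ a # d # vs)" for x using that dy by auto
  obtain h where h: "zigzag h 0 1 (us @ a # d # vs)"
    using zigzag_exists[of 0 1 u' v' ws'] da dy' unfolding uv' by auto
  obtain l where l: "zigzag h 0 l (us @ [a])" "zigzag h l 1 (a # d # vs)" using h zigzag_append by blast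
  obtain r where r: "lap h l r a d" "zigzag h r 1 (d # vs)" using l(2) by (rule zigzag_ConsE)
  have lr: "0 \<le> l" "l < r" "r \<le> 1" using zigzag_le[OF l(1)] lap_less[OF r(1)] zigzag_le[OF r(2)] by auto
  have dlr: "dyadic l" "dyadic r" using lap_dyadic[OF r(1)] by blast+
  have hd: "dyadic_pl Pos h l r \<or> dyadic_pl Neg h l r" and hlr: "h l = a" "h r = d" using r(1) by (auto simp: lap_def)
  have dbc: "dyadic b" "dyadic c" by (rule dy; simp)+
  have mm: "min a d \<le> b" "b \<le> max a d" "min a d \<le> c" "c \<le> max a d" using abcd by auto
  obtain p where p: "dyadic p" "p \<in> {l..r}" "h p = c" using lap_preimage[OF r(1) dbc(2) mm(3,4)] .
  obtain q where q: "dyadic q" "q \<in> {l..r}" "h q = b" using lap_preimage[OF r(1) dbc(1) mm(1,2)] .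
  have pl: "l < p" using p hlr abcd by (cases "p = l") auto
  \<comment> \<open>Either \<open>h\<close> increases on the lap and \<open>c < b\<close>, or it
    decreases and \<open>b < c\<close>; both put \<open>p\<close> before \<open>q\<close>.\<close>
  have pq: "p < q"
    using lap_less_iff[OF r(1) p(2) q(2)] lap_less_iff[OF r(1) q(2) p(2)] p q abcd by auto
  \<comment> \<open>\<open>q = 1\<close> would force \<open>r = 1\<close> and \<open>b = d\<close>,
    so \<open>d\<close> would be the last entry of the list, contrary to \<open>ne\<close>.\<close>
  have q1: "q < 1"
  proof (rule ccontr)
    assume "\<not> q < 1"
    then have "q = r" "r = 1" using q lr by auto
    then have "b = d" using q hlr by simp
    then obtain v' vs' where "vs = v' # vs'" using ne by (cases vs) auto
    then have "r < 1" using r(2) zigzag_less by blast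
    then show False using \<open>r = 1\<close> by simp
  qed
  obtain w0 where w0: "zigzag w0 l r [l, q, p, r]"
    using zigzag_exists[of l r l q "[p, r]"] dlr p q lr pl pq by auto
  obtain s where s: "lap w0 l s l q" "zigzag w0 s r [q, p, r]" using w0 by (rule zigzag_ConsE)
  obtain t where t: "lap w0 s t q p" "zigzag w0 t r [p, r]" using s(2) by (rule zigzag_ConsE)
  have t3: "lap w0 t r p r" using t(2) unfolding zigzag_two .
  have lst: "l < s" "s < t" "t < r" using lap_less s(1) t(1) t3 by blast+
  define w where "w x = (if x \<in> {l..r} then w0 x else x)" for x
  have s1: "lap w l s l q" by (rule lap_cong[OF s(1)]) (use lst in \<open>auto simp: w_def\<close>)
  have s2: "lap w s t q p" by (rule lap_cong[OF t(1)]) (use lst in \<open>auto simp: w_def\<close>)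
  have s3: "lap w t r p r" by (rule lap_cong[OF t3]) (use lst in \<open>auto simp: w_def\<close>)
  have idl: "w x = x" if "x \<in> {0..l}" for x
    using that s(1) lr by (cases "x = l") (auto simp: w_def lap_def)
  have idr: "w x = x" if "x \<in> {r..1}" for x
    using that t3 lr by (cases "x = r") (auto simp: w_def lap_def)
  have "lap w 0 s 0 q"
  proof (cases "l = 0")
    case False
    then have "lap w 0 l 0 l" using lr dlr idl by (intro lap_id) auto
    from lap_join[OF this s1] False lr pl pq show ?thesis by auto
  qed (use s1 in simp)
  moreover have "lap w t 1 p 1"
  proof (cases "r = 1")
    case False
    then have "lap w r 1 r 1" using lr dlr idr by (intro lap_id) auto
    from lap_join[OF s3 this] False lr pq q show ?thesis by auto
  qed (use s3 in simp)
  ultimately have "zigzag w 0 1 [0, q, p, 1]"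
    using s2 unfolding zigzag.simps(3)[of _ _ _ _ _ "[p, 1]"] zigzag.simps(3)[of _ _ _ _ _ "[1]"] zigzag_two by blast
  then have "rep_unit w" using lr pl pq q1 by (intro rep_unit_middle_fold[of w q p]) auto
  then have rep_unit: "rep_unit (\<lambda>x. h (w x))" using IH[OF h] by (rule rep_unit_comp[rotated])
  have "lap (\<lambda>x. h (w x)) l s a b"
    using lap_comp[OF s1 hd] q lr hlr by simp
  moreover have "lap (\<lambda>x. h (w x)) s t b c"
    using lap_comp[OF s2 hd] p q by simp
  moreover have "lap (\<lambda>x. h (w x)) t r c d"
    using lap_comp[OF s3 hd] p lr hlr by simp
  moreover have "zigzag (\<lambda>x. h (w x)) r 1 (d # vs)"
    by (rule zigzag_cong[OF r(2)]) (use idr in simp)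
  ultimately have "zigzag (\<lambda>x. h (w x)) l 1 (a # b # c # d # vs)" by (intro zigzag_ConsI)
  moreover have "zigzag (\<lambda>x. h (w x)) 0 l (us @ [a])"
    by (rule zigzag_cong[OF l(1)]) (use idl in simp)
  ultimately have "zigzag (\<lambda>x. h (w x)) 0 1 (us @ a # b # c # d # vs)" using zigzag_append by blast
  then show ?thesis using g rep_unit rep_unit_zigzag unfolding uv by blast
qed

text \<open>The bounds on \<open>set vs\<close> survive every shortening, since a deleted entry
  equal to 0 or 1 also occurs among the remaining ones. They force a list of two entries to be
  \<open>[0, 1]\<close> or \<open>[1, 0]\<close>.\<close>

lemma rep_unit_zigzag_all:
  assumes "zigzag g 0 1 vs" "{0, 1} \<subseteq> set vs" "set vs \<subseteq> {0..1}"
  shows "rep_unit g"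
  using assms
proof (induction "length vs" arbitrary: vs g rule: less_induct)
  case less
  have "2 \<le> length vs"
    using less.prems(2) card_mono[OF finite_set less.prems(2)] card_length[of vs] by simp
  then obtain x y ws where vs: "vs = x # y # ws" by (rule list_length_ge_2E)
  show ?case
  proof (cases ws)
    case Nil
    then consider "vs = [0, 1]" | "vs = [1, 0]" using less.prems(2) vs by auto
    then show ?thesis
    proof cases
      case 1
      then have s: "lap g 0 1 0 1" using less.prems(1) by simp
      then have "dyadic_pl Pos g 0 1" using lap_Pos_iff by force
      then show ?thesis by (rule rep_unit_dyadic_pl_Pos) (use s in \<open>auto simp: lap_def\<close>)
    next
      case 2
      then have s: "lap g 0 1 1 0" using less.prems(1) by simp
      then have s': "lap (\<lambda>x. g (1 - x)) 0 1 0 1" using lap_reflect by fastforce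
      then have "dyadic_pl Pos (\<lambda>x. g (1 - x)) 0 1" using lap_Pos_iff by force
      then have "rep_unit (\<lambda>x. g (1 - x))" by (rule rep_unit_dyadic_pl_Pos) (use s' in \<open>auto simp: lap_def\<close>)
      from rep_unit_reflect[OF this] show ?thesis by simp
    qed
  next
    case (Cons z zs)
    then have vs: "vs = x # y # z # zs" using vs by simp
    have da: "distinct_adj vs" using zigzag_distinct_adj[OF less.prems(1)] .
    note IH = less.hyps
    have merge: ?thesis
      if "vs = us @ a # b # c # cs" "a < b \<and> b < c \<or> c < b \<and> b < a" for us a b c cs
    proof (rule IH[of "us @ a # c # cs"])
      show "zigzag g 0 1 (us @ a # c # cs)" using zigzag_merge less.prems(1) that by blast
      show "{0, 1} \<subseteq> set (us @ a # c # cs)" using less.prems(2,3) that by auto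
    qed (use less.prems(3) that in auto)
    consider "x < y \<and> y < z \<or> z < y \<and> y < x" | "y < x \<and> x \<le> z \<or> z \<le> x \<and> x < y"
      | "x < z \<and> z < y \<or> y < z \<and> z < x"
      using da vs by (simp add: distinct_adj_Cons_Cons) linarith
    then show ?thesis
    proof cases
      case 1
      then show ?thesis using merge[of "[]" x y z zs] vs by simp
    next
      case 2
      show ?thesis
      proof (rule rep_unit_zigzag_end[OF less.prems(1)[unfolded vs] 2])
        fix h assume "zigzag h 0 1 (y # z # zs)"
        then show "rep_unit h" by (rule IH[rotated]) (use less.prems(2,3) 2 vs in auto)
      qed
    next
      case 3
      show ?thesis
      proof (rule zigzag_cases[OF da[unfolded vs] 3, folded vs])
        fix us a b c cs assume "vs = us @ a # b # c # cs" "a < b \<and> b < c \<or> c < b \<and> b < a"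
        then show ?thesis by (rule merge)
      next
        fix us a b c assume 2: "vs = us @ [a, b, c]" "b < c \<and> c \<le> a \<or> a \<le> c \<and> c < b"
        \<comment> \<open>Reflecting the domain turns a short last lap into a short first
          one.\<close>
        have "zigzag (\<lambda>x. g (1 - x)) (1 - 1) (1 - 0) (rev vs)" using zigzag_reflect[OF less.prems(1)] .
        then have "zigzag (\<lambda>x. g (1 - x)) 0 1 (c # b # a # rev us)" using 2(1) by (simp del: zigzag.simps)
        then have "rep_unit (\<lambda>x. g (1 - x))"
        proof (rule rep_unit_zigzag_end)
          show "b < c \<and> c \<le> a \<or> a \<le> c \<and> c < b" by (rule 2)
          fix h assume "zigzag h 0 1 (b # a # rev us)"
          then show "rep_unit h" by (rule IH[rotated]) (use less.prems(2,3) 2 in auto)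
        qed
        from rep_unit_reflect[OF this] show ?thesis by simp
      next
        fix us a b c d cs assume 3: "vs = us @ a # b # c # d # cs"
          "a < c \<and> c < b \<and> b \<le> d \<or> d \<le> b \<and> b < c \<and> c < a" "cs \<noteq> [] \<or> b \<noteq> d"
        show ?thesis
        proof (rule rep_unit_zigzag_middle[OF less.prems(1)[unfolded 3(1)] 3(2,3)])
          have sub: "a \<in> {0..1}" "b \<in> {0..1}" "c \<in> {0..1}" "d \<in> {0..1}"
            using less.prems(3) unfolding 3(1) by simp_all
          \<comment> \<open>\<open>c\<close> lies strictly between \<open>a\<close> and
            \<open>b\<close>, hence is not extreme; \<open>b\<close> lies between \<open>a\<close>
            and \<open>d\<close> and differs from \<open>a\<close>, so an extreme \<open>b\<close>
            equals \<open>d\<close>.\<close>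
          then have "c \<noteq> 0" "c \<noteq> 1" "b = 0 \<Longrightarrow> d = 0" "b = 1 \<Longrightarrow> d = 1" using 3(2) by auto
          then have ends: "{0, 1} \<subseteq> set (us @ a # d # cs)"
            using less.prems(2) unfolding 3(1) by auto
          fix h assume "zigzag h 0 1 (us @ a # d # cs)"
          then show "rep_unit h" by (rule IH[rotated, OF _ ends]) (use less.prems(3) 3(1) in auto)
        qed
      qed
    qed
  qed
qed

text \<open>The extrema of a zigzag occur at end points of laps, so surjectivity puts 0 and 1 into
  the list.\<close>

lemma thompson_monoid_representable:
  assumes g: "g \<in> thompson_monoid" shows "representable g"
proof -
  have d: "dyadic_pl Sgn g 0 1" and im: "g ` {0..1} = {0..1}" and ext: "g \<in> extensional {0..1}"
    using g by (auto simp: thompson_monoid_iff)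
  obtain vs where vs: "zigzag g 0 1 vs" using dyadic_pl_Sgn_zigzag[OF d] by blast
  have sub: "set vs \<subseteq> {0..1}" using zigzag_mem_image[OF vs] im by simp
  have ne: "vs \<noteq> []" using vs by auto
  define l r where "l = Min (set vs)" and "r = Max (set vs)"
  have lr: "l \<in> set vs" "r \<in> set vs" "set vs \<subseteq> {l..r}" using ne by (auto simp: l_def r_def)
  have "g ` {0..1} \<subseteq> {l..r}" by (intro image_subsetI zigzag_value[OF vs _ lr(3)])
  then have "l \<le> 0" "1 \<le> r" unfolding im by simp_all
  moreover have "l \<in> {0..1}" "r \<in> {0..1}" using lr(1,2) sub by blast+
  ultimately have "l = 0" "r = 1" by simp_all
  then have "rep_unit g" using rep_unit_zigzag_all[OF vs _ sub] lr by auto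
  then show ?thesis using ext by (simp add: rep_unit_def extensional_restrict)
qed

theorem theorem39:
  shows "(\<exists>e. monoid \<lparr>carrier = eproducts, mult = (\<odot>), one = e\<rparr> \<and>
              finitely_generated_monoid \<lparr>carrier = eproducts, mult = (\<odot>), one = e\<rparr>) \<and>
         \<Union>eproducts \<subseteq> eclass ` thompson_monoid \<and>
         \<Union>(\<Union>eproducts) = thompson_monoid"
proof (intro conjI)
  show "\<exists>e. monoid \<lparr>carrier = eproducts, mult = (\<odot>), one = e\<rparr> \<and>
      finitely_generated_monoid \<lparr>carrier = eproducts, mult = (\<odot>), one = e\<rparr>"
    using monoid_eproducts finitely_generated_eproducts by blast
  show "\<Union>eproducts \<subseteq> eclass ` thompson_monoid"
    using class_set_eproducts unfolding class_set_def by blast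
  show "\<Union>(\<Union>eproducts) = thompson_monoid"
  proof (intro equalityI subsetI)
    fix g assume "g \<in> \<Union>(\<Union>eproducts)"
    then obtain A where A: "A \<in> eproducts" "g \<in> \<Union>A" by blast
    show "g \<in> thompson_monoid" by (rule class_set_mem[OF class_set_eproducts[OF A(1)] A(2)])
  next
    fix g assume "g \<in> thompson_monoid"
    then show "g \<in> \<Union>(\<Union>eproducts)"
      by (intro representable_Union_eproducts thompson_monoid_representable)
  qed
qed

end
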